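(* Let $N_n$ be chosen uniformly at random among all labeled simplex galled trees with $n$ leaves, and let $S_n^{(\ell,\max)}=S^+(N_n)$, $S_n^{(\ell,\min)}=S^-(N_n)$. Then, as $n\to\infty$, \[ \mathbb{E}\big(S_n^{(\ell,\max)}\big)\sim\sqrt{\tfrac{2+\sqrt2}{2}}\,\sqrt{\pi}\,n^{3/2}\quad\text{and}\quad \mathbb{E}\big(S_n^{(\ell,\min)}\big)\sim\sqrt{\tfrac{2+\sqrt2}{2}}\,\sqrt{\pi}\,n^{3/2}. \]
   Context: A (rooted, binary) phylogenetic network is a finite acyclic directed graph without multiple edges whose nodes are: a unique root (indegree 0, outdegree 2), leaves (indegree 1, outdegree 0), tree nodes (indegree 1, outdegree 2), and reticulation nodes (indegree 2, outdegree 1). A tree-cycle (gall) is a pair of edge-disjoint directed paths from a tree node (or the root) to a reticulation node all of whose intermediate nodes are tree nodes. A galled tree is a phylogenetic network in which every reticulation node lies in a tree-cycle and any two tree-cycles are node-disjoint. A galled tree is simplex if the child of every reticulation node is a leaf. A labeled network with $n$ leaves has its leaves bijectively labeled by $\{1,\dots,n\}$; two such are identified if there is a digraph isomorphism preserving leaf labels. For a leaf $x$, $h^+(x)$ (resp. $h^-(x)$) is the length of a longest (resp. shortest) directed path from the root to $x$; $S^+(N)=\sum_x h^+(x)$ and $S^-(N)=\sum_x h^-(x)$ over all leaves $x$ of $N$. *)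

theory Defs
  imports Complex_Main "HOL-Library.Landau_Symbols"
begin

text \<open>A directed graph on natural-number vertices: (vertex set, arc set).
  Leaves are labelled by being literally the vertices 1..n.\<close>
type_synonym net = "nat set \<times> (nat \<times> nat) set"

definition verts :: "net \<Rightarrow> nat set" where "verts G = fst G"
definition arcs :: "net \<Rightarrow> (nat \<times> nat) set" where "arcs G = snd G"

definition indeg :: "net \<Rightarrow> nat \<Rightarrow> nat" where
  "indeg G v = card {u. (u, v) \<in> arcs G}"
definition outdeg :: "net \<Rightarrow> nat \<Rightarrow> nat" where
  "outdeg G v = card {w. (v, w) \<in> arcs G}"

definition is_root :: "net \<Rightarrow> nat \<Rightarrow> bool" where
  "is_root G v \<longleftrightarrow> v \<in> verts G \<and> indeg G v = 0 \<and> outdeg G v = 2"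
definition is_leaf :: "net \<Rightarrow> nat \<Rightarrow> bool" where
  "is_leaf G v \<longleftrightarrow> v \<in> verts G \<and> indeg G v = 1 \<and> outdeg G v = 0"
definition is_tree_node :: "net \<Rightarrow> nat \<Rightarrow> bool" where
  "is_tree_node G v \<longleftrightarrow> v \<in> verts G \<and> indeg G v = 1 \<and> outdeg G v = 2"
definition is_reticulation :: "net \<Rightarrow> nat \<Rightarrow> bool" where
  "is_reticulation G v \<longleftrightarrow> v \<in> verts G \<and> indeg G v = 2 \<and> outdeg G v = 1"

definition leaves :: "net \<Rightarrow> nat set" where
  "leaves G = {v. is_leaf G v}"

text \<open>Rooted binary phylogenetic network (no multiple arcs since arcs form a set).\<close>
definition is_network :: "net \<Rightarrow> bool" where
  "is_network G \<longleftrightarrow> finite (verts G) \<and> arcs G \<subseteq> verts G \<times> verts G \<and> acyclic (arcs G)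
     \<and> (\<exists>!r. r \<in> verts G \<and> indeg G r = 0)
     \<and> (\<forall>v \<in> verts G. is_root G v \<or> is_leaf G v \<or> is_tree_node G v \<or> is_reticulation G v)"

definition root :: "net \<Rightarrow> nat" where
  "root G = (THE r. r \<in> verts G \<and> indeg G r = 0)"

definition dpath :: "net \<Rightarrow> nat list \<Rightarrow> bool" where
  "dpath G p \<longleftrightarrow> p \<noteq> [] \<and> (\<forall>i. Suc i < length p \<longrightarrow> (p ! i, p ! Suc i) \<in> arcs G)"

definition path_arcs :: "nat list \<Rightarrow> (nat \<times> nat) set" where
  "path_arcs p = set (zip p (tl p))"

definition tree_cycle :: "net \<Rightarrow> nat list \<Rightarrow> nat list \<Rightarrow> bool" where
  "tree_cycle G P Q \<longleftrightarrow> dpath G P \<and> dpath G Q \<and> length P \<ge> 2 \<and> length Q \<ge> 2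
     \<and> hd P = hd Q \<and> last P = last Q
     \<and> (is_tree_node G (hd P) \<or> is_root G (hd P))
     \<and> is_reticulation G (last P)
     \<and> path_arcs P \<inter> path_arcs Q = {}
     \<and> (\<forall>x \<in> set (butlast (tl P)) \<union> set (butlast (tl Q)). is_tree_node G x)"

definition is_galled_tree :: "net \<Rightarrow> bool" where
  "is_galled_tree G \<longleftrightarrow> is_network G
     \<and> (\<forall>v. is_reticulation G v \<longrightarrow> (\<exists>P Q. tree_cycle G P Q \<and> v \<in> set P \<union> set Q))
     \<and> (\<forall>P Q P' Q'. tree_cycle G P Q \<and> tree_cycle G P' Q' \<and> {P, Q} \<noteq> {P', Q'}
          \<longrightarrow> (set P \<union> set Q) \<inter> (set P' \<union> set Q') = {})"

definition is_simplex_galled_tree :: "net \<Rightarrow> bool" where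
  "is_simplex_galled_tree G \<longleftrightarrow> is_galled_tree G
     \<and> (\<forall>v w. is_reticulation G v \<and> (v, w) \<in> arcs G \<longrightarrow> is_leaf G w)"

definition SGT :: "nat \<Rightarrow> net set" where
  "SGT n = {G. is_simplex_galled_tree G \<and> leaves G = {1..n}}"

definition net_iso :: "net \<Rightarrow> net \<Rightarrow> bool" where
  "net_iso G H \<longleftrightarrow> (\<exists>f. bij_betw f (verts G) (verts H)
     \<and> (\<forall>a \<in> verts G. \<forall>b \<in> verts G. (a, b) \<in> arcs G \<longleftrightarrow> (f a, f b) \<in> arcs H)
     \<and> (\<forall>x \<in> leaves G. f x = x))"

definition SGT_classes :: "nat \<Rightarrow> net set set" where
  "SGT_classes n = SGT n // {(G, H). G \<in> SGT n \<and> H \<in> SGT n \<and> net_iso G H}"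

definition root_path_lengths :: "net \<Rightarrow> nat \<Rightarrow> nat set" where
  "root_path_lengths G x = {length p - 1 | p. dpath G p \<and> hd p = root G \<and> last p = x}"

definition h_plus :: "net \<Rightarrow> nat \<Rightarrow> nat" where
  "h_plus G x = Max (root_path_lengths G x)"
definition h_minus :: "net \<Rightarrow> nat \<Rightarrow> nat" where
  "h_minus G x = Min (root_path_lengths G x)"

definition S_plus :: "net \<Rightarrow> nat" where
  "S_plus G = (\<Sum>x \<in> leaves G. h_plus G x)"
definition S_minus :: "net \<Rightarrow> nat" where
  "S_minus G = (\<Sum>x \<in> leaves G. h_minus G x)"

text \<open>Expectation under the uniform distribution on isomorphism classes
  (S_plus / S_minus are isomorphism invariants, so any representative may be taken).\<close>
definition expect_uniform :: "nat \<Rightarrow> (net \<Rightarrow> nat) \<Rightarrow> real" where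
  "expect_uniform n S = (\<Sum>C \<in> SGT_classes n. real (S (SOME G. G \<in> C))) / real (card (SGT_classes n))"

end

theory Submission
  imports Defs "HOL-Analysis.Analysis" "HOL-Real_Asymp.Real_Asymp"
    "HOL-Combinatorics.Multiset_Permutations" "HOL-Library.Countable"
begin

text \<open>
  Unfolding a simplex galled tree from its root, and stopping at the reticulations, gives a plane
  binary tree in which a reticulation with child \<open>x\<close> occurs twice, as \<open>Rt x\<close>. A network with \<open>k\<close>
  inner (root or tree) nodes has exactly \<open>2 ^ k\<close> such unfoldings, two networks sharing one are
  isomorphic, and the possible unfoldings form a context-free class. Weighting every unfolding by
  \<open>2 ^ (- k)\<close> therefore turns sums over isomorphism classes into sums over plane trees, and a fixed
  order of the labels turns these into ordinary generating functions: with \<open>A\<close> for the networks and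
  \<open>S\<close> for one side of a gall, \<open>A = z + A\<^sup>2 / 2 + z (S\<^sup>2 - 1) / 2\<close> and \<open>S = 1 + A S\<close>.

  For \<open>y = 1 - A\<close> this says \<open>y S = 1\<close> and \<open>y\<^sup>2 + z S\<^sup>2 = 1 - z\<close>, that is,
  \<open>y(x\<^sup>2) - x S(x\<^sup>2)\<close> is the square root of \<open>1 - 2 x - x\<^sup>2\<close>, which yields the asymptotics of
  the coefficients of \<open>A\<close>. The total path length has a generating function \<open>P\<close> for which
  \<open>(1 - 6 z + z\<^sup>2) P\<close> is a polynomial in \<open>z, y, S\<close>, hence absolutely convergent at the singularity
  \<open>\<rho> = 3 - 2 \<surd>2\<close>, and \<open>\<rho>\<^sup>n [z\<^sup>n] P\<close> converges. The depth of the leaf below a reticulation inside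
  its gall affects \<open>P\<close> only by a term that vanishes in the limit, so both path lengths behave alike;
  they are squeezed between the parameters \<open>\<theta> = 0\<close> (this depth is dropped) and \<open>\<theta> = 1\<close> (it is
  replaced by the sum of the two side lengths).
\<close>

section \<open>Generating functions and their coefficients\<close>

definition rr :: real where "rr = sqrt 2 - 1"
definition rho :: real where "rho = 3 - 2 * sqrt 2"

lemma sqrt2_bounds: "1.4 < sqrt 2" "sqrt 2 < (1.42::real)"
  by (rule real_less_rsqrt, simp add: power2_eq_square) (rule real_less_lsqrt, simp_all add: power2_eq_square)

lemma rr_pos: "0 < rr" and rho_pos: "0 < rho" and rho_less: "rho < 1/5" and rho_eq: "rho = rr\<^sup>2"
  using sqrt2_bounds by (simp_all add: rr_def rho_def power2_eq_square algebra_simps)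

lemma rr_inverse: "1 / rr = rr + 2"
  using rr_pos by (simp add: rr_def field_simps)

lemma rho_inverse: "1 / rho = 6 - rho"
proof -
  have "(6 - rho) * rho = 1"
    by (simp add: rho_def algebra_simps)
  then show ?thesis
    using rho_pos by (simp add: field_simps)
qed

text \<open>The square root of \<open>1 - 2 X - X\<^sup>2 = (1 - X / r) (1 + r X)\<close> with \<open>r = \<surd>2 - 1\<close>.\<close>
definition bser :: "real fps" where
  "bser = (fps_binomial (1/2) oo (fps_const (- 1 / rr) * fps_X)) *
          (fps_binomial (1/2) oo (fps_const rr * fps_X))"

lemma fps_binomial_half_linear_square:
  "(fps_binomial (1/2 :: real) oo (fps_const c * fps_X)) ^ 2 = 1 + fps_const c * fps_X"
proof -
  have "(fps_binomial (1/2 :: real) oo (fps_const c * fps_X)) ^ 2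
      = (fps_binomial (1/2) * fps_binomial (1/2)) oo (fps_const c * fps_X)"
    by (simp add: power2_eq_square fps_compose_mult_distrib)
  also have "fps_binomial (1/2 :: real) * fps_binomial (1/2) = 1 + fps_X"
    by (simp add: fps_binomial_add_mult [symmetric] fps_binomial_1)
  finally show ?thesis
    by (simp add: fps_compose_add_distrib)
qed

lemma bser_square: "bser ^ 2 = 1 - 2 * fps_X - fps_X ^ 2"
proof -
  have "bser ^ 2 = (1 + fps_const (- 1 / rr) * fps_X) * (1 + fps_const rr * fps_X)"
    unfolding bser_def power_mult_distrib fps_binomial_half_linear_square ..
  also have "\<dots> = 1 + (fps_const (- 1 / rr) + fps_const rr) * fps_X
                + (fps_const (- 1 / rr) * fps_const rr) * fps_X ^ 2"
    by (simp add: algebra_simps power2_eq_square del: fps_const_mult fps_const_add)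
  also have "fps_const (- 1 / rr) + fps_const rr = - 2"
    using rr_inverse by (simp add: numeral_fps_const)
  also have "fps_const (- 1 / rr) * fps_const rr = - 1"
    using rr_pos by (simp add: fps_const_neg [symmetric] del: fps_const_neg)
  finally show ?thesis
    by simp
qed

lemma fps_nth_compose_X_square:
  "fps_nth (f oo fps_X ^ 2) n = (if even n then fps_nth f (n div 2) else (0 :: 'a :: comm_ring_1))"
proof -
  have "fps_nth (f oo fps_X ^ 2) n = (\<Sum>i\<in>{0..n}. if n = 2 * i then fps_nth f i else 0)"
    unfolding fps_compose_nth by (intro sum.cong) (auto simp: power_mult [symmetric] fps_X_power_nth)
  also have "\<dots> = (\<Sum>i\<in>{i\<in>{0..n}. n = 2 * i}. fps_nth f i)"
    by (rule sum.inter_filter [symmetric]) simp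
  also have "{i\<in>{0..n}. n = 2 * i} = (if even n then {n div 2} else {})"
    by auto
  finally show ?thesis
    by auto
qed

lemma even_odd_parts_unique:
  fixes u v u' v' :: "'a :: comm_ring_1 fps"
  assumes "(u oo fps_X ^ 2) + fps_X * (v oo fps_X ^ 2) = (u' oo fps_X ^ 2) + fps_X * (v' oo fps_X ^ 2)"
  shows "u = u' \<and> v = v'"
proof -
  have "fps_nth u n = fps_nth u' n" for n
    using arg_cong [OF assms, of "\<lambda>f. fps_nth f (2 * n)"] by (cases n) (simp_all add: fps_nth_compose_X_square)
  moreover have "fps_nth v n = fps_nth v' n" for n
    using arg_cong [OF assms, of "\<lambda>f. fps_nth f (Suc (2 * n))"] by (simp add: fps_nth_compose_X_square)
  ultimately show ?thesis
    by (simp add: fps_eq_iff)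
qed

definition yser :: "real fps" where "yser = Abs_fps (\<lambda>n. fps_nth bser (2 * n))"
definition sser :: "real fps" where "sser = - Abs_fps (\<lambda>n. fps_nth bser (2 * n + 1))"

lemma bser_parts: "bser = (yser oo fps_X ^ 2) - fps_X * (sser oo fps_X ^ 2)"
proof (rule fps_ext)
  fix n
  show "fps_nth bser n = fps_nth ((yser oo fps_X ^ 2) - fps_X * (sser oo fps_X ^ 2)) n"
    by (cases "even n"; cases n) (auto simp: fps_nth_compose_X_square yser_def sser_def elim!: evenE oddE)
qed

lemma yser_sser: "yser * sser = 1" and yser_eq: "yser ^ 2 + fps_X * sser ^ 2 = 1 - fps_X"
proof -
  let ?y = "yser oo fps_X ^ 2" and ?s = "sser oo fps_X ^ 2"
  have "(((yser ^ 2 + fps_X * sser ^ 2) oo fps_X ^ 2) + fps_X * ((- (2 * (yser * sser))) oo fps_X ^ 2))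
      = bser ^ 2"
    unfolding bser_parts
    by (simp add: fps_compose_add_distrib fps_compose_mult_distrib fps_compose_uminus power2_eq_square
        algebra_simps numeral_fps_const)
  also have "\<dots> = (((1 - fps_X) oo fps_X ^ 2) + fps_X * ((- (2 * 1)) oo fps_X ^ 2))"
    unfolding bser_square
    by (simp add: fps_compose_sub_distrib fps_compose_uminus numeral_fps_const)
  finally have "yser ^ 2 + fps_X * sser ^ 2 = 1 - fps_X \<and> - (2 * (yser * sser)) = - (2 * 1)"
    by (rule even_odd_parts_unique)
  then show "yser * sser = 1" "yser ^ 2 + fps_X * sser ^ 2 = 1 - fps_X"
    by simp_all
qed

lemma yser_0: "fps_nth yser 0 = 1"
  by (simp add: yser_def bser_def)

definition aser :: "real fps" where "aser = 1 - yser"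

lemma aser_0: "fps_nth aser 0 = 0"
  by (simp add: aser_def yser_0)

lemma aser_eq: "aser = fps_X + fps_const (1/2) * (aser * aser) + fps_const (1/2) * (fps_X * (sser * sser - 1))"
proof -
  have "2 * (fps_X + fps_const (1/2) * (aser * aser) + fps_const (1/2) * (fps_X * (sser * sser - 1)))
      = 2 * fps_X + (fps_const 2 * fps_const (1/2)) * (aser * aser) + (fps_const 2 * fps_const (1/2)) * (fps_X * (sser * sser - 1))"
    unfolding numeral_fps_const by (simp only: algebra_simps)
  also have "\<dots> = 2 * fps_X + aser * aser + fps_X * (sser * sser - 1)"
    by simp
  also have "\<dots> = 2 * aser"
    using yser_eq by (simp add: aser_def power2_eq_square algebra_simps)
  finally have "2 * aser = 2 * (fps_X + fps_const (1/2) * (aser * aser) + fps_const (1/2) * (fps_X * (sser * sser - 1)))"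
    by (rule sym)
  then show ?thesis
    by (rule mult_left_cancel [THEN iffD1, rotated]) simp
qed

lemma sser_eq: "sser = 1 + aser * sser"
  using yser_sser by (simp add: aser_def algebra_simps)

text \<open>
  \<open>vser\<close> counts the sides of a gall weighted by their length, \<open>pser\<close> the networks
  and \<open>qser\<close> the sides weighted by total leaf depth; the closed forms solve the linear system
  consisting of \<open>vser_eq\<close>, \<open>qser_eq\<close> and \<open>pser_eq\<close>.
\<close>
definition vser :: "real fps" where "vser = aser * sser ^ 2"

lemma vser_eq: "vser = aser * vser + aser * sser"
proof -
  have "vser - aser * vser = aser * sser * (yser * sser)"
    unfolding vser_def aser_def by (simp add: algebra_simps power2_eq_square)
  then show ?thesis
    unfolding yser_sser by (simp add: algebra_simps)
qed

definition dser :: "real fps" where "dser = yser - fps_X * sser ^ 3"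

definition nser :: "real \<Rightarrow> real fps" where
  "nser \<theta> = fps_X * aser * fps_deriv aser + fps_X ^ 2 * sser ^ 2 * fps_deriv sser
            + fps_X ^ 2 * sser * fps_deriv sser + fps_const \<theta> * fps_X * (sser ^ 3 - 1)"

definition pser :: "real \<Rightarrow> real fps" where "pser \<theta> = nser \<theta> * inverse dser"

definition qser :: "real \<Rightarrow> real fps" where
  "qser \<theta> = sser * (pser \<theta> * sser + fps_X * fps_deriv sser)"

lemma pser_dser: "pser \<theta> * dser = nser \<theta>"
proof -
  have "fps_nth dser 0 \<noteq> 0"
    by (simp add: dser_def yser_0)
  then have "inverse dser * dser = 1"
    by (rule inverse_mult_eq_1)
  then show ?thesis
    unfolding pser_def mult.assoc by simp
qed

lemma qser_eq: "qser \<theta> = pser \<theta> * sser + aser * qser \<theta> + fps_X * fps_deriv sser"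
proof -
  have "qser \<theta> - aser * qser \<theta> = (yser * sser) * (pser \<theta> * sser + fps_X * fps_deriv sser)"
    unfolding qser_def aser_def by (simp add: algebra_simps)
  then show ?thesis
    unfolding yser_sser by (simp add: algebra_simps)
qed

lemma pser_eq:
  "pser \<theta> = aser * pser \<theta> + aser * (fps_X * fps_deriv aser)
     + fps_X * (sser * (qser \<theta> + fps_X * fps_deriv sser))
     + fps_const \<theta> * (fps_X * (vser * sser + sser * sser - 1))"
proof -
  have "vser * sser + sser * sser = sser ^ 3"
    using arg_cong [OF yser_sser, of "\<lambda>f. f * sser ^ 2"]
    unfolding vser_def aser_def by (simp add: algebra_simps power2_eq_square power3_eq_cube)
  moreover have "pser \<theta> * (yser - fps_X * sser ^ 3) = nser \<theta>"
    using pser_dser [of \<theta>] by (simp add: dser_def)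
  ultimately show ?thesis
    unfolding nser_def qser_def aser_def
    by (simp add: algebra_simps power2_eq_square power3_eq_cube)
qed

lemma deriv_sser: "fps_deriv sser = sser ^ 2 * fps_deriv aser"
proof -
  have "fps_deriv yser * sser + yser * fps_deriv sser = 0"
    using arg_cong [OF yser_sser, of fps_deriv] by (simp add: algebra_simps)
  then have "sser * (fps_deriv yser * sser + yser * fps_deriv sser) = 0"
    by simp
  then have "(yser * sser) * fps_deriv sser = - (sser ^ 2 * fps_deriv yser)"
    by (simp add: algebra_simps power2_eq_square eq_neg_iff_add_eq_0)
  then show ?thesis
    unfolding yser_sser by (simp add: aser_def)
qed

lemma deriv_aser: "2 * (dser * fps_deriv aser) = 1 + sser ^ 2"
proof -
  have "2 * (yser * fps_deriv yser) + sser ^ 2 + 2 * (fps_X * sser * fps_deriv sser) = - 1"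
    using arg_cong [OF yser_eq, of fps_deriv] by (simp add: algebra_simps power2_eq_square)
  then show ?thesis
    unfolding deriv_sser dser_def aser_def
    by (simp add: algebra_simps power2_eq_square power3_eq_cube)
qed

lemma dser_square: "(yser * dser) ^ 2 = 1 - 6 * fps_X + fps_X ^ 2"
proof -
  have "yser * dser = yser ^ 2 - fps_X * (yser * sser) * sser ^ 2"
    unfolding dser_def by (simp add: algebra_simps power2_eq_square power3_eq_cube)
  then have *: "yser * dser = yser ^ 2 - fps_X * sser ^ 2"
    unfolding yser_sser by simp
  have "(yser * dser) ^ 2 = (yser ^ 2 + fps_X * sser ^ 2) ^ 2 - 4 * fps_X * (yser * sser) ^ 2"
    unfolding * by (simp add: algebra_simps power2_eq_square)
  then show ?thesis
    unfolding yser_sser yser_eq by (simp add: algebra_simps power2_eq_square)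
qed

definition kser :: "real \<Rightarrow> real fps" where
  "kser \<theta> = yser ^ 2 * (1 + sser ^ 2) * (fps_X * (1 - yser) + fps_X ^ 2 * sser ^ 4 + fps_X ^ 2 * sser ^ 3)
            + fps_const \<theta> * (2 * (yser ^ 2 * dser * (fps_X * (sser ^ 3 - 1))))"

lemma pser_kser: "(1 - 6 * fps_X + fps_X ^ 2) * (2 * pser \<theta>) = kser \<theta>"
proof -
  have "(1 - 6 * fps_X + fps_X ^ 2) * (2 * pser \<theta>) = 2 * yser ^ 2 * dser * (pser \<theta> * dser)"
    unfolding dser_square [symmetric] by (simp add: algebra_simps power2_eq_square)
  also have "\<dots> = yser ^ 2 * (2 * (dser * fps_deriv aser))
        * (fps_X * aser + fps_X ^ 2 * sser ^ 4 + fps_X ^ 2 * sser ^ 3)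
       + fps_const \<theta> * (2 * (yser ^ 2 * dser * (fps_X * (sser ^ 3 - 1))))"
    unfolding pser_dser nser_def deriv_sser
    by (simp add: algebra_simps power2_eq_square power3_eq_cube power4_eq_xxxx)
  finally show ?thesis
    unfolding deriv_aser by (simp add: kser_def aser_def)
qed


definition absum :: "real fps \<Rightarrow> bool" where
  "absum f \<longleftrightarrow> summable (\<lambda>n. \<bar>fps_nth f n * rho ^ n\<bar>)"
definition ev :: "real fps \<Rightarrow> real" where
  "ev f = (\<Sum>n. fps_nth f n * rho ^ n)"

lemma absum_summable: "absum f \<Longrightarrow> summable (\<lambda>n. fps_nth f n * rho ^ n)"
  unfolding absum_def by (rule summable_rabs_cancel)

lemma absum_add: "absum f \<Longrightarrow> absum g \<Longrightarrow> absum (f + g)"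
  unfolding absum_def
  by (rule summable_comparison_test' [OF summable_add, of "\<lambda>n. \<bar>fps_nth f n * rho ^ n\<bar>"
        "\<lambda>n. \<bar>fps_nth g n * rho ^ n\<bar>" 0])
     (auto simp: distrib_right intro: abs_triangle_ineq)

lemma ev_add: "absum f \<Longrightarrow> absum g \<Longrightarrow> ev (f + g) = ev f + ev g"
  unfolding ev_def using suminf_add [OF absum_summable absum_summable, of f g] by (simp add: distrib_right)

lemma fps_mult_nth_scaled:
  "fps_nth (f * g) n * rho ^ n = (\<Sum>i\<le>n. (fps_nth f i * rho ^ i) * (fps_nth g (n - i) * rho ^ (n - i)))"
  unfolding fps_mult_nth sum_distrib_right atMost_atLeast0
  by (rule sum.cong) (auto simp: mult_ac power_add [symmetric])

lemma absum_mult: assumes "absum f" "absum g" shows "absum (f * g)"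
proof -
  have "summable (\<lambda>k. \<Sum>i\<le>k. \<bar>fps_nth f i * rho ^ i\<bar> * \<bar>fps_nth g (k - i) * rho ^ (k - i)\<bar>)"
    using assms by (intro summable_Cauchy_product) (simp_all add: absum_def)
  then show ?thesis
    unfolding absum_def fps_mult_nth_scaled
    by (rule summable_comparison_test' [where N = 0]) (simp add: sum_abs abs_mult [symmetric])
qed

lemma ev_mult: assumes "absum f" "absum g" shows "ev (f * g) = ev f * ev g"
  unfolding ev_def fps_mult_nth_scaled
  using assms by (intro Cauchy_product [symmetric]) (simp_all add: absum_def)

lemma absum_const: "absum (fps_const c)"
  unfolding absum_def by (rule summable_finite [of "{0}"]) auto

lemma ev_const: "ev (fps_const c) = c"
  unfolding ev_def by (subst suminf_finite [of "{0}"]) auto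

lemma absum_X: "absum fps_X"
  unfolding absum_def by (rule summable_finite [of "{1}"]) (auto simp: fps_X_def)

lemma ev_X: "ev fps_X = rho"
  unfolding ev_def by (subst suminf_finite [of "{1}"]) (auto simp: fps_X_def)

lemma absum_1: "absum 1" and ev_1: "ev 1 = 1"
  using absum_const [of 1] ev_const [of 1] by simp_all

lemma absum_uminus: "absum f \<Longrightarrow> absum (- f)" and ev_uminus: "absum f \<Longrightarrow> ev (- f) = - ev f"
  using absum_mult [OF absum_const [of "- 1"], of f] ev_mult [OF absum_const [of "- 1"], of f]
  unfolding ev_const by (simp_all add: fps_const_neg [symmetric] del: fps_const_neg)

lemma absum_diff: "absum f \<Longrightarrow> absum g \<Longrightarrow> absum (f - g)"
  and ev_diff: "absum f \<Longrightarrow> absum g \<Longrightarrow> ev (f - g) = ev f - ev g"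
  using absum_add [OF _ absum_uminus, of f g] ev_add [OF _ absum_uminus, of f g] ev_uminus [of g]
  by simp_all

lemma absum_power: "absum f \<Longrightarrow> absum (f ^ k)" and ev_power: "absum f \<Longrightarrow> ev (f ^ k) = ev f ^ k"
proof -
  have "absum f \<Longrightarrow> absum (f ^ k) \<and> ev (f ^ k) = ev f ^ k"
    by (induction k) (auto simp: absum_1 ev_1 absum_mult ev_mult)
  then show "absum f \<Longrightarrow> absum (f ^ k)" "absum f \<Longrightarrow> ev (f ^ k) = ev f ^ k"
    by auto
qed

lemma absum_numeral: "absum (numeral k)" and ev_numeral: "ev (numeral k) = numeral k"
  unfolding numeral_fps_const by (rule absum_const, rule ev_const)

lemmas absum_intros = absum_add absum_diff absum_mult absum_power absum_1 absum_X absum_const absum_numeral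
lemmas ev_simps = ev_add ev_diff ev_mult ev_power ev_1 ev_X ev_const ev_numeral

lemma fps_geometric: "(1 - fps_const c * fps_X) * Abs_fps (\<lambda>n. c ^ n) = (1 :: real fps)"
proof (rule fps_ext)
  fix n
  show "fps_nth ((1 - fps_const c * fps_X) * Abs_fps (\<lambda>n. c ^ n)) n = fps_nth 1 n"
    by (cases n) (simp_all add: left_diff_distrib mult.assoc)
qed

text \<open>The factor \<open>1 / (1 - X / \<rho>)\<close> of \<open>1 / (1 - 6 X + X\<^sup>2)\<close> sums up the scaled coefficients.\<close>
lemma coeff_limit_of_simple_pole:
  assumes "(1 - 6 * fps_X + fps_X ^ 2) * f = k" "absum k"
  shows "(\<lambda>n. fps_nth f n * rho ^ n) \<longlonglongrightarrow> ev k / (1 - rho\<^sup>2)"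
proof -
  define g where "g = Abs_fps (\<lambda>n. rho ^ n)"
  define h where "h = Abs_fps (\<lambda>n. (1 / rho) ^ n)"
  have g1: "(1 - fps_const rho * fps_X) * g = 1"
    unfolding g_def by (rule fps_geometric)
  have h1: "(1 - fps_const (1 / rho) * fps_X) * h = 1"
    unfolding h_def by (rule fps_geometric)
  have "(1 - fps_const rho * fps_X) * (1 - fps_const (1 / rho) * fps_X)
      = 1 - (fps_const rho + fps_const (1 / rho)) * fps_X + fps_const rho * fps_const (1 / rho) * fps_X ^ 2"
    by (simp add: algebra_simps power2_eq_square del: fps_const_mult fps_const_add)
  also have "\<dots> = 1 - 6 * fps_X + fps_X ^ 2"
  proof -
    have "fps_const rho + fps_const (1 / rho) = 6"
      unfolding rho_inverse by (simp add: numeral_fps_const)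
    moreover have "fps_const rho * fps_const (1 / rho) = 1"
      using rho_pos by simp
    ultimately show ?thesis
      by (simp only: mult_1_left)
  qed
  finally have fac: "(1 - fps_const rho * fps_X) * (1 - fps_const (1 / rho) * fps_X) = 1 - 6 * fps_X + fps_X ^ 2" .
  have "f = ((1 - fps_const rho * fps_X) * g) * ((1 - fps_const (1 / rho) * fps_X) * h) * f"
    by (simp add: g1 h1)
  also have "\<dots> = ((1 - 6 * fps_X + fps_X ^ 2) * f) * g * h"
    unfolding fac [symmetric] by (simp only: mult_ac)
  finally have f: "f = (k * g) * h"
    using assms(1) by simp
  have rho1: "rho\<^sup>2 < 1"
    using rho_pos rho_less by (simp add: abs_square_less_1)
  have gterm: "fps_nth g n * rho ^ n = (rho\<^sup>2) ^ n" for n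
    by (simp add: g_def power_mult_distrib [symmetric] power2_eq_square)
  have g: "absum g" "ev g = 1 / (1 - rho\<^sup>2)"
    unfolding absum_def ev_def gterm using rho1 by (simp_all add: summable_geometric suminf_geometric)
  have hterm: "fps_nth h n * rho ^ n = 1" for n
    using rho_pos by (simp add: h_def power_mult_distrib [symmetric])
  have "(\<lambda>n. \<Sum>i\<le>n. fps_nth (k * g) i * rho ^ i) \<longlonglongrightarrow> ev (k * g)"
    unfolding ev_def using absum_summable [OF absum_mult [OF assms(2) g(1)]] by (rule summable_LIMSEQ')
  then show ?thesis
    unfolding f fps_mult_nth_scaled [of "k * g" h] hterm
    by (simp add: ev_mult assms(2) g)
qed

definition alph :: "nat \<Rightarrow> real" where "alph n = (-1) ^ n * ((1/2) gchoose n)"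

lemma alph_limit: "(\<lambda>n. alph n * real n powr (3/2)) \<longlonglongrightarrow> - 1 / (2 * sqrt pi)"
proof -
  have half: "(- 1/2 :: real) \<notin> \<int>\<^sub>\<le>\<^sub>0"
  proof
    assume "(- 1/2 :: real) \<in> \<int>\<^sub>\<le>\<^sub>0"
    then obtain m :: int where "- 1/2 = real_of_int m"
      by (auto elim!: nonpos_Ints_cases)
    then have "- 1 = real_of_int (2 * m)"
      by simp
    then have "- 1 = 2 * m"
      by linarith
    then show False
      by presburger
  qed
  have "Gamma (1/2 :: real) = (- 1/2) * Gamma (- 1/2)"
    using Gamma_plus1 [OF half] by simp
  then have "inverse (Gamma (- (1/2 :: real))) = - 1 / (2 * sqrt pi)"
    using Gamma_one_half_real by (simp add: field_simps)
  then have "(\<lambda>n. ((1/2 :: real) gchoose n) / ((-1)^n / exp ((1/2+1) * ln (real n)))) \<longlonglongrightarrow> - 1 / (2 * sqrt pi)"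
    using gbinomial_asymptotic [of "1/2 :: real"] by simp
  then show ?thesis
  proof (rule Lim_transform_eventually)
    show "\<forall>\<^sub>F n in sequentially. ((1/2 :: real) gchoose n) / ((-1)^n / exp ((1/2+1) * ln (real n)))
        = alph n * real n powr (3/2)"
      using eventually_gt_at_top [of 0]
    proof eventually_elim
      case (elim n)
      then show ?case
        by (cases "even n") (simp_all add: alph_def powr_def)
    qed
  qed
qed

lemma bser_nth_scaled:
  "fps_nth bser m * rr ^ m = (\<Sum>k\<le>m. (((1/2) gchoose k) * rho ^ k) * alph (m - k))"
proof -
  have "fps_nth bser m * rr ^ m
      = (\<Sum>i=0..m. ((rr ^ i * ((1/2) gchoose i)) * ((- 1 / rr) ^ (m - i) * ((1/2) gchoose (m - i)))) * rr ^ m)"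
    unfolding bser_def by (subst mult.commute) (simp add: fps_mult_nth sum_distrib_right)
  also have "\<dots> = (\<Sum>k\<le>m. (((1/2) gchoose k) * rho ^ k) * alph (m - k))"
    unfolding atMost_atLeast0
  proof (rule sum.cong [OF refl])
    fix i assume "i \<in> {0..m}"
    then have "rr ^ m = rr ^ i * rr ^ (m - i)"
      by (simp add: power_add [symmetric])
    moreover have "(- 1 / rr) ^ (m - i) * rr ^ (m - i) = (-1) ^ (m - i)"
      using rr_pos by (simp add: power_mult_distrib [symmetric])
    moreover have "rho ^ i = rr ^ i * rr ^ i"
      by (simp add: rho_eq power_mult_distrib [symmetric] power2_eq_square)
    moreover have "rr ^ i * x * (u * v) * (rr ^ i * w) = (x * (rr ^ i * rr ^ i)) * ((u * w) * v)" for x u v w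
      by (simp only: mult_ac)
    ultimately show "((rr ^ i * ((1/2) gchoose i)) * ((- 1 / rr) ^ (m - i) * ((1/2) gchoose (m - i)))) * rr ^ m
        = (((1/2) gchoose i) * rho ^ i) * alph (m - i)"
      unfolding alph_def by (simp only:)
  qed
  finally show ?thesis .
qed


lemma rho_power_bound: "summable (\<lambda>k. (real k + 1) ^ 2 * rho ^ k)"
proof (rule summable_comparison_test' [where N = 0])
  show "summable (\<lambda>k. (real k + 1) ^ 2 * (1/5 :: real) ^ k)"
  proof (rule summable_comparison_test_bigo)
    show "summable (\<lambda>k. norm ((1/2 :: real) ^ k))"
      by (simp add: summable_geometric)
    show "(\<lambda>k. (real k + 1) ^ 2 * (1/5 :: real) ^ k) \<in> O(\<lambda>k. (1/2) ^ k)"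
      by real_asymp
  qed
  show "norm ((real k + 1) ^ 2 * rho ^ k) \<le> (real k + 1) ^ 2 * (1/5) ^ k" for k
    using rho_pos rho_less by (simp add: abs_mult power_mono mult_left_mono)
qed

lemma alph_bound: "\<exists>M. \<forall>n. \<bar>alph n\<bar> * (real n + 1) powr (3/2) \<le> M"
proof -
  have "(\<lambda>n. ((real n + 1) / real n) powr (3/2)) \<longlonglongrightarrow> 1"
    by real_asymp
  then have "(\<lambda>n. alph n * real n powr (3/2) * ((real n + 1) / real n) powr (3/2)) \<longlonglongrightarrow> - 1 / (2 * sqrt pi) * 1"
    by (intro tendsto_mult alph_limit)
  moreover have "\<forall>\<^sub>F n in sequentially. alph n * real n powr (3/2) * ((real n + 1) / real n) powr (3/2)
      = alph n * (real n + 1) powr (3/2)"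
    using eventually_gt_at_top [of 0] by eventually_elim (simp add: powr_divide)
  ultimately have "(\<lambda>n. alph n * (real n + 1) powr (3/2)) \<longlonglongrightarrow> - 1 / (2 * sqrt pi) * 1"
    by (rule Lim_transform_eventually)
  then have "Bseq (\<lambda>n. alph n * (real n + 1) powr (3/2))"
    by (intro convergent_imp_Bseq) (auto simp: convergent_def)
  then obtain K where "\<forall>n. norm (alph n * (real n + 1) powr (3/2)) \<le> K"
    by (auto simp: Bseq_def)
  then show ?thesis
    by (intro exI [of _ K]) (simp add: abs_mult)
qed

lemma bser_limit: "(\<lambda>m. fps_nth bser m * rr ^ m * real m powr (3/2)) \<longlonglongrightarrow> - sqrt (1 + rho) / (2 * sqrt pi)"
proof -
  obtain M where M: "\<bar>alph n\<bar> * (real n + 1) powr (3/2) \<le> M" for n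
    using alph_bound by blast
  have M1: "\<bar>alph n\<bar> \<le> M" for n
  proof -
    have "\<bar>alph n\<bar> * 1 \<le> \<bar>alph n\<bar> * (real n + 1) powr (3/2)"
      by (intro mult_left_mono ge_one_powr_ge_zero) auto
    with M [of n] show ?thesis
      by simp
  qed
  have "0 \<le> M"
    using M1 [of 0] by linarith
  define \<gamma> where "\<gamma> k = ((1/2) gchoose k) * rho ^ k" for k
  have \<gamma>_bound: "\<bar>\<gamma> k\<bar> \<le> M * rho ^ k" for k
    using M1 [of k] rho_pos by (simp add: \<gamma>_def alph_def abs_mult power_abs mult_right_mono)
  define a where "a k m = (if k \<le> m then \<gamma> k * (alph (m - k) * real m powr (3/2)) else 0)" for k m
  have sums: "\<gamma> sums (1 + rho) powr (1/2)"
    unfolding \<gamma>_def using rho_pos rho_less by (intro gen_binomial_real) simp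
  have lim: "(\<lambda>m. a k m) \<longlonglongrightarrow> \<gamma> k * (- 1 / (2 * sqrt pi))" for k
  proof -
    have "(\<lambda>m. alph (m - k + k - k) * real (m - k) powr (3/2)) \<longlonglongrightarrow> - 1 / (2 * sqrt pi)"
      using filterlim_compose [OF alph_limit filterlim_minus_const_nat_at_top [of k]] by simp
    moreover have "(\<lambda>m. (real m / (real m - real k)) powr (3/2)) \<longlonglongrightarrow> 1"
      by real_asymp
    ultimately have "(\<lambda>m. \<gamma> k * (alph (m - k + k - k) * real (m - k) powr (3/2) * (real m / (real m - real k)) powr (3/2)))
        \<longlonglongrightarrow> \<gamma> k * (- 1 / (2 * sqrt pi) * 1)"
      by (intro tendsto_mult tendsto_const)
    moreover have "\<forall>\<^sub>F m in sequentially. \<gamma> k * (alph (m - k + k - k) * real (m - k) powr (3/2) * (real m / (real m - real k)) powr (3/2)) = a k m"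
      using eventually_gt_at_top [of k] by eventually_elim (simp add: a_def powr_divide of_nat_diff)
    ultimately show ?thesis
      using Lim_transform_eventually by fastforce
  qed
  have bound: "norm (a k m) \<le> M * M * ((real k + 1) ^ 2 * rho ^ k)" for k m
  proof (cases "k \<le> m")
    case True
    have "real m \<le> (real (m - k) + 1) * (real k + 1)"
      using True mult_left_mono [of "real k" "real m" "real k"] by (simp add: of_nat_diff algebra_simps)
    then have "real m powr (3/2) \<le> ((real (m - k) + 1) * (real k + 1)) powr (3/2)"
      by (intro powr_mono2) auto
    also have "\<dots> = (real (m - k) + 1) powr (3/2) * (real k + 1) powr (3/2)"
      by (simp add: powr_mult)
    also have "(real k + 1) powr (3/2) \<le> (real k + 1) powr 2"
      by (intro powr_mono) auto
    finally have *: "real m powr (3/2) \<le> (real (m - k) + 1) powr (3/2) * (real k + 1) ^ 2"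
      by (simp add: powr_numeral mult_left_mono)
    have "\<bar>alph (m - k)\<bar> * real m powr (3/2) \<le> \<bar>alph (m - k)\<bar> * ((real (m - k) + 1) powr (3/2) * (real k + 1) ^ 2)"
      by (intro mult_left_mono *) auto
    also have "\<dots> \<le> M * (real k + 1) ^ 2"
      unfolding mult.assoc [symmetric] by (intro mult_right_mono M) auto
    finally have **: "\<bar>alph (m - k)\<bar> * real m powr (3/2) \<le> M * (real k + 1) ^ 2" .
    have "norm (a k m) = \<bar>\<gamma> k\<bar> * (\<bar>alph (m - k)\<bar> * real m powr (3/2))"
      using True by (simp add: a_def abs_mult)
    also have "\<dots> \<le> (M * rho ^ k) * (M * (real k + 1) ^ 2)"
      using \<open>0 \<le> M\<close> rho_pos by (intro mult_mono \<gamma>_bound **) auto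
    finally show ?thesis
      by (simp add: mult_ac)
  next
    case False
    then show ?thesis
      using \<open>0 \<le> M\<close> rho_pos by (simp add: a_def)
  qed
  have "((\<lambda>m. suminf (\<lambda>k. a k m)) \<longlongrightarrow> suminf (\<lambda>k. \<gamma> k * (- 1 / (2 * sqrt pi)))) sequentially"
    using tannerys_theorem [of a "\<lambda>k. \<gamma> k * (- 1 / (2 * sqrt pi))" sequentially
        "\<lambda>k. M * M * ((real k + 1) ^ 2 * rho ^ k)"] lim bound
      summable_mult [OF rho_power_bound, of "M * M"]
    by (simp add: always_eventually case_prod_unfold)
  moreover have "suminf (\<lambda>k. a k m) = fps_nth bser m * rr ^ m * real m powr (3/2)" for m
  proof -
    have "suminf (\<lambda>k. a k m) = (\<Sum>k\<le>m. a k m)"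
      by (rule suminf_finite) (auto simp: a_def)
    also have "\<dots> = (\<Sum>k\<le>m. \<gamma> k * alph (m - k)) * real m powr (3/2)"
      unfolding sum_distrib_right by (rule sum.cong) (auto simp: a_def)
    finally show ?thesis
      by (simp add: bser_nth_scaled \<gamma>_def)
  qed
  moreover have "suminf (\<lambda>k. \<gamma> k * (- 1 / (2 * sqrt pi))) = - sqrt (1 + rho) / (2 * sqrt pi)"
    using suminf_mult2 [OF sums_summable [OF sums], of "- 1 / (2 * sqrt pi)"] sums_unique [OF sums] rho_pos
    by (simp add: powr_half_sqrt)
  ultimately show ?thesis
    by simp
qed


lemma summable_of_powr_limit:
  fixes f :: "nat \<Rightarrow> real"
  assumes "(\<lambda>n. f n * real n powr (3/2)) \<longlonglongrightarrow> c"
  shows "summable (\<lambda>n. \<bar>f n\<bar>)"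
proof -
  have "Bseq (\<lambda>n. f n * real n powr (3/2))"
    using assms by (intro convergent_imp_Bseq) (auto simp: convergent_def)
  then obtain K where K: "\<bar>f n * real n powr (3/2)\<bar> \<le> K" for n
    by (auto simp: Bseq_def)
  have "summable (\<lambda>n. K * real n powr (- 3/2))"
    by (intro summable_mult) (simp add: summable_real_powr_iff)
  then show ?thesis
  proof (rule summable_comparison_test' [where N = 1])
    fix n :: nat assume "1 \<le> n"
    then have "\<bar>f n\<bar> = \<bar>f n * real n powr (3/2)\<bar> * real n powr (- 3/2)"
      by (simp add: abs_mult mult.assoc powr_add [symmetric])
    also have "\<dots> \<le> K * real n powr (- 3/2)"
      by (intro mult_right_mono K) auto
    finally show "norm \<bar>f n\<bar> \<le> K * real n powr (- 3/2)"
      by simp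
  qed
qed

lemma yser_limit:
  "(\<lambda>n. fps_nth yser n * rho ^ n * real n powr (3/2)) \<longlonglongrightarrow> - sqrt (1 + rho) / (2 * sqrt pi) / 2 powr (3/2)"
proof -
  have "strict_mono (\<lambda>n :: nat. 2 * n)"
    by (simp add: strict_mono_def)
  from LIMSEQ_subseq_LIMSEQ [OF bser_limit this]
  have "(\<lambda>n. fps_nth bser (2 * n) * rr ^ (2 * n) * real (2 * n) powr (3/2)) \<longlonglongrightarrow> - sqrt (1 + rho) / (2 * sqrt pi)"
    by (simp add: o_def)
  then have "(\<lambda>n. fps_nth bser (2 * n) * rr ^ (2 * n) * real (2 * n) powr (3/2) / 2 powr (3/2))
      \<longlonglongrightarrow> - sqrt (1 + rho) / (2 * sqrt pi) / 2 powr (3/2)"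
    by (intro tendsto_divide tendsto_const) auto
  then show ?thesis
    by (simp add: yser_def rho_eq power_mult powr_mult mult.assoc)
qed

lemma absum_yser: "absum yser"
  unfolding absum_def by (rule summable_of_powr_limit [OF yser_limit])

lemma absum_sser: "absum sser"
proof -
  have "strict_mono (\<lambda>n :: nat. 2 * n + 1)"
    by (simp add: strict_mono_def)
  from LIMSEQ_subseq_LIMSEQ [OF bser_limit this]
  have "(\<lambda>n. fps_nth bser (2 * n + 1) * rr ^ (2 * n + 1) * real (2 * n + 1) powr (3/2))
      \<longlonglongrightarrow> - sqrt (1 + rho) / (2 * sqrt pi)"
    by (simp add: o_def)
  moreover have "(\<lambda>n. (real n / real (2 * n + 1)) powr (3/2)) \<longlonglongrightarrow> (1/2) powr (3/2)"
    by real_asymp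
  ultimately have "(\<lambda>n. (- 1 / rr) * (fps_nth bser (2 * n + 1) * rr ^ (2 * n + 1) * real (2 * n + 1) powr (3/2)
        * (real n / real (2 * n + 1)) powr (3/2)))
      \<longlonglongrightarrow> (- 1 / rr) * (- sqrt (1 + rho) / (2 * sqrt pi) * (1/2) powr (3/2))"
    by (intro tendsto_mult tendsto_const)
  moreover have "(- 1 / rr) * (fps_nth bser (2 * n + 1) * rr ^ (2 * n + 1) * real (2 * n + 1) powr (3/2)
        * (real n / real (2 * n + 1)) powr (3/2)) = fps_nth sser n * rho ^ n * real n powr (3/2)" for n
  proof -
    have "real (2 * n + 1) powr (3/2) * (real n / real (2 * n + 1)) powr (3/2) = real n powr (3/2)"
      by (simp add: powr_mult [symmetric] del: of_nat_Suc)
    moreover have "(- 1 / rr) * (x * rr ^ (2 * n + 1) * u * v) = (- x) * rho ^ n * (u * v)" for x u v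
      using rr_pos by (simp add: rho_eq power_mult)
    ultimately show ?thesis
      by (simp add: sser_def)
  qed
  ultimately have "(\<lambda>n. fps_nth sser n * rho ^ n * real n powr (3/2))
      \<longlonglongrightarrow> (- 1 / rr) * (- sqrt (1 + rho) / (2 * sqrt pi) * (1/2) powr (3/2))"
    by simp
  then show ?thesis
    unfolding absum_def by (rule summable_of_powr_limit)
qed

lemma ev_kser: "absum (kser \<theta>)" "ev (kser \<theta>) = 2 * rho * (1 + rr)"
proof -
  note [intro] = absum_intros absum_yser absum_sser
  have dser: "absum dser"
    unfolding dser_def by auto
  show "absum (kser \<theta>)"
    unfolding kser_def using dser by (auto intro!: absum_intros)
  define y s d where "y = ev yser" and "s = ev sser" and "d = ev dser"
  have ys: "y * s = 1"
    unfolding y_def s_def by (simp add: ev_mult [symmetric] absum_yser absum_sser yser_sser ev_1)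
  have yeq: "y ^ 2 + rho * s ^ 2 = 1 - rho"
    using arg_cong [OF yser_eq, of ev] by (simp add: ev_simps absum_intros absum_yser absum_sser y_def s_def)
  have d: "d = y - rho * s ^ 3"
    unfolding d_def dser_def by (simp add: ev_simps absum_intros absum_yser absum_sser y_def s_def)
  have "(y * d) ^ 2 = 1 - 6 * rho + rho ^ 2"
    using arg_cong [OF dser_square, of ev] dser by (simp add: ev_simps absum_intros absum_yser y_def d_def power_mult_distrib)
  also have "\<dots> = 0"
    by (simp add: rho_def power2_eq_square algebra_simps)
  finally have "y * d = 0"
    by simp
  then have "d = 0"
    using ys by auto
  then have "y * y = y * (rho * s ^ 3)"
    using d by simp
  also have "\<dots> = (y * s) * (rho * s ^ 2)"
    by (simp add: power2_eq_square power3_eq_cube mult_ac)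
  finally have "y ^ 2 = rho * s ^ 2"
    using ys by (simp add: power2_eq_square)
  with yeq have "2 * y ^ 2 = 1 - rho"
    by simp
  then have yr: "y ^ 2 = rr"
    by (simp add: rr_def rho_def)
  have ry: "rr * s = y"
    using yr ys by (metis mult.assoc mult.right_neutral power2_eq_square)
  have rs: "rr * s ^ 2 = 1"
    using ry ys by (simp add: power2_eq_square mult.assoc [symmetric])
  have "ev (kser \<theta>) = y ^ 2 * (1 + s ^ 2) * (rho * (1 - y) + rho ^ 2 * s ^ 4 + rho ^ 2 * s ^ 3)"
    using \<open>d = 0\<close> unfolding kser_def
    by (simp add: ev_simps absum_intros absum_yser absum_sser dser y_def s_def d_def)
  also have "y ^ 2 * (1 + s ^ 2) = rr + 1"
    using yr rs by (simp add: algebra_simps)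
  also have "rho ^ 2 * s ^ 4 = rho * (rr * s ^ 2) ^ 2"
    by (simp add: rho_eq power2_eq_square power4_eq_xxxx)
  also have "rho ^ 2 * s ^ 3 = rho * (rr * s ^ 2) * (rr * s)"
    by (simp add: rho_eq power2_eq_square power3_eq_cube)
  finally show "ev (kser \<theta>) = 2 * rho * (1 + rr)"
    unfolding rs ry by (simp add: algebra_simps)
qed

lemma pser_limit: "(\<lambda>n. fps_nth (pser \<theta>) n * rho ^ n) \<longlonglongrightarrow> 1/4"
proof -
  have "(\<lambda>n. fps_nth (2 * pser \<theta>) n * rho ^ n) \<longlonglongrightarrow> 2 * rho * (1 + rr) / (1 - rho\<^sup>2)"
    using coeff_limit_of_simple_pole [OF pser_kser] ev_kser by simp
  also have "2 * rho * (1 + rr) / (1 - rho\<^sup>2) = 1/2"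
  proof -
    have "1 - rho\<^sup>2 = 4 * (rho * (1 + rr))"
      by (simp add: rho_def rr_def power2_eq_square algebra_simps)
    moreover have "rho * (1 + rr) \<noteq> 0"
      using rho_pos rr_pos by simp
    ultimately show ?thesis
      by simp
  qed
  finally have "(\<lambda>n. (1/2) * (fps_nth (2 * pser \<theta>) n * rho ^ n)) \<longlonglongrightarrow> (1/2) * (1/2)"
    by (intro tendsto_mult tendsto_const)
  then show ?thesis
    by (simp add: numeral_fps_const mult.assoc)
qed

lemma pser_aser_ratio:
  "(\<lambda>n. fps_nth (pser \<theta>) n / fps_nth aser n) \<sim>[at_top]
     (\<lambda>n. sqrt ((2 + sqrt 2) / 2) * sqrt pi * real n powr (3/2))"
proof (rule asymp_equivI')
  define \<kappa> where "\<kappa> = sqrt ((2 + sqrt 2) / 2) * sqrt pi"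
  have \<kappa>: "\<kappa> > 0"
    unfolding \<kappa>_def by (intro mult_pos_pos) (auto simp: add_pos_pos)
  have "sqrt (1 + rho) * sqrt ((2 + sqrt 2) / 2) = sqrt 2"
    unfolding real_sqrt_mult [symmetric] by (simp add: rho_def algebra_simps)
  moreover have "2 powr (3/2) = 2 * sqrt (2 :: real)"
    using powr_add [of "2 :: real" 1 "1/2"] by (simp add: powr_half_sqrt)
  moreover have "sqrt ((2 + sqrt 2) / 2) > 0"
    by (simp add: add_pos_pos)
  ultimately have c: "sqrt (1 + rho) / (2 * sqrt pi) / 2 powr (3/2) = 1 / (4 * \<kappa>)"
    by (simp add: \<kappa>_def divide_simps)
  have "(\<lambda>n. - (fps_nth yser n * rho ^ n * real n powr (3/2))) \<longlonglongrightarrow> - (- sqrt (1 + rho) / (2 * sqrt pi) / 2 powr (3/2))"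
    by (intro tendsto_minus yser_limit)
  then have "(\<lambda>n. - (fps_nth yser n * rho ^ n * real n powr (3/2))) \<longlonglongrightarrow> 1 / (4 * \<kappa>)"
    using c by simp
  moreover have "\<forall>\<^sub>F n in sequentially. - (fps_nth yser n * rho ^ n * real n powr (3/2))
      = fps_nth aser n * rho ^ n * real n powr (3/2)"
    using eventually_gt_at_top [of 0] by eventually_elim (simp add: aser_def)
  ultimately have "(\<lambda>n. fps_nth aser n * rho ^ n * real n powr (3/2)) \<longlonglongrightarrow> 1 / (4 * \<kappa>)"
    by (rule Lim_transform_eventually)
  then have "(\<lambda>n. fps_nth (pser \<theta>) n * rho ^ n / (fps_nth aser n * rho ^ n * real n powr (3/2)) / \<kappa>)
      \<longlonglongrightarrow> (1/4) / (1 / (4 * \<kappa>)) / \<kappa>"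
    using \<kappa> by (intro tendsto_divide pser_limit tendsto_const) auto
  then show "(\<lambda>n. fps_nth (pser \<theta>) n / fps_nth aser n / (sqrt ((2 + sqrt 2) / 2) * sqrt pi * real n powr (3/2))) \<longlonglongrightarrow> 1"
    unfolding \<kappa>_def [symmetric] using \<kappa> rho_pos by (simp add: field_simps)
qed

section \<open>Unfolded networks\<close>

datatype utree = Lf nat | Rt nat | Nd utree utree

text \<open>
  \<open>ok None xs t\<close>: the tree \<open>t\<close> unfolds a network with leaves \<open>xs\<close>. \<open>ok (Some x) xs t\<close>: it unfolds one
  side of a gall, below its top, whose reticulation has the child \<open>x\<close>; here \<open>x\<close> is not listed in \<open>xs\<close>.
\<close>
inductive ok :: "nat option \<Rightarrow> nat list \<Rightarrow> utree \<Rightarrow> bool" where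
  leaf: "ok None [x] (Lf x)"
| ret: "ok (Some x) [] (Rt x)"
| tree: "ok None xs l \<Longrightarrow> ok None ys r \<Longrightarrow> ok None (xs @ ys) (Nd l r)"
| gall: "ok (Some x) xs l \<Longrightarrow> ok (Some x) ys r \<Longrightarrow> (l, r) \<noteq> (Rt x, Rt x) \<Longrightarrow> ok None (x # xs @ ys) (Nd l r)"
| side_right: "ok None xs l \<Longrightarrow> ok (Some x) ys r \<Longrightarrow> ok (Some x) (xs @ ys) (Nd l r)"
| side_left: "ok (Some x) xs l \<Longrightarrow> ok None ys r \<Longrightarrow> ok (Some x) (xs @ ys) (Nd l r)"

inductive_cases ok_RtE: "ok q xs (Rt x)"
inductive_cases ok_NdE: "ok q xs (Nd l r)"

fun pend :: "utree \<Rightarrow> nat option" where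
  "pend (Lf x) = None"
| "pend (Rt x) = Some x"
| "pend (Nd l r) = (case pend l of None \<Rightarrow> pend r | Some x \<Rightarrow> if pend r = None then Some x else None)"

definition closes :: "utree \<Rightarrow> utree \<Rightarrow> bool" where
  "closes l r \<longleftrightarrow> pend l \<noteq> None \<and> pend r \<noteq> None"

fun labs :: "utree \<Rightarrow> nat list" where
  "labs (Lf x) = [x]"
| "labs (Rt x) = []"
| "labs (Nd l r) = (if closes l r then [the (pend l)] else []) @ labs l @ labs r"

lemma ok_pend: "ok q xs t \<Longrightarrow> pend t = q"
  by (induction rule: ok.induct) auto

lemma ok_labs: "ok q xs t \<Longrightarrow> labs t = xs"
  by (induction rule: ok.induct) (auto simp: closes_def dest!: ok_pend)

lemma ok_unique: "ok q xs t \<Longrightarrow> ok q' xs' t \<Longrightarrow> q = q' \<and> xs = xs'"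
  using ok_pend ok_labs by metis

lemma ok_None_nonempty: "ok q xs t \<Longrightarrow> q = None \<Longrightarrow> xs \<noteq> []"
  by (induction rule: ok.induct) auto

lemma ok_Some_Nil: "ok q xs t \<Longrightarrow> xs = [] \<Longrightarrow> q = Some x \<Longrightarrow> t = Rt x"
  by (cases rule: ok.cases) (auto dest: ok_None_nonempty)

fun pdepth :: "utree \<Rightarrow> nat" where
  "pdepth (Nd l r) = Suc (if pend l = None then pdepth r else pdepth l)"
| "pdepth _ = 0"

text \<open>
  The total depth of the labels in \<open>labs\<close>, where \<open>\<theta>\<close> scales a bound for the depth, below the top of
  its gall, of the leaf under a reticulation.
\<close>
fun depths :: "real \<Rightarrow> utree \<Rightarrow> real" where
  "depths \<theta> (Nd l r) = depths \<theta> l + depths \<theta> r + real (length (labs l)) + real (length (labs r))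
     + (if closes l r then \<theta> * (real (pdepth l) + real (pdepth r) + 2) else 0)"
| "depths \<theta> _ = 0"

fun wt :: "utree \<Rightarrow> real" where
  "wt (Nd l r) = wt l * wt r / 2"
| "wt _ = 1"

definition graft :: "(nat list \<Rightarrow> utree set) \<Rightarrow> (nat list \<Rightarrow> utree set) \<Rightarrow> nat list \<Rightarrow> (utree \<times> utree) set" where
  "graft X Y xs = (\<Union>k\<in>{0..length xs}. X (take k xs) \<times> Y (drop k xs))"

abbreviation oks :: "nat option \<Rightarrow> nat list \<Rightarrow> utree set" where
  "oks q xs \<equiv> {t. ok q xs t}"

lemma graft_iff:
  "(l, r) \<in> graft X Y xs \<longleftrightarrow> (\<exists>ys zs. xs = ys @ zs \<and> l \<in> X ys \<and> r \<in> Y zs)"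
proof
  assume "(l, r) \<in> graft X Y xs"
  then obtain k where "l \<in> X (take k xs)" "r \<in> Y (drop k xs)"
    by (auto simp: graft_def)
  then show "\<exists>ys zs. xs = ys @ zs \<and> l \<in> X ys \<and> r \<in> Y zs"
    using append_take_drop_id by metis
next
  assume "\<exists>ys zs. xs = ys @ zs \<and> l \<in> X ys \<and> r \<in> Y zs"
  then obtain ys zs where "xs = ys @ zs" "l \<in> X ys" "r \<in> Y zs"
    by blast
  then show "(l, r) \<in> graft X Y xs"
    unfolding graft_def by (intro UN_I [of "length ys"]) auto
qed

lemma finite_graft:
  assumes "\<And>k. k \<le> length xs \<Longrightarrow> finite (X (take k xs) \<times> Y (drop k xs))"
  shows "finite (graft X Y xs)"
  unfolding graft_def using assms by auto

lemma sum_graft: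
  assumes "\<And>k. k \<le> length xs \<Longrightarrow> finite (oks q (take k xs) \<times> oks q' (drop k xs))"
  shows "sum f (graft (oks q) (oks q') xs) = (\<Sum>k=0..length xs. sum f (oks q (take k xs) \<times> oks q' (drop k xs)))"
  unfolding graft_def
proof (rule sum.UNION_disjoint)
  show "\<forall>i\<in>{0..length xs}. \<forall>j\<in>{0..length xs}. i \<noteq> j \<longrightarrow>
    (oks q (take i xs) \<times> oks q' (drop i xs)) \<inter> (oks q (take j xs) \<times> oks q' (drop j xs)) = {}"
  proof (intro ballI impI)
    fix i j assume ij: "i \<in> {0..length xs}" "j \<in> {0..length xs}" "i \<noteq> j"
    then have "take i xs \<noteq> take j xs"
      by (metis atLeastAtMost_iff length_take min.absorb2)
    then show "(oks q (take i xs) \<times> oks q' (drop i xs)) \<inter> (oks q (take j xs) \<times> oks q' (drop j xs)) = {}"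
      by (auto dest: ok_unique)
  qed
qed (use assms in auto)

abbreviation nd :: "utree \<times> utree \<Rightarrow> utree" where "nd \<equiv> \<lambda>(l, r). Nd l r"

lemma inj_nd: "inj_on nd X"
  by (auto simp: inj_on_def)

lemma oks_None:
  "oks None xs = {t. \<exists>x. xs = [x] \<and> t = Lf x} \<union> nd ` graft (oks None) (oks None) xs
     \<union> (case xs of [] \<Rightarrow> {} | x # zs \<Rightarrow> nd ` (graft (oks (Some x)) (oks (Some x)) zs - {(Rt x, Rt x)}))"
  (is "?L = ?R")
proof (intro equalityI subsetI)
  fix t assume "t \<in> ?L"
  then have "ok None xs t"
    by simp
  then show "t \<in> ?R"
    by (cases rule: ok.cases) (force simp: graft_iff)+
next
  fix t assume "t \<in> ?R"
  then show "t \<in> ?L"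
  proof (elim UnE)
    assume "t \<in> {t. \<exists>x. xs = [x] \<and> t = Lf x}"
    then show ?thesis
      by (auto intro: ok.leaf)
  next
    assume "t \<in> nd ` graft (oks None) (oks None) xs"
    then obtain l r ys zs where "t = Nd l r" "xs = ys @ zs" "ok None ys l" "ok None zs r"
      by (auto simp: graft_iff)
    then show ?thesis
      by (simp add: ok.tree)
  next
    assume *: "t \<in> (case xs of [] \<Rightarrow> {} | x # zs \<Rightarrow> nd ` (graft (oks (Some x)) (oks (Some x)) zs - {(Rt x, Rt x)}))"
    then obtain x us where xs: "xs = x # us"
      by (cases xs) auto
    with * obtain p where p: "t = nd p" "p \<in> graft (oks (Some x)) (oks (Some x)) us" "p \<noteq> (Rt x, Rt x)"
      by auto
    then obtain l r ys zs where "p = (l, r)" "us = ys @ zs" "ok (Some x) ys l" "ok (Some x) zs r"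
      by (cases p) (auto simp: graft_iff)
    with p xs show ?thesis
      by (auto intro!: ok.gall)
  qed
qed

lemma oks_Some:
  "oks (Some x) xs = {t. xs = [] \<and> t = Rt x} \<union> nd ` graft (oks None) (oks (Some x)) xs
     \<union> nd ` graft (oks (Some x)) (oks None) xs" (is "?L = ?R")
proof (intro equalityI subsetI)
  fix t assume "t \<in> ?L"
  then have "ok (Some x) xs t"
    by simp
  then show "t \<in> ?R"
    by (cases rule: ok.cases) (force simp: graft_iff)+
next
  fix t assume "t \<in> ?R"
  then consider "xs = []" "t = Rt x"
    | l r ys zs where "t = Nd l r" "xs = ys @ zs" "ok None ys l" "ok (Some x) zs r"
    | l r ys zs where "t = Nd l r" "xs = ys @ zs" "ok (Some x) ys l" "ok None zs r"
    by (elim UnE imageE) (auto simp: graft_iff)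
  then show "t \<in> ?L"
    by cases (simp_all add: ok.ret ok.side_left ok.side_right)
qed

lemma oks_None_Nil [simp]: "oks None [] = {}"
  by (auto dest: ok_None_nonempty)

lemma oks_Some_Nil [simp]: "oks (Some x) [] = {Rt x}"
  by (auto dest: ok_Some_Nil intro: ok.intros)

lemma finite_oks: "finite (oks q xs)"
proof (induction "length xs" arbitrary: q xs rule: less_induct)
  case less
  have None: "finite (oks None xs)"
  proof (subst oks_None, intro finite_UnI finite_imageI)
    show "finite (graft (oks None) (oks None) xs)"
    proof (rule finite_graft)
      fix k assume "k \<le> length xs"
      then consider "k = 0" | "k = length xs" | "0 < k" "k < length xs"
        by linarith
      then show "finite (oks None (take k xs) \<times> oks None (drop k xs))"
        by cases (auto simp: less)
    qed
    show "finite (case xs of [] \<Rightarrow> {} | x # zs \<Rightarrow> nd ` (graft (oks (Some x)) (oks (Some x)) zs - {(Rt x, Rt x)}))"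
    proof (cases xs)
      case (Cons x zs)
      have "finite (graft (oks (Some x)) (oks (Some x)) zs)"
        by (rule finite_graft) (auto simp: less Cons)
      then show ?thesis
        by (simp add: Cons)
    qed simp
  qed (auto intro: finite_subset [of _ "{Lf (hd xs)}"])
  have "finite (oks (Some x) xs)" for x
  proof (subst oks_Some, intro finite_UnI finite_imageI)
    show "finite (graft (oks None) (oks (Some x)) xs)"
    proof (rule finite_graft)
      fix k assume "k \<le> length xs"
      then consider "k = 0" | "k = length xs" | "0 < k" "k < length xs"
        by linarith
      then show "finite (oks None (take k xs) \<times> oks (Some x) (drop k xs))"
        by cases (auto simp: less None)
    qed
    show "finite (graft (oks (Some x)) (oks None) xs)"
    proof (rule finite_graft)
      fix k assume "k \<le> length xs"
      then consider "k = 0" | "k = length xs" | "0 < k" "k < length xs"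
        by linarith
      then show "finite (oks (Some x) (take k xs) \<times> oks None (drop k xs))"
        by cases (auto simp: less None)
    qed
  qed simp
  with None show ?case
    by (cases q) auto
qed


lemma finite_grafts: "finite (graft (oks q) (oks q') ys)"
  by (rule finite_graft) (simp add: finite_oks)

lemma sum_grafts:
  "(\<Sum>p\<in>graft (oks q) (oks q') ys. f (nd p))
    = (\<Sum>k=0..length ys. \<Sum>l\<in>oks q (take k ys). \<Sum>r\<in>oks q' (drop k ys). f (Nd l r))"
  by (subst sum_graft) (simp_all add: finite_oks sum.cartesian_product case_prod_unfold)

lemma sum_nd_Un:
  assumes fin: "finite A" "finite B" "finite C" and A: "A \<inter> range nd = {}" and BC: "B \<inter> C = {}"
  shows "sum f (A \<union> (nd ` B \<union> nd ` C)) = sum f A + ((\<Sum>p\<in>B. f (nd p)) + (\<Sum>p\<in>C. f (nd p)))"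
proof -
  have "nd ` B \<inter> nd ` C = {}"
    by (simp only: inj_on_image_Int [OF inj_nd subset_UNIV subset_UNIV, symmetric] BC image_empty)
  then have "sum f (nd ` B \<union> nd ` C) = sum f (nd ` B) + sum f (nd ` C)"
    using fin by (intro sum.union_disjoint finite_imageI)
  moreover have "sum f (A \<union> (nd ` B \<union> nd ` C)) = sum f A + sum f (nd ` B \<union> nd ` C)"
    using fin A by (intro sum.union_disjoint finite_UnI finite_imageI) auto
  moreover have "sum f (nd ` X) = (\<Sum>p\<in>X. f (nd p))" for X
    by (subst sum.reindex [OF inj_nd]) (simp add: o_def)
  ultimately show ?thesis
    by simp
qed

lemma sum_oks_None:
  "sum f (oks None xs) = (if length xs = 1 then f (Lf (hd xs)) else 0)
     + (\<Sum>k=0..length xs. \<Sum>l\<in>oks None (take k xs). \<Sum>r\<in>oks None (drop k xs). f (Nd l r))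
     + (case xs of [] \<Rightarrow> 0 | x # zs \<Rightarrow>
         (\<Sum>k=0..length zs. \<Sum>l\<in>oks (Some x) (take k zs). \<Sum>r\<in>oks (Some x) (drop k zs). f (Nd l r))
         - (if zs = [] then f (Nd (Rt x) (Rt x)) else 0 :: real))"
proof -
  let ?A = "{t. \<exists>x. xs = [x] \<and> t = Lf x}" and ?B = "graft (oks None) (oks None) xs"
  let ?C = "case xs of [] \<Rightarrow> {} | x # zs \<Rightarrow> graft (oks (Some x)) (oks (Some x)) zs - {(Rt x, Rt x)}"
  have A: "finite ?A" "sum f ?A = (if length xs = 1 then f (Lf (hd xs)) else 0)"
  proof -
    have "?A = (if length xs = 1 then {Lf (hd xs)} else {})"
      by (cases xs) auto
    then show "finite ?A" "sum f ?A = (if length xs = 1 then f (Lf (hd xs)) else 0)"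
      by auto
  qed
  have C: "finite ?C" "(\<Sum>p\<in>?C. f (nd p)) = (case xs of [] \<Rightarrow> 0 | x # zs \<Rightarrow>
         (\<Sum>k=0..length zs. \<Sum>l\<in>oks (Some x) (take k zs). \<Sum>r\<in>oks (Some x) (drop k zs). f (Nd l r))
         - (if zs = [] then f (Nd (Rt x) (Rt x)) else 0 :: real))"
  proof -
    show "finite ?C"
      by (auto simp: finite_grafts split: list.split)
    have "(Rt x, Rt x) \<in> graft (oks (Some x)) (oks (Some x)) zs \<longleftrightarrow> zs = []" for x zs
      by (auto simp: graft_iff intro: ok.ret elim: ok_RtE)
    then show "(\<Sum>p\<in>?C. f (nd p)) = (case xs of [] \<Rightarrow> 0 | x # zs \<Rightarrow>
         (\<Sum>k=0..length zs. \<Sum>l\<in>oks (Some x) (take k zs). \<Sum>r\<in>oks (Some x) (drop k zs). f (Nd l r))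
         - (if zs = [] then f (Nd (Rt x) (Rt x)) else 0 :: real))"
      by (cases xs) (simp_all add: sum_diff1 finite_grafts sum_grafts)
  qed
  have disj: "?A \<inter> range nd = {}"
    by auto
  have BC: "?B \<inter> ?C = {}"
  proof -
    have "pend (fst p) = None" if "p \<in> ?B" for p
      using that by (cases p) (auto simp: graft_iff dest: ok_pend)
    moreover have "pend (fst p) \<noteq> None" if "p \<in> ?C" for p
      using that by (cases p; cases xs) (auto simp: graft_iff dest: ok_pend)
    ultimately show ?thesis
      by blast
  qed
  have "nd ` ?C = (case xs of [] \<Rightarrow> {} | x # zs \<Rightarrow> nd ` (graft (oks (Some x)) (oks (Some x)) zs - {(Rt x, Rt x)}))"
    by (cases xs) simp_all
  then have split: "oks None xs = ?A \<union> (nd ` ?B \<union> nd ` ?C)"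
    unfolding Un_assoc [symmetric] by (simp only: oks_None [of xs, symmetric])
  show ?thesis
    unfolding split sum_nd_Un [OF A(1) finite_grafts C(1) disj BC] A(2) C(2) sum_grafts by (simp only: add.assoc)
qed

lemma sum_oks_Some:
  "sum f (oks (Some x) xs) = (if xs = [] then f (Rt x) else 0)
     + (\<Sum>k=0..length xs. \<Sum>l\<in>oks None (take k xs). \<Sum>r\<in>oks (Some x) (drop k xs). f (Nd l r))
     + (\<Sum>k=0..length xs. \<Sum>l\<in>oks (Some x) (take k xs). \<Sum>r\<in>oks None (drop k xs). (f (Nd l r) :: real))"
proof -
  let ?A = "{t. xs = [] \<and> t = Rt x}" and ?B = "graft (oks None) (oks (Some x)) xs"
  let ?C = "graft (oks (Some x)) (oks None) xs"
  have A: "finite ?A" "sum f ?A = (if xs = [] then f (Rt x) else 0)"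
    by (cases xs; auto)+
  have disj: "?A \<inter> range nd = {}"
    by auto
  have BC: "?B \<inter> ?C = {}"
    by (auto simp: graft_iff dest: ok_unique)
  have split: "oks (Some x) xs = ?A \<union> (nd ` ?B \<union> nd ` ?C)"
    unfolding Un_assoc [symmetric] by (rule oks_Some)
  show ?thesis
    unfolding split sum_nd_Un [OF A(1) finite_grafts finite_grafts disj BC] A(2) sum_grafts by (simp only: add.assoc)
qed

section \<open>Weighted sums over unfoldings\<close>

lemma sum_pair_plus:
  fixes f g w :: "'a \<Rightarrow> real"
  shows "(\<Sum>l\<in>X. \<Sum>r\<in>Y. w l * w r / 2 * (f l + g r))
    = ((\<Sum>l\<in>X. w l * f l) * (\<Sum>r\<in>Y. w r) + (\<Sum>l\<in>X. w l) * (\<Sum>r\<in>Y. w r * g r)) / 2"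
  unfolding sum_product sum.distrib [symmetric] sum_divide_distrib
  by (simp add: algebra_simps add_divide_distrib)

lemma sum_pair:
  fixes w :: "'a \<Rightarrow> real"
  shows "(\<Sum>l\<in>X. \<Sum>r\<in>Y. w l * w r / 2) = (\<Sum>l\<in>X. w l) * (\<Sum>r\<in>Y. w r) / 2"
  unfolding sum_product sum_divide_distrib ..

definition paser :: "real \<Rightarrow> real fps" where "paser \<theta> = pser \<theta> + fps_X * fps_deriv aser"
definition qsser :: "real \<Rightarrow> real fps" where "qsser \<theta> = qser \<theta> + fps_X * fps_deriv sser"

lemma paser_nth: "fps_nth (paser \<theta>) n = fps_nth (pser \<theta>) n + real n * fps_nth aser n"
  and qsser_nth: "fps_nth (qsser \<theta>) n = fps_nth (qser \<theta>) n + real n * fps_nth sser n"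
  by (simp_all add: paser_def qsser_def fps_mult_fps_X_deriv_shift)

lemma fps_half_double: "fps_const (1/2) * (f + f) = (f :: real fps)"
proof -
  have "fps_const (1/2) * (f + f) = fps_const (1/2) * fps_const 2 * f"
    unfolding numeral_fps_const [symmetric] by (simp add: algebra_simps)
  then show ?thesis
    by simp
qed

lemma pser_sym:
  "pser \<theta> = fps_const (1/2) * (paser \<theta> * aser + aser * paser \<theta>)
    + fps_X * (fps_const (1/2) * ((qsser \<theta> + fps_const \<theta> * (vser + sser)) * sser
        + sser * (qsser \<theta> + fps_const \<theta> * (vser + sser))) - fps_const \<theta>)"
proof -
  have "fps_const (1/2) * (paser \<theta> * aser + aser * paser \<theta>) = aser * paser \<theta>"
    using fps_half_double [of "aser * paser \<theta>"] by (simp add: mult.commute)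
  moreover have "fps_const (1/2) * ((qsser \<theta> + fps_const \<theta> * (vser + sser)) * sser
        + sser * (qsser \<theta> + fps_const \<theta> * (vser + sser))) = sser * (qsser \<theta> + fps_const \<theta> * (vser + sser))"
    using fps_half_double [of "sser * (qsser \<theta> + fps_const \<theta> * (vser + sser))"] by (simp add: mult.commute)
  ultimately show ?thesis
    using pser_eq [of \<theta>] by (simp add: paser_def qsser_def algebra_simps)
qed

lemma qser_sym:
  "qser \<theta> = fps_const (1/2) * (paser \<theta> * sser + aser * qsser \<theta>) + fps_const (1/2) * (qsser \<theta> * aser + sser * paser \<theta>)"
proof -
  have "fps_deriv sser = fps_deriv aser * sser + aser * fps_deriv sser"
    using arg_cong [OF sser_eq, of fps_deriv] by (simp add: algebra_simps)
  then have *: "fps_X * fps_deriv sser = fps_X * (fps_deriv aser * sser + aser * fps_deriv sser)"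
    by (rule arg_cong)
  have "qser \<theta> = pser \<theta> * sser + aser * qser \<theta> + fps_X * (fps_deriv aser * sser + aser * fps_deriv sser)"
    by (rule trans [OF qser_eq]) (simp only: *)
  then have "qser \<theta> = paser \<theta> * sser + aser * qsser \<theta>"
    by (simp add: paser_def qsser_def algebra_simps)
  moreover have "fps_const (1/2) * (paser \<theta> * sser + aser * qsser \<theta>) + fps_const (1/2) * (qsser \<theta> * aser + sser * paser \<theta>)
      = fps_const (1/2) * ((paser \<theta> * sser + aser * qsser \<theta>) + (paser \<theta> * sser + aser * qsser \<theta>))"
    by (simp add: algebra_simps)
  ultimately show ?thesis
    unfolding fps_half_double by simp
qed

lemma vser_sym: "vser = fps_const (1/2) * (aser * (vser + sser)) + fps_const (1/2) * ((vser + sser) * aser)"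
proof -
  have "fps_const (1/2) * (aser * (vser + sser)) + fps_const (1/2) * ((vser + sser) * aser)
      = fps_const (1/2) * (aser * (vser + sser) + aser * (vser + sser))"
    by (simp add: algebra_simps)
  then show ?thesis
    unfolding fps_half_double using vser_eq by (simp add: algebra_simps)
qed

lemma sser_sym: "sser = 1 + fps_const (1/2) * (aser * sser) + fps_const (1/2) * (sser * aser)"
proof -
  have "fps_const (1/2) * (aser * sser) + fps_const (1/2) * (sser * aser) = fps_const (1/2) * (aser * sser + aser * sser)"
    by (simp add: algebra_simps)
  also have "\<dots> = aser * sser"
    by (rule fps_half_double)
  finally show ?thesis
    unfolding add.assoc using sser_eq by (simp only:)
qed

lemma pser_0: "fps_nth (pser \<theta>) 0 = 0"
  by (simp add: pser_def nser_def)

lemma nth_half_mult: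
  fixes f g :: "real fps"
  shows "fps_nth (fps_const (1/2) * (f * g)) n = (\<Sum>k=0..n. fps_nth f k * fps_nth g (n - k) / 2)"
  unfolding fps_mult_left_const_nth fps_mult_nth [of f g] by (simp add: sum_divide_distrib)

lemma nth_half_mult2:
  fixes f g :: "real fps"
  shows "fps_nth (fps_const (1/2) * (f * g + f' * g')) n
    = (\<Sum>k=0..n. (fps_nth f k * fps_nth g (n - k) + fps_nth f' k * fps_nth g' (n - k)) / 2)"
  unfolding fps_mult_left_const_nth fps_add_nth fps_mult_nth [of f g] fps_mult_nth [of f' g']
  by (simp add: sum_divide_distrib add_divide_distrib sum.distrib)

definition sumW :: "nat option \<Rightarrow> nat list \<Rightarrow> real" where "sumW q xs = (\<Sum>t\<in>oks q xs. wt t)"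
definition sumD :: "real \<Rightarrow> nat option \<Rightarrow> nat list \<Rightarrow> real" where "sumD \<theta> q xs = (\<Sum>t\<in>oks q xs. wt t * depths \<theta> t)"
definition sumE :: "real \<Rightarrow> nat option \<Rightarrow> nat list \<Rightarrow> real" where
  "sumE \<theta> q xs = (\<Sum>t\<in>oks q xs. wt t * (depths \<theta> t + real (length (labs t))))"
definition sumV :: "nat option \<Rightarrow> nat list \<Rightarrow> real" where "sumV q xs = (\<Sum>t\<in>oks q xs. wt t * real (pdepth t))"

lemma sumE_eq: "sumE \<theta> q xs = sumD \<theta> q xs + real (length xs) * sumW q xs"
  unfolding sumE_def sumD_def sumW_def sum_distrib_left sum.distrib [symmetric]
  by (rule sum.cong) (auto simp: algebra_simps dest: ok_labs)

lemma sumW_None: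
  "sumW None xs = (if length xs = 1 then 1 else 0)
     + (\<Sum>k=0..length xs. sumW None (take k xs) * sumW None (drop k xs) / 2)
     + (case xs of [] \<Rightarrow> 0 | x # zs \<Rightarrow>
         (\<Sum>k=0..length zs. sumW (Some x) (take k zs) * sumW (Some x) (drop k zs) / 2) - (if zs = [] then 1/2 else 0))"
  unfolding sumW_def sum_oks_None [of wt xs] by (simp add: sum_pair split: list.split)

lemma sumW_Some:
  "sumW (Some x) xs = (if xs = [] then 1 else 0)
     + (\<Sum>k=0..length xs. sumW None (take k xs) * sumW (Some x) (drop k xs) / 2)
     + (\<Sum>k=0..length xs. sumW (Some x) (take k xs) * sumW None (drop k xs) / 2)"
  unfolding sumW_def sum_oks_Some [of wt x xs] by (simp add: sum_pair)

lemma sumD_None: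
  "sumD \<theta> None xs = (\<Sum>k=0..length xs. (sumE \<theta> None (take k xs) * sumW None (drop k xs)
        + sumW None (take k xs) * sumE \<theta> None (drop k xs)) / 2)
     + (case xs of [] \<Rightarrow> 0 | x # zs \<Rightarrow>
         (\<Sum>k=0..length zs. ((sumE \<theta> (Some x) (take k zs) + \<theta> * (sumV (Some x) (take k zs) + sumW (Some x) (take k zs)))
              * sumW (Some x) (drop k zs)
            + sumW (Some x) (take k zs)
              * (sumE \<theta> (Some x) (drop k zs) + \<theta> * (sumV (Some x) (drop k zs) + sumW (Some x) (drop k zs)))) / 2)
         - (if zs = [] then \<theta> else 0))"
proof -
  let ?h = "\<lambda>t. depths \<theta> t + real (length (labs t))"
  let ?h' = "\<lambda>t. depths \<theta> t + real (length (labs t)) + \<theta> * (real (pdepth t) + 1)"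
  have tree: "(\<Sum>l\<in>oks None ys. \<Sum>r\<in>oks None zs. wt (Nd l r) * depths \<theta> (Nd l r))
      = (sumE \<theta> None ys * sumW None zs + sumW None ys * sumE \<theta> None zs) / 2" for ys zs
  proof -
    have "(\<Sum>l\<in>oks None ys. \<Sum>r\<in>oks None zs. wt (Nd l r) * depths \<theta> (Nd l r))
        = (\<Sum>l\<in>oks None ys. \<Sum>r\<in>oks None zs. wt l * wt r / 2 * (?h l + ?h r))"
      by (intro sum.cong) (auto simp: closes_def algebra_simps dest: ok_pend)
    then show ?thesis
      unfolding sum_pair_plus sumE_def sumW_def .
  qed
  have ext: "(\<Sum>t\<in>oks q ys. wt t * ?h' t) = sumE \<theta> q ys + \<theta> * (sumV q ys + sumW q ys)" for q ys
    unfolding sumE_def sumV_def sumW_def sum_distrib_left sum.distrib [symmetric]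
    by (intro sum.cong) (auto simp: algebra_simps)
  have gall: "(\<Sum>l\<in>oks (Some x) ys. \<Sum>r\<in>oks (Some x) zs. wt (Nd l r) * depths \<theta> (Nd l r))
      = ((sumE \<theta> (Some x) ys + \<theta> * (sumV (Some x) ys + sumW (Some x) ys)) * sumW (Some x) zs
         + sumW (Some x) ys * (sumE \<theta> (Some x) zs + \<theta> * (sumV (Some x) zs + sumW (Some x) zs))) / 2" for x ys zs
  proof -
    have "(\<Sum>l\<in>oks (Some x) ys. \<Sum>r\<in>oks (Some x) zs. wt (Nd l r) * depths \<theta> (Nd l r))
        = (\<Sum>l\<in>oks (Some x) ys. \<Sum>r\<in>oks (Some x) zs. wt l * wt r / 2 * (?h' l + ?h' r))"
      by (intro sum.cong) (auto simp: closes_def algebra_simps dest!: ok_pend)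
    then show ?thesis
      unfolding sum_pair_plus ext sumW_def [symmetric] .
  qed
  show ?thesis
    unfolding sumD_def sum_oks_None [of "\<lambda>t. wt t * depths \<theta> t" xs] tree gall
    by (simp add: closes_def split: list.split)
qed

lemma sumD_Some:
  "sumD \<theta> (Some x) xs = (\<Sum>k=0..length xs. (sumE \<theta> None (take k xs) * sumW (Some x) (drop k xs)
        + sumW None (take k xs) * sumE \<theta> (Some x) (drop k xs)) / 2)
     + (\<Sum>k=0..length xs. (sumE \<theta> (Some x) (take k xs) * sumW None (drop k xs)
        + sumW (Some x) (take k xs) * sumE \<theta> None (drop k xs)) / 2)"
proof -
  let ?h = "\<lambda>t. depths \<theta> t + real (length (labs t))"
  have pair: "(\<Sum>l\<in>oks q ys. \<Sum>r\<in>oks q' zs. wt (Nd l r) * depths \<theta> (Nd l r))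
      = (sumE \<theta> q ys * sumW q' zs + sumW q ys * sumE \<theta> q' zs) / 2" if "q = None \<or> q' = None" for q q' ys zs
  proof -
    have "(\<Sum>l\<in>oks q ys. \<Sum>r\<in>oks q' zs. wt (Nd l r) * depths \<theta> (Nd l r))
        = (\<Sum>l\<in>oks q ys. \<Sum>r\<in>oks q' zs. wt l * wt r / 2 * (?h l + ?h r))"
      using that by (intro sum.cong) (auto simp: closes_def algebra_simps dest: ok_pend)
    then show ?thesis
      unfolding sum_pair_plus sumE_def sumW_def .
  qed
  show ?thesis
    unfolding sumD_def sum_oks_Some [of "\<lambda>t. wt t * depths \<theta> t" x xs] by (simp add: pair del: wt.simps depths.simps(1))
qed

lemma sumV_Some:
  "sumV (Some x) xs = (\<Sum>k=0..length xs. sumW None (take k xs) * (sumV (Some x) (drop k xs) + sumW (Some x) (drop k xs)) / 2)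
     + (\<Sum>k=0..length xs. (sumV (Some x) (take k xs) + sumW (Some x) (take k xs)) * sumW None (drop k xs) / 2)"
proof -
  have ext: "(\<Sum>t\<in>oks q ys. wt t * (real (pdepth t) + 1)) = sumV q ys + sumW q ys" for q ys
    unfolding sumV_def sumW_def sum.distrib [symmetric] by (intro sum.cong) (auto simp: algebra_simps)
  have right: "(\<Sum>l\<in>oks None ys. \<Sum>r\<in>oks (Some x) zs. wt (Nd l r) * real (pdepth (Nd l r)))
      = sumW None ys * (sumV (Some x) zs + sumW (Some x) zs) / 2" for ys zs
  proof -
    have "(\<Sum>l\<in>oks None ys. \<Sum>r\<in>oks (Some x) zs. wt (Nd l r) * real (pdepth (Nd l r)))
        = (\<Sum>l\<in>oks None ys. \<Sum>r\<in>oks (Some x) zs. wt l * wt r / 2 * (0 + (real (pdepth r) + 1)))"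
      by (intro sum.cong) (auto dest: ok_pend)
    then show ?thesis
      unfolding sum_pair_plus ext sumW_def [symmetric] by simp
  qed
  have left: "(\<Sum>l\<in>oks (Some x) ys. \<Sum>r\<in>oks None zs. wt (Nd l r) * real (pdepth (Nd l r)))
      = (sumV (Some x) ys + sumW (Some x) ys) * sumW None zs / 2" for ys zs
  proof -
    have "(\<Sum>l\<in>oks (Some x) ys. \<Sum>r\<in>oks None zs. wt (Nd l r) * real (pdepth (Nd l r)))
        = (\<Sum>l\<in>oks (Some x) ys. \<Sum>r\<in>oks None zs. wt l * wt r / 2 * ((real (pdepth l) + 1) + 0))"
      by (intro sum.cong) (auto dest!: ok_pend)
    then show ?thesis
      unfolding sum_pair_plus ext sumW_def [symmetric] by simp
  qed
  show ?thesis
    unfolding sumV_def sum_oks_Some [of "\<lambda>t. wt t * real (pdepth t)" x xs]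
    unfolding left right unfolding sumV_def by simp
qed

lemma sum_Nil [simp]: "sumW None [] = 0" "sumE \<theta> None [] = 0" "sumW (Some x) [] = 1"
  "sumV (Some x) [] = 0" "sumE \<theta> (Some x) [] = 0"
  by (simp_all add: sumW_def sumE_def sumV_def)


lemma sum_splits_eq_coeff:
  fixes f g :: "real fps"
  assumes n: "length xs = n"
    and IH: "\<And>ys. length ys < n \<Longrightarrow> F ys = fps_nth f (length ys) \<and> G ys = fps_nth g (length ys)"
    and left: "F [] = 0 \<and> fps_nth f 0 = 0 \<or> G xs = fps_nth g n"
    and right: "G [] = 0 \<and> fps_nth g 0 = 0 \<or> F xs = fps_nth f n"
  shows "(\<Sum>k=0..length xs. F (take k xs) * G (drop k xs) / 2) = fps_nth (fps_const (1/2) * (f * g)) n"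
  unfolding nth_half_mult n
proof (intro sum.cong refl)
  fix k assume "k \<in> {0..n}"
  then consider "k = 0" "n = 0" | "k = 0" "0 < n" | "k = n" "0 < n" | "0 < k" "k < n"
    by force
  then show "F (take k xs) * G (drop k xs) / 2 = fps_nth f k * fps_nth g (n - k) / 2"
    using IH [of "take k xs"] IH [of "drop k xs"] left right n by cases auto
qed

lemma sum_splits_eq_coeff2:
  fixes a b :: "real fps"
  assumes "(\<Sum>k\<in>K. f k / 2) = fps_nth (fps_const (1/2) * a) n" "(\<Sum>k\<in>K. g k / 2) = fps_nth (fps_const (1/2) * b) n"
  shows "(\<Sum>k\<in>K. (f k + g k) / 2) = fps_nth (fps_const (1/2) * (a + b)) n"
  unfolding distrib_left fps_add_nth add_divide_distrib sum.distrib assms ..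

lemma sums_eq_coeffs:
  "sumW None xs = fps_nth aser (length xs) \<and> sumE \<theta> None xs = fps_nth (paser \<theta>) (length xs)
   \<and> sumW (Some x) xs = fps_nth sser (length xs) \<and> sumE \<theta> (Some x) xs = fps_nth (qsser \<theta>) (length xs)
   \<and> sumV (Some x) xs = fps_nth vser (length xs)"
proof (induction "length xs" arbitrary: xs x rule: less_induct)
  case less
  define n where "n = length xs"
  have ln: "length xs = n"
    by (simp add: n_def)
  have IH: "sumW None ys = fps_nth aser (length ys)" "sumE \<theta> None ys = fps_nth (paser \<theta>) (length ys)"
    "sumW (Some x) ys = fps_nth sser (length ys)" "sumE \<theta> (Some x) ys = fps_nth (qsser \<theta>) (length ys)"
    "sumV (Some x) ys = fps_nth vser (length ys)" if "length ys < n" for x ys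
    using less that by (auto simp: n_def)
  have paser_0: "fps_nth (paser \<theta>) 0 = 0"
    by (simp add: paser_nth pser_0)
  have W: "sumW None xs = fps_nth aser n"
  proof -
    have "(\<Sum>k=0..length xs. sumW None (take k xs) * sumW None (drop k xs) / 2) = fps_nth (fps_const (1/2) * (aser * aser)) n"
      by (rule sum_splits_eq_coeff [OF ln]) (simp_all add: IH aser_0)
    moreover have "(case xs of [] \<Rightarrow> 0 | x # zs \<Rightarrow>
         (\<Sum>k=0..length zs. sumW (Some x) (take k zs) * sumW (Some x) (drop k zs) / 2) - (if zs = [] then 1/2 else 0))
        = fps_nth (fps_X * (fps_const (1/2) * (sser * sser) - fps_const (1/2))) n"
      by (cases xs) (auto simp: nth_half_mult IH n_def simp del: fps_mult_left_const_nth)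
    moreover have "aser = fps_X + fps_const (1/2) * (aser * aser) + fps_X * (fps_const (1/2) * (sser * sser) - fps_const (1/2))"
      by (rule trans [OF aser_eq]) (simp add: algebra_simps)
    from arg_cong [OF this, of "\<lambda>f. fps_nth f n"]
    have "fps_nth aser n = (if n = 1 then 1 else 0) + fps_nth (fps_const (1/2) * (aser * aser)) n
        + fps_nth (fps_X * (fps_const (1/2) * (sser * sser) - fps_const (1/2))) n"
      by (simp only: fps_add_nth fps_X_nth)
    ultimately show ?thesis
      unfolding sumW_None [of xs] by (simp only: ln)
  qed
  have D: "sumD \<theta> None xs = fps_nth (pser \<theta>) n"
  proof -
    have "(\<Sum>k=0..length xs. (sumE \<theta> None (take k xs) * sumW None (drop k xs)
        + sumW None (take k xs) * sumE \<theta> None (drop k xs)) / 2)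
        = fps_nth (fps_const (1/2) * (paser \<theta> * aser + aser * paser \<theta>)) n"
      by (intro sum_splits_eq_coeff2 sum_splits_eq_coeff [OF ln]) (simp_all add: IH aser_0 paser_0)
    moreover have "(case xs of [] \<Rightarrow> 0 | x # zs \<Rightarrow>
         (\<Sum>k=0..length zs. ((sumE \<theta> (Some x) (take k zs) + \<theta> * (sumV (Some x) (take k zs) + sumW (Some x) (take k zs)))
              * sumW (Some x) (drop k zs)
            + sumW (Some x) (take k zs)
              * (sumE \<theta> (Some x) (drop k zs) + \<theta> * (sumV (Some x) (drop k zs) + sumW (Some x) (drop k zs)))) / 2)
         - (if zs = [] then \<theta> else 0))
      = fps_nth (fps_X * (fps_const (1/2) * ((qsser \<theta> + fps_const \<theta> * (vser + sser)) * sser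
        + sser * (qsser \<theta> + fps_const \<theta> * (vser + sser))) - fps_const \<theta>)) n"
      unfolding fps_X_mult_nth fps_sub_nth nth_half_mult2
      by (cases xs) (auto simp: IH n_def)
    ultimately show ?thesis
      unfolding sumD_None [of \<theta> xs]
      using arg_cong [OF pser_sym [of \<theta>], of "\<lambda>f. fps_nth f n"] by (simp only: fps_add_nth)
  qed
  have E: "sumE \<theta> None xs = fps_nth (paser \<theta>) n"
    unfolding sumE_eq W D paser_nth n_def ..
  note rules = IH W E aser_0 paser_0
  have WS: "sumW (Some x) xs = fps_nth sser n"
  proof -
    have "(\<Sum>k=0..length xs. sumW None (take k xs) * sumW (Some x) (drop k xs) / 2) = fps_nth (fps_const (1/2) * (aser * sser)) n"
      by (rule sum_splits_eq_coeff [OF ln]) (simp_all add: rules)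
    moreover have "(\<Sum>k=0..length xs. sumW (Some x) (take k xs) * sumW None (drop k xs) / 2) = fps_nth (fps_const (1/2) * (sser * aser)) n"
      by (rule sum_splits_eq_coeff [OF ln]) (simp_all add: rules)
    ultimately show ?thesis
      unfolding sumW_Some [of x xs]
      using arg_cong [OF sser_sym, of "\<lambda>f. fps_nth f n"]
      unfolding fps_add_nth fps_one_nth by (simp only: ln length_0_conv [symmetric])
  qed
  have DS: "sumD \<theta> (Some x) xs = fps_nth (qser \<theta>) n"
  proof -
    have "(\<Sum>k=0..length xs. (sumE \<theta> None (take k xs) * sumW (Some x) (drop k xs)
          + sumW None (take k xs) * sumE \<theta> (Some x) (drop k xs)) / 2)
        = fps_nth (fps_const (1/2) * (paser \<theta> * sser + aser * qsser \<theta>)) n"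
      by (intro sum_splits_eq_coeff2 sum_splits_eq_coeff [OF ln]) (simp_all add: rules)
    moreover have "(\<Sum>k=0..length xs. (sumE \<theta> (Some x) (take k xs) * sumW None (drop k xs)
          + sumW (Some x) (take k xs) * sumE \<theta> None (drop k xs)) / 2)
        = fps_nth (fps_const (1/2) * (qsser \<theta> * aser + sser * paser \<theta>)) n"
      by (intro sum_splits_eq_coeff2 sum_splits_eq_coeff [OF ln]) (simp_all add: rules)
    ultimately show ?thesis
      unfolding sumD_Some [of \<theta> x xs]
      using arg_cong [OF qser_sym [of \<theta>], of "\<lambda>f. fps_nth f n"] by (simp only: fps_add_nth)
  qed
  have VS: "sumV (Some x) xs = fps_nth vser n"
  proof -
    have "(\<Sum>k=0..length xs. sumW None (take k xs) * (sumV (Some x) (drop k xs) + sumW (Some x) (drop k xs)) / 2)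
        = fps_nth (fps_const (1/2) * (aser * (vser + sser))) n"
      by (rule sum_splits_eq_coeff [OF ln]) (simp_all add: rules)
    moreover have "(\<Sum>k=0..length xs. (sumV (Some x) (take k xs) + sumW (Some x) (take k xs)) * sumW None (drop k xs) / 2)
        = fps_nth (fps_const (1/2) * ((vser + sser) * aser)) n"
      by (rule sum_splits_eq_coeff [OF ln, where F = "\<lambda>ys. sumV (Some x) ys + sumW (Some x) ys"]) (simp_all add: rules)
    ultimately show ?thesis
      unfolding sumV_Some [of x xs]
      using arg_cong [OF vser_sym, of "\<lambda>f. fps_nth f n"] by (simp only: fps_add_nth [of "fps_const _ * _"])
  qed
  have ES: "sumE \<theta> (Some x) xs = fps_nth (qsser \<theta>) n"
    unfolding sumE_eq WS DS qsser_nth n_def ..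
  show ?case
    using W E WS ES VS by (simp add: n_def)
qed

lemma sum_wt_eq: "(\<Sum>t\<in>oks None xs. wt t) = fps_nth aser (length xs)"
  using sums_eq_coeffs [of xs 0] by (simp add: sumW_def)

lemma sum_depths_eq: "(\<Sum>t\<in>oks None xs. wt t * depths \<theta> t) = fps_nth (pser \<theta>) (length xs)"
  using sums_eq_coeffs [of xs \<theta> 0] sumE_eq [of \<theta> None xs] by (auto simp: sumD_def paser_nth)

section \<open>Path lengths in unfoldings\<close>

fun plen :: "utree \<Rightarrow> nat \<Rightarrow> nat set" where
  "plen (Lf y) x = (if x = y then {0} else {})"
| "plen (Rt y) x = (if x = y then {1} else {})"
| "plen (Nd l r) x = Suc ` (plen l x \<union> plen r x)"

lemma finite_plen: "finite (plen t x)"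
  by (induction t) auto

lemma plen_nonempty_iff: "ok q xs t \<Longrightarrow> plen t x \<noteq> {} \<longleftrightarrow> x \<in> set xs \<union> set_option q"
  by (induction rule: ok.induct) auto

lemma plen_pending: "ok q xs t \<Longrightarrow> q = Some z \<Longrightarrow> z \<notin> set xs \<Longrightarrow> plen t z = {Suc (pdepth t)}"
proof (induction rule: ok.induct)
  case (side_right xs l x ys r)
  then have "plen l z = {}"
    using plen_nonempty_iff [OF side_right(1), of z] by auto
  with side_right show ?case
    by (auto dest: ok_pend)
next
  case (side_left x xs l ys r)
  then have "plen r z = {}"
    using plen_nonempty_iff [OF side_left(2), of z] by auto
  with side_left show ?case
    by (auto dest!: ok_pend)
qed auto

lemma sum_Min_plen_Suc:
  assumes "\<And>x. x \<in> A \<Longrightarrow> plen t x = Suc ` plen s x" "\<And>x. x \<in> A \<Longrightarrow> plen s x \<noteq> {}"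
  shows "(\<Sum>x\<in>A. Min (plen t x)) = (\<Sum>x\<in>A. Min (plen s x)) + card A"
    and "(\<Sum>x\<in>A. Max (plen t x)) = (\<Sum>x\<in>A. Max (plen s x)) + card A"
proof -
  have "Min (plen t x) = Min (plen s x) + 1" "Max (plen t x) = Max (plen s x) + 1" if "x \<in> A" for x
    using assms that mono_Min_commute [of Suc "plen s x"] mono_Max_commute [of Suc "plen s x"]
    by (simp_all add: finite_plen mono_Suc)
  then show "(\<Sum>x\<in>A. Min (plen t x)) = (\<Sum>x\<in>A. Min (plen s x)) + card A"
    "(\<Sum>x\<in>A. Max (plen t x)) = (\<Sum>x\<in>A. Max (plen s x)) + card A"
    by (simp_all add: sum_Suc)
qed

lemma plen_sums_append:
  assumes "ok q xs l" "ok q' ys r" "distinct (xs @ ys)"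
    "set_option q \<inter> set ys = {}" "set_option q' \<inter> set xs = {}"
  shows "(\<Sum>x\<in>set (xs @ ys). Min (plen (Nd l r) x))
      = (\<Sum>x\<in>set xs. Min (plen l x)) + (\<Sum>x\<in>set ys. Min (plen r x)) + length xs + length ys"
    and "(\<Sum>x\<in>set (xs @ ys). Max (plen (Nd l r) x))
      = (\<Sum>x\<in>set xs. Max (plen l x)) + (\<Sum>x\<in>set ys. Max (plen r x)) + length xs + length ys"
proof -
  have l: "plen (Nd l r) x = Suc ` plen l x" "plen l x \<noteq> {}" if "x \<in> set xs" for x
    using that assms plen_nonempty_iff [OF assms(1), of x] plen_nonempty_iff [OF assms(2), of x] by auto
  have r: "plen (Nd l r) x = Suc ` plen r x" "plen r x \<noteq> {}" if "x \<in> set ys" for x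
    using that assms plen_nonempty_iff [OF assms(1), of x] plen_nonempty_iff [OF assms(2), of x] by auto
  have "set xs \<inter> set ys = {}" and card: "card (set xs) = length xs" "card (set ys) = length ys"
    using assms(3) by (auto simp: distinct_card)
  then have split: "sum f (set (xs @ ys)) = sum f (set xs) + sum f (set ys)" for f :: "nat \<Rightarrow> nat"
    by (simp add: sum.union_disjoint)
  show "(\<Sum>x\<in>set (xs @ ys). Min (plen (Nd l r) x))
      = (\<Sum>x\<in>set xs. Min (plen l x)) + (\<Sum>x\<in>set ys. Min (plen r x)) + length xs + length ys"
    unfolding split using sum_Min_plen_Suc(1) [of "set xs" "Nd l r" l, OF l] sum_Min_plen_Suc(1) [of "set ys" "Nd l r" r, OF r]
    by (simp only: card)
  show "(\<Sum>x\<in>set (xs @ ys). Max (plen (Nd l r) x))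
      = (\<Sum>x\<in>set xs. Max (plen l x)) + (\<Sum>x\<in>set ys. Max (plen r x)) + length xs + length ys"
    unfolding split using sum_Min_plen_Suc(2) [of "set xs" "Nd l r" l, OF l] sum_Min_plen_Suc(2) [of "set ys" "Nd l r" r, OF r]
    by (simp only: card)
qed

lemma depths_bounds:
  "ok q xs t \<Longrightarrow> distinct xs \<Longrightarrow> set_option q \<inter> set xs = {} \<Longrightarrow>
    depths 0 t \<le> real (\<Sum>x\<in>set xs. Min (plen t x)) \<and> real (\<Sum>x\<in>set xs. Max (plen t x)) \<le> depths 1 t"
proof (induction rule: ok.induct)
  case (tree xs l ys r)
  have "depths 0 l \<le> real (\<Sum>x\<in>set xs. Min (plen l x)) \<and> real (\<Sum>x\<in>set xs. Max (plen l x)) \<le> depths 1 l"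
    "depths 0 r \<le> real (\<Sum>x\<in>set ys. Min (plen r x)) \<and> real (\<Sum>x\<in>set ys. Max (plen r x)) \<le> depths 1 r"
    using tree by auto
  then show ?case
    using plen_sums_append [OF tree(1,2)] tree ok_labs [OF tree(1)] ok_labs [OF tree(2)]
      ok_pend [OF tree(1)] ok_pend [OF tree(2)]
    by (simp add: closes_def del: plen.simps set_append of_nat_sum)
next
  case (gall x xs l ys r)
  have IH: "depths 0 l \<le> real (\<Sum>x\<in>set xs. Min (plen l x)) \<and> real (\<Sum>x\<in>set xs. Max (plen l x)) \<le> depths 1 l"
    "depths 0 r \<le> real (\<Sum>x\<in>set ys. Min (plen r x)) \<and> real (\<Sum>x\<in>set ys. Max (plen r x)) \<le> depths 1 r"
    using gall by auto
  have x: "x \<notin> set (xs @ ys)"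
    using gall by auto
  have "plen l x = {Suc (pdepth l)}" "plen r x = {Suc (pdepth r)}"
    using x plen_pending [OF gall(1)] plen_pending [OF gall(2)] by auto
  then have "plen (Nd l r) x = {Suc (Suc (pdepth l)), Suc (Suc (pdepth r))}"
    by auto
  then have "Max (plen (Nd l r) x) \<le> pdepth l + pdepth r + 2"
    by simp
  moreover have "(\<Sum>y\<in>set (x # xs @ ys). f y) = f x + (\<Sum>y\<in>set (xs @ ys). f y)" for f :: "nat \<Rightarrow> nat"
    using x by simp
  moreover have "x \<notin> set xs" "x \<notin> set ys"
    using x by auto
  ultimately show ?case
    using plen_sums_append [OF gall(1,2)] gall ok_labs [OF gall(1)] ok_labs [OF gall(2)]
      ok_pend [OF gall(1)] ok_pend [OF gall(2)] IH
    by (simp add: closes_def del: plen.simps set_append of_nat_sum list.set)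
next
  case (side_right xs l x ys r)
  have IH: "depths 0 l \<le> real (\<Sum>x\<in>set xs. Min (plen l x)) \<and> real (\<Sum>x\<in>set xs. Max (plen l x)) \<le> depths 1 l"
    "depths 0 r \<le> real (\<Sum>x\<in>set ys. Min (plen r x)) \<and> real (\<Sum>x\<in>set ys. Max (plen r x)) \<le> depths 1 r"
    using side_right by auto
  have "set_option (Some x) \<inter> set xs = {}"
    using side_right by auto
  then show ?case
    using plen_sums_append [OF side_right(1,2)] side_right ok_labs [OF side_right(1)] ok_labs [OF side_right(2)]
      ok_pend [OF side_right(1)] ok_pend [OF side_right(2)] IH
    by (simp add: closes_def del: plen.simps set_append of_nat_sum)
next
  case (side_left x xs l ys r)
  have IH: "depths 0 l \<le> real (\<Sum>x\<in>set xs. Min (plen l x)) \<and> real (\<Sum>x\<in>set xs. Max (plen l x)) \<le> depths 1 l"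
    "depths 0 r \<le> real (\<Sum>x\<in>set ys. Min (plen r x)) \<and> real (\<Sum>x\<in>set ys. Max (plen r x)) \<le> depths 1 r"
    using side_left by auto
  have "set_option (Some x) \<inter> set ys = {}"
    using side_left by auto
  then show ?case
    using plen_sums_append [OF side_left(1,2)] side_left ok_labs [OF side_left(1)] ok_labs [OF side_left(2)]
      ok_pend [OF side_left(1)] ok_pend [OF side_left(2)] IH
    by (simp add: closes_def del: plen.simps set_append of_nat_sum)
qed auto

section \<open>Networks and their unfoldings\<close>

definition succs :: "net \<Rightarrow> nat \<Rightarrow> nat set" where "succs G v = {w. (v, w) \<in> arcs G}"
definition preds :: "net \<Rightarrow> nat \<Rightarrow> nat set" where "preds G v = {u. (u, v) \<in> arcs G}"

lemma mem_succs [simp]: "w \<in> succs G v \<longleftrightarrow> (v, w) \<in> arcs G"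
  and mem_preds [simp]: "u \<in> preds G v \<longleftrightarrow> (u, v) \<in> arcs G"
  by (auto simp: succs_def preds_def)

lemma indeg_preds: "indeg G v = card (preds G v)" and outdeg_succs: "outdeg G v = card (succs G v)"
  by (simp_all add: indeg_def outdeg_def preds_def succs_def)

fun rep :: "net \<Rightarrow> nat \<Rightarrow> utree \<Rightarrow> bool" where
  "rep G v (Lf x) \<longleftrightarrow> v = x \<and> x \<in> leaves G"
| "rep G v (Rt x) \<longleftrightarrow> succs G v = {x} \<and> x \<in> leaves G"
| "rep G v (Nd l r) \<longleftrightarrow> (\<exists>a b. a \<noteq> b \<and> succs G v = {a, b} \<and> rep G a l \<and> rep G b r)"

lemma rep_meet: "rep G a s \<Longrightarrow> rep H b s \<Longrightarrow> (\<And>x. x \<in> leaves G \<Longrightarrow> succs G x = {}) \<Longrightarrow>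
    (\<And>x. x \<in> leaves H \<Longrightarrow> succs H x = {}) \<Longrightarrow> rep G a t \<Longrightarrow> rep H b t"
proof (induction s arbitrary: a b t)
  case (Lf x)
  then show ?case
    by (cases t) auto
next
  case (Rt x)
  then show ?case
    by (cases t) (auto simp: doubleton_eq_iff)
next
  case (Nd l r)
  note leaf = Nd.prems(3,4)
  obtain c d where cd: "c \<noteq> d" "succs G a = {c, d}" "rep G c l" "rep G d r"
    using Nd.prems(1) by auto
  obtain c' d' where cd': "c' \<noteq> d'" "succs H b = {c', d'}" "rep H c' l" "rep H d' r"
    using Nd.prems(2) by auto
  from Nd.prems(5) cd leaf(1) obtain l' r' where t: "t = Nd l' r'"
    by (cases t) (auto simp: doubleton_eq_iff)
  then obtain e f where "e \<noteq> f" "succs G a = {e, f}" "rep G e l'" "rep G f r'"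
    using Nd.prems(5) by auto
  with cd consider "rep G c l'" "rep G d r'" | "rep G d l'" "rep G c r'"
    by (auto simp: doubleton_eq_iff)
  then show ?case
  proof cases
    case 1
    with Nd.IH(1) [OF cd(3) cd'(3) leaf] Nd.IH(2) [OF cd(4) cd'(4) leaf] cd' show ?thesis
      unfolding t by auto
  next
    case 2
    with Nd.IH(1) [OF cd(3) cd'(3) leaf] Nd.IH(2) [OF cd(4) cd'(4) leaf] cd' show ?thesis
      unfolding t rep.simps by (intro exI [of _ d'] exI [of _ c']) auto
  qed
qed

definition plens :: "net \<Rightarrow> nat \<Rightarrow> nat \<Rightarrow> nat set" where
  "plens G v x = {length p - 1 | p. dpath G p \<and> hd p = v \<and> last p = x}"

lemma dpath_Cons: "dpath G (v # p) \<longleftrightarrow> p = [] \<or> (v, hd p) \<in> arcs G \<and> dpath G p"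
proof (cases p)
  case (Cons w q)
  show ?thesis
    unfolding dpath_def Cons by (auto simp: nth_Cons split: nat.splits)
qed (simp add: dpath_def)

lemma dpath_singleton [simp]: "dpath G [v]"
  by (simp add: dpath_def)

lemma plens_rec: "plens G v x = (if v = x then {0} else {}) \<union> Suc ` (\<Union>w\<in>succs G v. plens G w x)"
proof (intro equalityI subsetI)
  fix k assume "k \<in> plens G v x"
  then obtain p where p: "k = length p - 1" "dpath G p" "hd p = v" "last p = x"
    by (auto simp: plens_def)
  then obtain q where q: "p = v # q"
    by (cases p) (auto simp: dpath_def)
  show "k \<in> (if v = x then {0} else {}) \<union> Suc ` (\<Union>w\<in>succs G v. plens G w x)"
  proof (cases "q = []")
    case True
    with p q show ?thesis by auto
  next
    case False
    with p q have "length q - 1 \<in> plens G (hd q) x" "hd q \<in> succs G v" "k = Suc (length q - 1)"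
      by (auto simp: plens_def dpath_Cons)
    then show ?thesis
      by blast
  qed
next
  fix k assume "k \<in> (if v = x then {0} else {}) \<union> Suc ` (\<Union>w\<in>succs G v. plens G w x)"
  then consider "k = 0" "v = x" | w j where "(v, w) \<in> arcs G" "j \<in> plens G w x" "k = Suc j"
    by (auto split: if_splits)
  then show "k \<in> plens G v x"
  proof cases
    case 1
    then show ?thesis
      by (auto simp: plens_def intro!: exI [of _ "[v]"])
  next
    case 2
    then obtain p where p: "j = length p - 1" "dpath G p" "hd p = w" "last p = x"
      by (auto simp: plens_def)
    then have "p \<noteq> []"
      by (simp add: dpath_def)
    with p 2 show ?thesis
      by (auto simp: plens_def dpath_Cons intro!: exI [of _ "v # p"])
  qed
qed

lemma plens_eq_plen:
  assumes "\<And>y. y \<in> leaves G \<Longrightarrow> succs G y = {}" "x \<in> leaves G"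
  shows "rep G v t \<Longrightarrow> plens G v x = plen t x"
proof (induction t arbitrary: v)
  case (Lf y)
  then show ?case
    using assms by (subst plens_rec) auto
next
  case (Rt y)
  then have "v \<noteq> x" "succs G v = {y}" "y \<in> leaves G"
    using assms by auto
  moreover have "plens G y x = (if y = x then {0} else {})"
    using assms \<open>y \<in> leaves G\<close> by (subst plens_rec) auto
  ultimately show ?case
    by (subst plens_rec) auto
next
  case (Nd l r)
  then obtain a b where "a \<noteq> b" "succs G v = {a, b}" "rep G a l" "rep G b r"
    by auto
  moreover from this have "v \<noteq> x"
    using assms by auto
  ultimately show ?case
    using Nd.IH by (subst plens_rec) (auto simp: image_Un)
qed

locale network =
  fixes G :: net
  assumes network: "is_network G"
begin

lemma finite_verts: "finite (verts G)" and arcs_verts: "(u, v) \<in> arcs G \<Longrightarrow> u \<in> verts G \<and> v \<in> verts G"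
  and acyclic: "acyclic (arcs G)"
  using network by (auto simp: is_network_def)

lemma finite_arcs: "finite (arcs G)"
  by (rule finite_subset [of _ "verts G \<times> verts G"]) (use network in \<open>auto simp: is_network_def\<close>)

lemma finite_succs: "finite (succs G v)" and finite_preds: "finite (preds G v)"
  by (rule finite_subset [OF _ finite_verts], use arcs_verts in auto)+

lemma no_cycle: "(u, u) \<notin> (arcs G)\<^sup>+"
  using acyclic by (simp add: acyclic_def)

lemma vertex_cases:
  assumes "v \<in> verts G"
  obtains "is_root G v" | "is_leaf G v" | "is_tree_node G v" | "is_reticulation G v"
  using assms network by (auto simp: is_network_def)

lemma card1E: assumes "card A = 1" obtains a where "A = {a}"
  using assms by (auto simp: card_1_singleton_iff)

lemma leaf_succs: "is_leaf G v \<Longrightarrow> succs G v = {}"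
  using finite_succs by (auto simp: is_leaf_def outdeg_succs)

lemma leaves_succs: "v \<in> leaves G \<Longrightarrow> succs G v = {}"
  by (simp add: leaves_def leaf_succs)

lemma inner_succs:
  assumes "is_root G v \<or> is_tree_node G v" obtains a b where "a \<noteq> b" "succs G v = {a, b}"
  using assms by (auto simp: is_root_def is_tree_node_def outdeg_succs card_2_iff)

lemma ret_succs: assumes "is_reticulation G v" obtains x where "succs G v = {x}"
  using assms by (auto simp: is_reticulation_def outdeg_succs card_1_singleton_iff)

lemma indeg1_unique:
  assumes "is_leaf G v \<or> is_tree_node G v" "(a, v) \<in> arcs G" "(b, v) \<in> arcs G"
  shows "a = b"
proof -
  have "card (preds G v) = 1"
    using assms(1) by (auto simp: is_leaf_def is_tree_node_def indeg_preds)
  then obtain c where "preds G v = {c}"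
    by (rule card1E)
  then show ?thesis
    using assms(2,3) by (metis mem_preds singletonD)
qed

lemma root_no_preds: "is_root G v \<Longrightarrow> (a, v) \<notin> arcs G"
  using finite_preds [of v] by (auto simp: is_root_def indeg_preds)

lemma nonret_unique_pred:
  assumes "\<not> is_reticulation G v" "(a, v) \<in> arcs G" "(b, v) \<in> arcs G"
  shows "a = b"
  using assms arcs_verts root_no_preds indeg1_unique by (metis vertex_cases)

lemma root_unique: "is_root G u \<Longrightarrow> is_root G v \<Longrightarrow> u = v"
  using network by (auto simp: is_network_def is_root_def)

lemma indeg0_is_root: "v \<in> verts G \<Longrightarrow> indeg G v = 0 \<Longrightarrow> is_root G v"
  by (erule vertex_cases) (simp_all add: is_leaf_def is_tree_node_def is_reticulation_def)

lemma root_is_root: "is_root G (Defs.root G)" and root_eq: "is_root G v \<Longrightarrow> v = Defs.root G"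
proof -
  have ex1: "\<exists>!r. r \<in> verts G \<and> indeg G r = 0"
    using network by (simp add: is_network_def)
  then have r: "Defs.root G \<in> verts G" "indeg G (Defs.root G) = 0"
    using theI' [OF ex1] by (simp_all add: Defs.root_def)
  then show "is_root G (Defs.root G)"
    by (rule indeg0_is_root)
  then show "is_root G v \<Longrightarrow> v = Defs.root G"
    using root_unique by blast
qed

lemma wf_converse: "wf ((arcs G)\<inverse>)" and wf_arcs: "wf (arcs G)"
  using finite_acyclic_wf_converse finite_acyclic_wf finite_arcs acyclic by blast+

lemma root_reaches: "v \<in> verts G \<Longrightarrow> (Defs.root G, v) \<in> (arcs G)\<^sup>*"
proof (induction v rule: wf_induct_rule [OF wf_arcs])
  case (1 v)
  show ?case
  proof (cases "preds G v = {}")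
    case True
    then have "indeg G v = 0"
      by (simp add: indeg_preds)
    with 1(2) have "is_root G v"
      by (rule indeg0_is_root)
    then show ?thesis
      using root_eq by auto
  next
    case False
    then obtain u where "(u, v) \<in> arcs G"
      by auto
    then show ?thesis
      using 1 arcs_verts by (meson rtrancl.rtrancl_into_rtrancl)
  qed
qed

end

section \<open>Tree cycles\<close>

lemma path_arcs_iff: "(a, b) \<in> path_arcs P \<longleftrightarrow> (\<exists>i. Suc i < length P \<and> P ! i = a \<and> P ! Suc i = b)"
proof -
  have "(\<exists>i. i < length P \<and> i < length P - 1 \<and> P ! i = a \<and> P ! Suc i = b) \<longleftrightarrow> (\<exists>i. Suc i < length P \<and> P ! i = a \<and> P ! Suc i = b)"
    by (intro iff_exI) auto
  then show ?thesis
    by (auto simp: path_arcs_def in_set_zip nth_tl)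
qed

lemma dpath_path_arcs: "dpath G P \<longleftrightarrow> P \<noteq> [] \<and> path_arcs P \<subseteq> arcs G"
  unfolding dpath_def subset_iff by (auto simp: path_arcs_iff)

lemma path_arcs_set: "(a, b) \<in> path_arcs P \<Longrightarrow> a \<in> set P \<and> b \<in> set P"
  by (auto simp: path_arcs_iff intro!: nth_mem)

lemma pred_in_path: "b \<in> set P \<Longrightarrow> b \<noteq> hd P \<Longrightarrow> \<exists>p. (p, b) \<in> path_arcs P"
proof -
  assume b: "b \<in> set P" "b \<noteq> hd P"
  then obtain i where i: "i < length P" "P ! i = b"
    by (auto simp: in_set_conv_nth)
  with b have "i \<noteq> 0"
    by (metis hd_conv_nth length_greater_0_conv list.size(3) not_less_zero)
  with i show ?thesis
    by (auto simp: path_arcs_iff intro!: exI [of _ "P ! (i - 1)"] exI [of _ "i - 1"])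
qed

lemma succ_in_path: "b \<in> set P \<Longrightarrow> b \<noteq> last P \<Longrightarrow> \<exists>s. (b, s) \<in> path_arcs P"
proof -
  assume b: "b \<in> set P" "b \<noteq> last P"
  then obtain i where i: "i < length P" "P ! i = b"
    by (auto simp: in_set_conv_nth)
  with b have "i \<noteq> length P - 1"
    by (metis last_conv_nth length_0_conv not_less_zero)
  with i have "(b, P ! Suc i) \<in> path_arcs P"
    by (auto simp: path_arcs_iff intro!: exI [of _ i])
  then show ?thesis ..
qed

lemma tree_cycle_sym: "tree_cycle G P Q \<Longrightarrow> tree_cycle G Q P"
  by (auto simp: tree_cycle_def)

lemma node_types_disjoint:
  "is_leaf G v \<Longrightarrow> \<not> is_root G v" "is_leaf G v \<Longrightarrow> \<not> is_tree_node G v" "is_leaf G v \<Longrightarrow> \<not> is_reticulation G v"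
  "is_root G v \<Longrightarrow> \<not> is_tree_node G v" "is_root G v \<Longrightarrow> \<not> is_reticulation G v"
  "is_tree_node G v \<Longrightarrow> \<not> is_reticulation G v"
  by (auto simp: is_leaf_def is_root_def is_tree_node_def is_reticulation_def)

lemma tree_cycle_interior:
  assumes "tree_cycle G P Q" "b \<in> set P \<union> set Q" "b \<noteq> hd P" "b \<noteq> last P"
  shows "is_tree_node G b"
proof -
  have *: "b \<in> set (butlast (tl R))" if "b \<in> set R" "b \<noteq> hd R" "b \<noteq> last R" for R
  proof -
    from that have "b \<in> set (tl R)"
      by (cases R) auto
    moreover from this have "last R = last (tl R)"
      by (cases R) auto
    ultimately show ?thesis
      using that(3) by (metis append_butlast_last_id empty_iff list.set(1) rotate1.simps(2) set_ConsD set_rotate1)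
  qed
  show ?thesis
    using assms * [of P] * [of Q] by (auto simp: tree_cycle_def)
qed

lemma tree_cycle_hd_last:
  assumes "tree_cycle G P Q"
  shows "hd P = hd Q" "last P = last Q" "hd P \<in> set P" "last P \<in> set P" "last Q \<in> set Q" "hd Q \<in> set Q"
    "is_tree_node G (hd P) \<or> is_root G (hd P)" "is_reticulation G (last P)" "hd P \<noteq> last P"
proof -
  have "P \<noteq> []" "Q \<noteq> []"
    using assms by (auto simp: tree_cycle_def)
  then show "hd P \<in> set P" "last P \<in> set P" "last Q \<in> set Q" "hd Q \<in> set Q"
    by simp_all
  show "hd P = hd Q" "last P = last Q" "is_tree_node G (hd P) \<or> is_root G (hd P)" "is_reticulation G (last P)"
    using assms by (auto simp: tree_cycle_def)
  then show "hd P \<noteq> last P"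
    by (metis node_types_disjoint(5,6))
qed

context network
begin

lemma dpath_nth_trancl: "dpath G P \<Longrightarrow> i < j \<Longrightarrow> j < length P \<Longrightarrow> (P ! i, P ! j) \<in> (arcs G)\<^sup>+"
proof (induction j)
  case (Suc j)
  then have arc: "(P ! j, P ! Suc j) \<in> arcs G"
    by (auto simp: dpath_def)
  show ?case
  proof (cases "i = j")
    case True
    with arc show ?thesis by auto
  next
    case False
    with Suc have "(P ! i, P ! j) \<in> (arcs G)\<^sup>+"
      by auto
    with arc show ?thesis
      by auto
  qed
qed simp

lemma dpath_nth_inj: "dpath G P \<Longrightarrow> i < length P \<Longrightarrow> j < length P \<Longrightarrow> P ! i = P ! j \<Longrightarrow> i = j"
  using dpath_nth_trancl no_cycle by (metis linorder_neqE_nat)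

lemma hd_reaches: "dpath G P \<Longrightarrow> v \<in> set P \<Longrightarrow> v \<noteq> hd P \<Longrightarrow> (hd P, v) \<in> (arcs G)\<^sup>+"
proof -
  assume P: "dpath G P" "v \<in> set P" "v \<noteq> hd P"
  then obtain i where i: "i < length P" "P ! i = v"
    by (auto simp: in_set_conv_nth)
  moreover have "hd P = P ! 0"
    using P by (auto simp: dpath_def hd_conv_nth)
  moreover from calculation P have "0 < i"
    by (cases i) auto
  ultimately show ?thesis
    using dpath_nth_trancl [OF P(1), of 0 i] by simp
qed

lemma path_arc_target: "dpath G P \<Longrightarrow> (a, b) \<in> path_arcs P \<Longrightarrow> b \<noteq> hd P"
proof
  assume P: "dpath G P" "(a, b) \<in> path_arcs P" "b = hd P"
  then obtain i where "Suc i < length P" "P ! Suc i = b"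
    by (auto simp: path_arcs_iff)
  moreover have "hd P = P ! 0"
    using P by (auto simp: dpath_def hd_conv_nth)
  ultimately have "Suc i = 0"
    using P dpath_nth_inj [OF P(1), of "Suc i" 0] by (metis less_Suc_eq_0_disj less_trans)
  then show False by simp
qed

lemma path_arc_source: "dpath G P \<Longrightarrow> (a, b) \<in> path_arcs P \<Longrightarrow> a \<noteq> last P"
proof
  assume P: "dpath G P" "(a, b) \<in> path_arcs P" "a = last P"
  then obtain i where "Suc i < length P" "P ! i = a"
    by (auto simp: path_arcs_iff)
  moreover have "last P = P ! (length P - 1)"
    using P by (auto simp: dpath_def last_conv_nth)
  ultimately have "i = length P - 1"
    using P dpath_nth_inj [OF P(1), of i "length P - 1"] by auto
  then show False
    using \<open>Suc i < length P\<close> by simp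
qed

lemma path_arcs_functional: "dpath G P \<Longrightarrow> (v, a) \<in> path_arcs P \<Longrightarrow> (v, b) \<in> path_arcs P \<Longrightarrow> a = b"
  unfolding path_arcs_iff by (metis Suc_lessD dpath_nth_inj)

lemma tree_cycle_dpath: "tree_cycle G P Q \<Longrightarrow> dpath G P \<and> dpath G Q"
  by (simp add: tree_cycle_def)

lemma tree_cycle_in_arc_aux:
  assumes tc: "tree_cycle G P Q" and b: "b \<in> set P" "b \<noteq> hd P" and arc: "(v, b) \<in> arcs G"
  shows "(v, b) \<in> path_arcs P \<union> path_arcs Q"
proof -
  note hl = tree_cycle_hd_last [OF tc]
  have sub: "path_arcs P \<subseteq> arcs G" "path_arcs Q \<subseteq> arcs G" "path_arcs P \<inter> path_arcs Q = {}"
    using tc by (auto simp: tree_cycle_def dpath_path_arcs)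
  obtain p where p: "(p, b) \<in> path_arcs P"
    using pred_in_path [OF b] by blast
  show ?thesis
  proof (cases "b = last P")
    case True
    then obtain q where q: "(q, b) \<in> path_arcs Q"
      using pred_in_path [of b Q] b hl by auto
    with p sub have "p \<noteq> q"
      by auto
    moreover have "card (preds G b) = 2"
      using hl(8) True by (simp add: is_reticulation_def indeg_preds)
    moreover have "{p, q, v} \<subseteq> preds G b"
      using p q sub arc by auto
    ultimately have "v = p \<or> v = q"
      using card_mono [OF finite_preds, of "{p, q, v}" b] by (auto simp: card_insert_if split: if_splits)
    with p q show ?thesis
      by auto
  next
    case False
    then have "is_tree_node G b"
      using tree_cycle_interior [OF tc] b by auto
    then show ?thesis
      using indeg1_unique [of b v p] arc p sub by auto
  qed
qed

lemma tree_cycle_in_arc: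
  assumes tc: "tree_cycle G P Q" and b: "b \<in> set P \<union> set Q" "b \<noteq> hd P" and arc: "(v, b) \<in> arcs G"
  shows "(v, b) \<in> path_arcs P \<union> path_arcs Q"
  using tree_cycle_in_arc_aux [OF tc _ _ arc] tree_cycle_in_arc_aux [OF tree_cycle_sym [OF tc] _ _ arc]
    b tree_cycle_hd_last(1) [OF tc] by auto

lemma tree_cycle_disjoint_interior:
  assumes tc: "tree_cycle G P Q" and v: "v \<in> set P" "v \<in> set Q" "v \<noteq> hd P"
  shows "v = last P"
proof (rule ccontr)
  assume "v \<noteq> last P"
  then have "is_tree_node G v"
    using tree_cycle_interior [OF tc] v by auto
  moreover obtain p where p: "(p, v) \<in> path_arcs P"
    using pred_in_path v by blast
  moreover obtain q where q: "(q, v) \<in> path_arcs Q"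
    using pred_in_path [of v Q] v tree_cycle_hd_last(1) [OF tc] by auto
  moreover have sub: "path_arcs P \<subseteq> arcs G" "path_arcs Q \<subseteq> arcs G" "path_arcs P \<inter> path_arcs Q = {}"
    using tc by (auto simp: tree_cycle_def dpath_path_arcs)
  ultimately have "p = q"
    using indeg1_unique [of v p q] by auto
  with p q sub show False
    by auto
qed

lemma tree_cycle_out_arc:
  assumes tc: "tree_cycle G P Q" and v: "v \<noteq> hd P"
    and a: "(v, a) \<in> path_arcs P \<union> path_arcs Q" and b: "(v, b) \<in> path_arcs P \<union> path_arcs Q"
  shows "a = b"
proof -
  have dp: "dpath G P" "dpath G Q"
    using tree_cycle_dpath [OF tc] by auto
  have False if "(v, c) \<in> path_arcs P" "(v, d) \<in> path_arcs Q" for c d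
  proof -
    have "v \<in> set P" "v \<in> set Q"
      using that path_arcs_set by blast+
    then have "v = last P"
      using tree_cycle_disjoint_interior [OF tc] v by blast
    then show False
      using path_arc_source [OF dp(1) that(1)] by simp
  qed
  then show ?thesis
    using a b path_arcs_functional [OF dp(1)] path_arcs_functional [OF dp(2)] by blast
qed

end

text \<open>The top of a gall does not count as lying in it.\<close>
definition in_gall :: "net \<Rightarrow> nat \<Rightarrow> nat \<Rightarrow> bool" where
  "in_gall G v z \<longleftrightarrow> (\<exists>P Q. tree_cycle G P Q \<and> last P = z \<and> v \<in> set P \<union> set Q \<and> v \<noteq> hd P)"

locale sgt_net = network +
  assumes simplex: "is_simplex_galled_tree G"
begin

lemma ret_child_leaf: "is_reticulation G v \<Longrightarrow> (v, x) \<in> arcs G \<Longrightarrow> is_leaf G x"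
  using simplex by (auto simp: is_simplex_galled_tree_def)

lemma same_gall:
  assumes "tree_cycle G P Q" "tree_cycle G P' Q'" "v \<in> set P \<union> set Q" "v \<in> set P' \<union> set Q'"
  shows "hd P' = hd P" "last P' = last P" "path_arcs P' \<union> path_arcs Q' = path_arcs P \<union> path_arcs Q"
    "set P' \<union> set Q' = set P \<union> set Q"
proof -
  have "{P, Q} = {P', Q'}"
    using assms simplex unfolding is_simplex_galled_tree_def is_galled_tree_def by blast
  then have "P' = P \<and> Q' = Q \<or> P' = Q \<and> Q' = P"
    by (auto simp: doubleton_eq_iff)
  then show "hd P' = hd P" "last P' = last P" "path_arcs P' \<union> path_arcs Q' = path_arcs P \<union> path_arcs Q"
    "set P' \<union> set Q' = set P \<union> set Q"
    using tree_cycle_hd_last(1,2) [OF assms(1)] by auto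
qed

lemma ret_in_gall:
  assumes "is_reticulation G z"
  obtains P Q where "tree_cycle G P Q" "last P = z"
proof -
  obtain P Q where PQ: "tree_cycle G P Q" "z \<in> set P \<union> set Q"
    using assms simplex by (auto simp: is_simplex_galled_tree_def is_galled_tree_def)
  have "z \<noteq> hd P"
    using assms tree_cycle_hd_last(7) [OF PQ(1)] node_types_disjoint by metis
  then have "z = last P"
    using tree_cycle_interior [OF PQ(1,2)] assms node_types_disjoint by metis
  with PQ that show ?thesis
    by blast
qed

lemma in_gall_unique: "in_gall G v z \<Longrightarrow> in_gall G v z' \<Longrightarrow> z = z'"
  using same_gall(2) unfolding in_gall_def by blast

lemma in_gall_type: "in_gall G v z \<Longrightarrow> is_tree_node G v \<or> is_reticulation G v"
  using tree_cycle_interior tree_cycle_hd_last(8) unfolding in_gall_def by blast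

lemma in_gall_ret: "in_gall G v z \<Longrightarrow> is_reticulation G z"
  using tree_cycle_hd_last(8) unfolding in_gall_def by blast

lemma ret_in_gall_self: "is_reticulation G z \<Longrightarrow> in_gall G z z"
proof -
  assume "is_reticulation G z"
  then obtain P Q where PQ: "tree_cycle G P Q" "last P = z"
    by (rule ret_in_gall)
  then show ?thesis
    using tree_cycle_hd_last [OF PQ(1)] unfolding in_gall_def by (metis UnI1)
qed

lemma parent_in_gall:
  assumes "in_gall G c z" "(v, c) \<in> arcs G" "\<not> in_gall G v z"
  obtains P Q where "tree_cycle G P Q" "last P = z" "v = hd P"
proof -
  obtain P Q where PQ: "tree_cycle G P Q" "last P = z" "c \<in> set P \<union> set Q" "c \<noteq> hd P"
    using assms(1) by (auto simp: in_gall_def)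
  then have "(v, c) \<in> path_arcs P \<union> path_arcs Q"
    using tree_cycle_in_arc assms(2) by blast
  then have "v \<in> set P \<union> set Q"
    using path_arcs_set by blast
  then have "v = hd P"
    using PQ assms(3) unfolding in_gall_def by blast
  with PQ that show ?thesis
    by blast
qed

lemma gall_top_children:
  assumes "tree_cycle G P Q" "(hd P, c) \<in> arcs G"
  shows "in_gall G c (last P)"
proof -
  note hl = tree_cycle_hd_last [OF assms(1)]
  have dp: "dpath G P" "dpath G Q"
    using tree_cycle_dpath [OF assms(1)] by auto
  have sub: "path_arcs P \<subseteq> arcs G" "path_arcs Q \<subseteq> arcs G" "path_arcs P \<inter> path_arcs Q = {}"
    using assms(1) by (auto simp: tree_cycle_def dpath_path_arcs)
  obtain p where p: "(hd P, p) \<in> path_arcs P"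
    using succ_in_path [of "hd P" P] hl by auto
  obtain q where q: "(hd P, q) \<in> path_arcs Q"
    using succ_in_path [of "hd P" Q] hl by auto
  have "p \<noteq> q"
    using p q sub by auto
  obtain a b where "succs G (hd P) = {a, b}"
    using inner_succs hl(7) by blast
  then have "c = p \<or> c = q"
    using p q sub \<open>p \<noteq> q\<close> assms(2) by (metis empty_iff insert_iff mem_succs subsetD)
  then have "(hd P, c) \<in> path_arcs P \<or> (hd P, c) \<in> path_arcs Q"
    using p q by auto
  then have "c \<in> set P \<union> set Q" "c \<noteq> hd P"
    using path_arcs_set path_arc_target [OF dp(1)] path_arc_target [OF dp(2)] hl(1) by (blast, metis)
  then show ?thesis
    using assms(1) unfolding in_gall_def by blast
qed

lemma gall_side_children:
  assumes v: "in_gall G v z" and ab: "a \<noteq> b" "succs G v = {a, b}"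
  obtains "in_gall G a z" "\<And>z'. \<not> in_gall G b z'" | "in_gall G b z" "\<And>z'. \<not> in_gall G a z'"
proof -
  obtain P Q where PQ: "tree_cycle G P Q" "last P = z" "v \<in> set P \<union> set Q" "v \<noteq> hd P"
    using v by (auto simp: in_gall_def)
  note hl = tree_cycle_hd_last [OF PQ(1)]
  have dp: "dpath G P" "dpath G Q"
    using tree_cycle_dpath [OF PQ(1)] by auto
  have sub: "path_arcs P \<subseteq> arcs G" "path_arcs Q \<subseteq> arcs G"
    using PQ(1) by (auto simp: tree_cycle_def dpath_path_arcs)
  have arc: "(v, c) \<in> path_arcs P \<union> path_arcs Q" if "in_gall G c z'" "(v, c) \<in> arcs G" for c z'
  proof -
    obtain P' Q' where PQ': "tree_cycle G P' Q'" "c \<in> set P' \<union> set Q'" "c \<noteq> hd P'"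
      using \<open>in_gall G c z'\<close> unfolding in_gall_def by blast
    then have *: "(v, c) \<in> path_arcs P' \<union> path_arcs Q'"
      using tree_cycle_in_arc \<open>(v, c) \<in> arcs G\<close> by blast
    then have "v \<in> set P' \<union> set Q'"
      using path_arcs_set by blast
    then show ?thesis
      using * same_gall(3) [OF PQ(1) PQ'(1) PQ(3)] by simp
  qed
  have "v \<noteq> last P"
  proof
    assume "v = last P"
    then obtain x where "succs G v = {x}"
      using hl(8) ret_succs by blast
    with ab show False
      by auto
  qed
  then obtain c where c: "(v, c) \<in> path_arcs P \<union> path_arcs Q"
    using succ_in_path [of v P] succ_in_path [of v Q] PQ(3) hl(2) by auto
  then have c_in: "in_gall G c z"
    using path_arcs_set path_arc_target [OF dp(1)] path_arc_target [OF dp(2)] hl(1) PQ(1,2)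
    unfolding in_gall_def by fastforce
  have other: "\<not> in_gall G d z'" if "(v, d) \<in> arcs G" "d \<noteq> c" for d z'
    using arc [of d z'] that c tree_cycle_out_arc [OF PQ(1,4)] by blast
  have "(v, c) \<in> arcs G"
    using c sub by auto
  then have "c = a \<or> c = b"
    using ab by (metis empty_iff insert_iff mem_succs)
  moreover have "(v, a) \<in> arcs G" "(v, b) \<in> arcs G"
    using ab by (metis insert_iff mem_succs)+
  ultimately show ?thesis
    using that c_in other ab(1) by blast
qed

lemma two_succs_type:
  assumes "a \<noteq> b" "succs G v = {a, b}"
  shows "is_root G v \<or> is_tree_node G v"
proof -
  have "card (succs G v) = 2"
    using assms by simp
  moreover have "v \<in> verts G"
    using assms arcs_verts by (metis insertI1 mem_succs)
  ultimately show ?thesis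
    by (auto elim: vertex_cases simp: is_leaf_def is_reticulation_def outdeg_succs)
qed

lemma one_succ_type:
  assumes "succs G v = {x}"
  shows "is_reticulation G v"
proof -
  have "card (succs G v) = 1"
    using assms by simp
  moreover have "v \<in> verts G"
    using assms arcs_verts by (metis insertI1 mem_succs)
  ultimately show ?thesis
    by (auto elim: vertex_cases simp: is_leaf_def is_root_def is_tree_node_def outdeg_succs)
qed

lemma rep_ok:
  "rep G v t \<Longrightarrow> ok None (labs t) t \<and> (\<forall>z. \<not> in_gall G v z)
     \<or> (\<exists>z x. ok (Some x) (labs t) t \<and> in_gall G v z \<and> (z, x) \<in> arcs G)"
proof (induction t arbitrary: v)
  case (Lf x)
  then have "is_leaf G v"
    by (auto simp: leaves_def)
  then have "\<not> in_gall G v z" for z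
    using in_gall_type node_types_disjoint by metis
  then show ?case
    by (auto intro: ok.leaf)
next
  case (Rt x)
  then have "is_reticulation G v" "(v, x) \<in> arcs G"
    using one_succ_type [of v x] by (auto dest: equalityD2)
  then show ?case
    using ret_in_gall_self by (auto intro: ok.ret)
next
  case (Nd l r)
  then obtain a b where ab: "a \<noteq> b" "succs G v = {a, b}" and rep: "rep G a l" "rep G b r"
    by auto
  have arcs: "(v, a) \<in> arcs G" "(v, b) \<in> arcs G"
    using ab by (metis insert_iff mem_succs)+
  note IHl = Nd.IH(1) [OF rep(1)] and IHr = Nd.IH(2) [OF rep(2)]
  consider (side) z where "in_gall G v z" | (top) z c where "\<And>z. \<not> in_gall G v z" "c \<in> {a, b}" "in_gall G c z"
    | (out) "\<And>z. \<not> in_gall G v z" "\<And>z. \<not> in_gall G a z" "\<And>z. \<not> in_gall G b z"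
    by blast
  then show ?case
  proof cases
    case side
    from side ab show ?thesis
    proof (rule gall_side_children)
      assume a: "in_gall G a z" and b: "\<And>z'. \<not> in_gall G b z'"
      then obtain z' x where x: "ok (Some x) (labs l) l" "in_gall G a z'" "(z', x) \<in> arcs G"
        using IHl by blast
      then have "z' = z"
        using in_gall_unique a by blast
      have r: "ok None (labs r) r"
        using IHr b by blast
      have "ok (Some x) (labs (Nd l r)) (Nd l r)"
        using ok.side_left [OF x(1) r] ok_pend [OF r] by (simp add: closes_def)
      then show ?thesis
        using side x \<open>z' = z\<close> by blast
    next
      assume b: "in_gall G b z" and a: "\<And>z'. \<not> in_gall G a z'"
      then obtain z' x where x: "ok (Some x) (labs r) r" "in_gall G b z'" "(z', x) \<in> arcs G"
        using IHr by blast
      then have "z' = z"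
        using in_gall_unique b by blast
      have l: "ok None (labs l) l"
        using IHl a by blast
      have "ok (Some x) (labs (Nd l r)) (Nd l r)"
        using ok.side_right [OF l x(1)] ok_pend [OF l] by (simp add: closes_def)
      then show ?thesis
        using side x \<open>z' = z\<close> by blast
    qed
  next
    case top
    then have "(v, c) \<in> arcs G"
      using arcs by auto
    then obtain P Q where PQ: "tree_cycle G P Q" "last P = z" "v = hd P"
      using parent_in_gall [OF top(3)] top(1) by blast
    then have in_ab: "in_gall G a z" "in_gall G b z"
      using gall_top_children arcs by blast+
    obtain x where x: "ok (Some x) (labs l) l" "(z, x) \<in> arcs G"
      using IHl in_ab in_gall_unique by blast
    obtain x' where x': "ok (Some x') (labs r) r" "(z, x') \<in> arcs G"
      using IHr in_ab in_gall_unique by blast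
    obtain y where "succs G z = {y}"
      using in_gall_ret in_ab ret_succs by blast
    then have "x' = x"
      using x x' by (metis mem_succs singletonD)
    have "(l, r) \<noteq> (Rt x, Rt x)"
    proof
      assume "(l, r) = (Rt x, Rt x)"
      then have "succs G a = {x}" "succs G b = {x}" "x \<in> leaves G"
        using rep by auto
      then show False
        using indeg1_unique [of x a b] ab(1) unfolding leaves_def by (metis insertI1 mem_Collect_eq mem_succs)
    qed
    then have "ok None (labs (Nd l r)) (Nd l r)"
      using ok.gall [of x "labs l" l "labs r" r] x x' \<open>x' = x\<close> ok_pend [OF x(1)] ok_pend [OF x'(1)]
      by (simp add: closes_def)
    then show ?thesis
      using top(1) by blast
  next
    case out
    then have "ok None (labs l) l" "ok None (labs r) r"
      using IHl IHr by blast+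
    then have "ok None (labs (Nd l r)) (Nd l r)"
      using ok.tree ok_pend by (simp add: closes_def)
    then show ?thesis
      using out(1) by blast
  qed
qed

end

section \<open>The unfoldings of a simplex galled tree\<close>

lemma ex_doubleton_iff:
  "a \<noteq> b \<Longrightarrow> (\<exists>c d. c \<noteq> d \<and> {a, b} = {c, d} \<and> P c \<and> Q d) \<longleftrightarrow> P a \<and> Q b \<or> P b \<and> Q a"
  unfolding doubleton_eq_iff by metis

text \<open>
  The vertex at which the label \<open>y\<close> enters \<open>labs\<close>: the leaf \<open>y\<close> itself or, if its parent is a
  reticulation, the top of the gall. Unlike \<open>y\<close>, the anchor has a unique path from the root.
\<close>
definition anchor :: "net \<Rightarrow> nat \<Rightarrow> nat \<Rightarrow> bool" where
  "anchor G y u \<longleftrightarrow> u = y \<and> y \<in> leaves G \<and> (\<forall>z. (z, y) \<in> arcs G \<longrightarrow> \<not> is_reticulation G z)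
     \<or> (\<exists>P Q. tree_cycle G P Q \<and> (last P, y) \<in> arcs G \<and> u = hd P)"

definition core :: "net \<Rightarrow> nat \<Rightarrow> bool" where
  "core G v \<longleftrightarrow> (\<forall>z. (z, v) \<in> arcs G \<longrightarrow> \<not> is_reticulation G z)"

context sgt_net
begin

lemma core_nonleaf: "v \<in> verts G \<Longrightarrow> \<not> is_leaf G v \<Longrightarrow> core G v"
  using ret_child_leaf unfolding core_def by blast

lemma anchor_nonret_core: "anchor G y u \<Longrightarrow> \<not> is_reticulation G u \<and> core G u"
proof -
  assume "anchor G y u"
  then consider "u = y" "y \<in> leaves G" "\<forall>z. (z, y) \<in> arcs G \<longrightarrow> \<not> is_reticulation G z"
    | P Q where "tree_cycle G P Q" "u = hd P"
    unfolding anchor_def by blast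
  then show ?thesis
  proof cases
    case 1
    then show ?thesis
      using node_types_disjoint(3) unfolding core_def leaves_def by blast
  next
    case 2
    then have "is_tree_node G u \<or> is_root G u"
      using tree_cycle_hd_last(7) by blast
    then have "\<not> is_leaf G u" "\<not> is_reticulation G u" "u \<in> verts G"
      using node_types_disjoint [of G u] by (auto simp: is_tree_node_def is_root_def)
    then show ?thesis
      using core_nonleaf by blast
  qed
qed

lemma anchor_unique: "anchor G y u \<Longrightarrow> anchor G y u' \<Longrightarrow> u = u'"
proof -
  have gall: "u = u'" if tc: "tree_cycle G P Q" "tree_cycle G P' Q'"
    and y: "(last P, y) \<in> arcs G" "(last P', y) \<in> arcs G" and u: "u = hd P" "u' = hd P'" for P Q P' Q'
  proof -
    have "is_leaf G y"
      using ret_child_leaf tree_cycle_hd_last(8) [OF tc(1)] y(1) by blast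
    then have "last P = last P'"
      using indeg1_unique y by blast
    then have "hd P' = hd P"
      using same_gall(1) [OF tc, of "last P"] tree_cycle_hd_last(4) [OF tc(1)] tree_cycle_hd_last(4) [OF tc(2)] by auto
    with u show ?thesis
      by simp
  qed
  assume "anchor G y u" "anchor G y u'"
  then show ?thesis
    using gall tree_cycle_hd_last(8) unfolding anchor_def by metis
qed

lemma anchor_leaf: "anchor G y u \<Longrightarrow> y \<in> leaves G"
  using ret_child_leaf tree_cycle_hd_last(8) unfolding anchor_def leaves_def by blast

lemma anchor_exists:
  assumes "y \<in> leaves G"
  obtains u where "anchor G y u" "u \<in> verts G"
proof (cases "\<exists>z. (z, y) \<in> arcs G \<and> is_reticulation G z")
  case True
  then obtain z where z: "(z, y) \<in> arcs G" "is_reticulation G z"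
    by blast
  then obtain P Q where PQ: "tree_cycle G P Q" "last P = z"
    using ret_in_gall by blast
  then have "anchor G y (hd P)"
    using z unfolding anchor_def by blast
  moreover have "hd P \<in> verts G"
    using tree_cycle_hd_last(7) [OF PQ(1)] by (auto simp: is_tree_node_def is_root_def)
  ultimately show ?thesis
    by (rule that)
next
  case False
  then have "anchor G y y"
    using assms unfolding anchor_def by blast
  moreover have "y \<in> verts G"
    using assms by (simp add: leaves_def is_leaf_def)
  ultimately show ?thesis
    by (rule that)
qed

lemma siblings_disjoint:
  assumes "(v, a) \<in> arcs G" "(v, b) \<in> arcs G" "a \<noteq> b"
  shows "\<not> is_reticulation G u \<Longrightarrow> core G u \<Longrightarrow> (a, u) \<in> (arcs G)\<^sup>* \<Longrightarrow> (b, u) \<in> (arcs G)\<^sup>* \<Longrightarrow> False"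
proof (induction u rule: wf_induct_rule [OF wf_arcs])
  case (1 u)
  have no_back: False if "(v, d) \<in> arcs G" "(d, v) \<in> (arcs G)\<^sup>*" for d
    using that no_cycle [of v] by (meson rtrancl_into_trancl2)
  have step: "\<exists>w. (d, w) \<in> (arcs G)\<^sup>* \<and> (w, u) \<in> arcs G" if "d \<noteq> u" "(d, u) \<in> (arcs G)\<^sup>*" for d
    using that by (metis rtranclE)
  show ?case
  proof (cases "u = a \<or> u = b")
    case True
    then obtain d where d: "(v, d) \<in> arcs G" "d \<noteq> u" "(d, u) \<in> (arcs G)\<^sup>*" "(v, u) \<in> arcs G"
      using 1 assms by blast
    then obtain w where "(d, w) \<in> (arcs G)\<^sup>*" "(w, u) \<in> arcs G"
      using step by blast
    moreover from this have "w = v"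
      using nonret_unique_pred 1(2) d(4) by blast
    ultimately show False
      using no_back d(1) by blast
  next
    case False
    then obtain w w' where w: "(a, w) \<in> (arcs G)\<^sup>*" "(w, u) \<in> arcs G" "(b, w') \<in> (arcs G)\<^sup>*" "(w', u) \<in> arcs G"
      using step 1 by metis
    then have "w = w'"
      using nonret_unique_pred 1(2) by blast
    have "\<not> is_reticulation G w"
      using w(2) 1(3) unfolding core_def by blast
    moreover have "\<not> is_leaf G w"
      using w(2) leaf_succs by (metis empty_iff mem_succs)
    then have "core G w"
      using core_nonleaf arcs_verts w(2) by blast
    ultimately show False
      using 1(1) [OF w(2)] w \<open>w = w'\<close> by blast
  qed
qed

lemma child_core:
  assumes "a \<noteq> b" "succs G v = {a, b}" "(v, c) \<in> arcs G"
  shows "core G c"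
proof -
  have "\<not> is_reticulation G v"
    using two_succs_type [OF assms(1,2)] node_types_disjoint by blast
  moreover have "z = v" if "(z, c) \<in> arcs G" "is_reticulation G z" for z
    using ret_child_leaf [OF that(2,1)] indeg1_unique that(1) assms(3) by blast
  ultimately show ?thesis
    unfolding core_def by blast
qed

lemma closing_node:
  assumes "rep G v (Nd l r)" "closes l r" "pend l = Some y"
  shows "\<exists>P Q. tree_cycle G P Q \<and> (last P, y) \<in> arcs G \<and> v = hd P"
proof -
  obtain a b where ab: "a \<noteq> b" "succs G v = {a, b}" "rep G a l" "rep G b r"
    using assms(1) by auto
  then have arc: "(v, a) \<in> arcs G"
    by (metis insertI1 mem_succs)
  obtain z where z: "in_gall G a z" "(z, y) \<in> arcs G"
    using rep_ok [OF ab(3)] assms(3) ok_pend by fastforce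
  have "pend (Nd l r) = None"
    using assms(2,3) by (simp add: closes_def)
  then have "\<not> in_gall G v z"
    using rep_ok [OF assms(1)] ok_pend by fastforce
  then obtain P Q where "tree_cycle G P Q" "last P = z" "v = hd P"
    using parent_in_gall [OF z(1) arc] by blast
  with z show ?thesis
    by blast
qed

lemma labs_anchor:
  "rep G v t \<Longrightarrow> core G v \<Longrightarrow> y \<in> set (labs t) \<Longrightarrow> \<exists>u. anchor G y u \<and> (v, u) \<in> (arcs G)\<^sup>*"
proof (induction t arbitrary: v)
  case (Lf x)
  then have "anchor G y v"
    unfolding anchor_def core_def by auto
  then show ?case
    by blast
next
  case (Rt x)
  then show ?case
    by simp
next
  case (Nd l r)
  obtain a b where ab: "a \<noteq> b" "succs G v = {a, b}" "rep G a l" "rep G b r"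
    using Nd.prems(1) by auto
  then have arc: "(v, a) \<in> arcs G" "(v, b) \<in> arcs G"
    by (metis insert_iff mem_succs)+
  consider "closes l r" "pend l = Some y" | "y \<in> set (labs l)" | "y \<in> set (labs r)"
    using Nd.prems(3) by (auto simp: closes_def split: if_splits)
  then show ?case
  proof cases
    case 1
    then have "anchor G y v"
      using closing_node [OF Nd.prems(1)] unfolding anchor_def by blast
    then show ?thesis
      by blast
  next
    case 2
    then show ?thesis
      using Nd.IH(1) [OF ab(3) child_core [OF ab(1,2) arc(1)]] arc(1) by (meson converse_rtrancl_into_rtrancl)
  next
    case 3
    then show ?thesis
      using Nd.IH(2) [OF ab(4) child_core [OF ab(1,2) arc(2)]] arc(2) by (meson converse_rtrancl_into_rtrancl)
  qed
qed

lemma labs_distinct: "rep G v t \<Longrightarrow> core G v \<Longrightarrow> distinct (labs t)"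
proof (induction t arbitrary: v)
  case (Nd l r)
  obtain a b where ab: "a \<noteq> b" "succs G v = {a, b}" "rep G a l" "rep G b r"
    using Nd.prems(1) by auto
  then have arc: "(v, a) \<in> arcs G" "(v, b) \<in> arcs G"
    by (metis insert_iff mem_succs)+
  have core: "core G a" "core G b"
    using child_core [OF ab(1,2)] arc by blast+
  have "distinct (labs l)" "distinct (labs r)"
    using Nd.IH ab core by blast+
  moreover have "set (labs l) \<inter> set (labs r) = {}"
  proof (rule equals0I)
    fix y assume "y \<in> set (labs l) \<inter> set (labs r)"
    then obtain u u' where u: "anchor G y u" "(a, u) \<in> (arcs G)\<^sup>*" "anchor G y u'" "(b, u') \<in> (arcs G)\<^sup>*"
      using labs_anchor ab core by (metis IntD1 IntD2)
    then have "u' = u"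
      using anchor_unique by blast
    then show False
      using siblings_disjoint [OF arc ab(1)] anchor_nonret_core [OF u(1)] u by blast
  qed
  moreover have "y \<notin> set (labs l) \<union> set (labs r)" if "closes l r" "pend l = Some y" for y
  proof
    assume "y \<in> set (labs l) \<union> set (labs r)"
    then obtain d u where u: "(v, d) \<in> arcs G" "anchor G y u" "(d, u) \<in> (arcs G)\<^sup>*"
      using labs_anchor ab core arc by (metis UnE)
    moreover have "anchor G y v"
      using closing_node [OF Nd.prems(1) that] unfolding anchor_def by blast
    ultimately have "(v, v) \<in> (arcs G)\<^sup>+"
      using anchor_unique by (metis rtrancl_into_trancl2)
    then show False
      using no_cycle by blast
  qed
  ultimately show ?case
    by (auto simp: closes_def)
qed auto

lemma anchor_labs:
  "rep G v t \<Longrightarrow> core G v \<Longrightarrow> anchor G y u \<Longrightarrow> (v, u) \<in> (arcs G)\<^sup>* \<Longrightarrow> y \<in> set (labs t)"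
proof (induction t arbitrary: v)
  case (Lf x)
  then have leaf: "is_leaf G v" "v = x"
    by (auto simp: leaves_def)
  then have "succs G v = {}"
    using leaf_succs by blast
  then have "u = v"
    using Lf(4) by (metis converse_rtranclE empty_iff mem_succs)
  moreover have "v \<noteq> hd P" if "tree_cycle G P Q" for P Q
    using tree_cycle_hd_last(7) [OF that] leaf node_types_disjoint by metis
  ultimately have "v = y"
    using Lf(3) unfolding anchor_def by blast
  with leaf show ?case
    by simp
next
  case (Rt x)
  then have ret: "is_reticulation G v" "succs G v = {x}"
    using one_succ_type by auto
  then have arc: "(v, x) \<in> arcs G"
    by (metis insertI1 mem_succs)
  have "u \<noteq> v"
    using anchor_nonret_core Rt(3) ret by blast
  then obtain w where w: "(v, w) \<in> arcs G" "(w, u) \<in> (arcs G)\<^sup>*"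
    using Rt(4) by (metis converse_rtranclE)
  then have "w = x"
    using ret by (metis mem_succs singletonD)
  moreover have "succs G x = {}"
    using ret_child_leaf [OF ret(1) arc] leaf_succs by blast
  ultimately have "u = x"
    using w(2) by (metis converse_rtranclE empty_iff mem_succs)
  then show ?case
    using anchor_nonret_core [OF Rt(3)] ret arc unfolding core_def by blast
next
  case (Nd l r)
  obtain a b where ab: "a \<noteq> b" "succs G v = {a, b}" "rep G a l" "rep G b r"
    using Nd.prems(1) by auto
  then have arc: "(v, a) \<in> arcs G" "(v, b) \<in> arcs G"
    by (metis insert_iff mem_succs)+
  have core: "core G a" "core G b"
    using child_core [OF ab(1,2)] arc by blast+
  show ?case
  proof (cases "u = v")
    case True
    have "\<not> is_leaf G v"
      using two_succs_type [OF ab(1,2)] node_types_disjoint by blast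
    then have "v \<notin> leaves G"
      by (simp add: leaves_def)
    then obtain P Q where PQ: "tree_cycle G P Q" "(last P, y) \<in> arcs G" "v = hd P"
      using Nd.prems(3) True unfolding anchor_def by blast
    then have in_ab: "in_gall G a (last P)" "in_gall G b (last P)"
      using gall_top_children arc by blast+
    obtain x where x: "succs G (last P) = {x}"
      using tree_cycle_hd_last(8) [OF PQ(1)] ret_succs by blast
    have y: "y' = y" if "(last P, y') \<in> arcs G" for y'
      using that PQ(2) x by (metis mem_succs singletonD)
    have "pend l = Some y"
      using rep_ok [OF ab(3)] in_ab(1) in_gall_unique y ok_pend by metis
    moreover have "pend r = Some y"
      using rep_ok [OF ab(4)] in_ab(2) in_gall_unique y ok_pend by metis
    ultimately show ?thesis
      by (simp add: closes_def)
  next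
    case False
    then obtain w where w: "(v, w) \<in> arcs G" "(w, u) \<in> (arcs G)\<^sup>*"
      using Nd.prems(4) by (metis converse_rtranclE)
    then have "w = a \<or> w = b"
      using ab(2) by (metis empty_iff insert_iff mem_succs)
    then show ?thesis
      using Nd.IH(1) [OF ab(3) core(1) Nd.prems(3)] Nd.IH(2) [OF ab(4) core(2) Nd.prems(3)] w by auto
  qed
qed

lemma root_rep_ok:
  assumes "rep G (Defs.root G) t"
  shows "ok None (labs t) t" "distinct (labs t)" "set (labs t) = leaves G"
proof -
  have "\<not> in_gall G (Defs.root G) z" for z
    using in_gall_type root_is_root node_types_disjoint by metis
  then show "ok None (labs t) t"
    using rep_ok [OF assms] by blast
  have core: "core G (Defs.root G)"
    using root_no_preds root_is_root unfolding core_def by blast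
  show "distinct (labs t)"
    by (rule labs_distinct [OF assms core])
  show "set (labs t) = leaves G"
  proof (intro equalityI subsetI)
    fix y assume "y \<in> set (labs t)"
    then show "y \<in> leaves G"
      using labs_anchor [OF assms core] anchor_leaf by blast
  next
    fix y assume "y \<in> leaves G"
    then obtain u where "anchor G y u" "u \<in> verts G"
      by (rule anchor_exists)
    then show "y \<in> set (labs t)"
      using anchor_labs [OF assms core] root_reaches by blast
  qed
qed

lemma ret_parents_in_gall:
  assumes "tree_cycle G P Q" "(v, last P) \<in> arcs G"
  shows "v \<in> set P \<union> set Q"
proof -
  have "(v, last P) \<in> path_arcs P \<union> path_arcs Q"
    using tree_cycle_hd_last(4,9) [OF assms(1)] by (intro tree_cycle_in_arc [OF assms(1) _ _ assms(2)]) auto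
  then show ?thesis
    using path_arcs_set by blast
qed

lemma rep_inj: "rep G a t \<Longrightarrow> rep G b t \<Longrightarrow> a = b"
proof (induction t arbitrary: a b)
  case (Rt x)
  then have "(a, x) \<in> arcs G" "(b, x) \<in> arcs G" "is_leaf G x"
    by (auto simp: leaves_def dest: equalityD2)
  then show ?case
    using indeg1_unique by blast
next
  case (Nd l r)
  obtain c d where cd: "c \<noteq> d" "succs G a = {c, d}" "rep G c l" "rep G d r"
    using Nd.prems(1) by auto
  obtain c' d' where cd': "succs G b = {c', d'}" "rep G c' l" "rep G d' r"
    using Nd.prems(2) by auto
  have "c' = c" "d' = d"
    using Nd.IH cd cd' by blast+
  then have arcs: "(a, c) \<in> arcs G" "(b, c) \<in> arcs G" "(a, d) \<in> arcs G" "(b, d) \<in> arcs G"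
    using cd(2) cd'(1) by (metis insert_iff mem_succs)+
  show ?case
  proof (rule ccontr)
    assume "a \<noteq> b"
    then have "is_reticulation G c" "is_reticulation G d"
      using nonret_unique_pred arcs by blast+
    then obtain P Q P' Q' where tc: "tree_cycle G P Q" "last P = c" "tree_cycle G P' Q'" "last P' = d"
      using ret_in_gall by metis
    then have "a \<in> set P \<union> set Q" "a \<in> set P' \<union> set Q'"
      using ret_parents_in_gall arcs by blast+
    then have "c = d"
      using same_gall(2) [OF tc(1,3)] tc by auto
    with cd show False
      by simp
  qed
qed simp

lemma rep_weights:
  "v \<in> verts G \<Longrightarrow> finite {t. rep G v t} \<and> (\<Sum>t\<in>{t. rep G v t}. wt t) = 1"
proof (induction v rule: wf_induct_rule [OF wf_converse])
  case (1 v)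
  have leaf: "is_leaf G x \<longleftrightarrow> x \<in> leaves G" for x
    by (simp add: leaves_def)
  from 1(2) show ?case
  proof (cases rule: vertex_cases)
    case 2
    then have "{t. rep G v t} = {Lf v}"
      using leaf_succs [OF 2] leaf by (intro set_eqI, rename_tac t, case_tac t) auto
    then show ?thesis
      by simp
  next
    case 4
    then obtain x where x: "succs G v = {x}"
      by (rule ret_succs)
    then have "x \<in> leaves G"
      using ret_child_leaf [OF 4, of x] leaf by (metis insertI1 mem_succs)
    moreover have "v \<notin> leaves G"
      using 4 leaf node_types_disjoint by metis
    ultimately have "{t. rep G v t} = {Rt x}"
      using x by (intro set_eqI, rename_tac t, case_tac t) (auto simp: doubleton_eq_iff)
    then show ?thesis
      by simp
  next
    have inner: ?thesis if inner: "is_root G v \<or> is_tree_node G v"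
    proof -
      obtain a b where ab: "a \<noteq> b" "succs G v = {a, b}"
        using inner_succs inner by blast
      then have arc: "(v, a) \<in> arcs G" "(v, b) \<in> arcs G"
        by (metis insert_iff mem_succs)+
      let ?A = "{t. rep G a t}" and ?B = "{t. rep G b t}"
      have A: "finite ?A" "sum wt ?A = 1" and B: "finite ?B" "sum wt ?B = 1"
        using 1(1) [of a] 1(1) [of b] arc arcs_verts by auto
      have "?A \<inter> ?B = {}"
        using rep_inj ab(1) by auto
      have "v \<notin> leaves G"
        using inner leaf node_types_disjoint by metis
      then have "rep G v t \<longleftrightarrow> (\<exists>l r. t = Nd l r \<and> (rep G a l \<and> rep G b r \<or> rep G b l \<and> rep G a r))" for t
        using ab by (cases t) (simp_all add: ex_doubleton_iff, auto)
      then have split: "{t. rep G v t} = nd ` (?A \<times> ?B) \<union> nd ` (?B \<times> ?A)"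
        by (intro set_eqI) (simp add: image_iff, blast)
      have "(?A \<times> ?B) \<inter> (?B \<times> ?A) = {}"
        using \<open>?A \<inter> ?B = {}\<close> by blast
      then have disj: "nd ` (?A \<times> ?B) \<inter> nd ` (?B \<times> ?A) = {}"
        by (simp only: inj_on_image_Int [OF inj_nd subset_UNIV subset_UNIV, symmetric] image_empty)
      have prod: "sum wt (nd ` (X \<times> Y)) = sum wt X * sum wt Y / 2" for X Y
        by (subst sum.reindex [OF inj_nd])
           (simp add: sum_product sum_divide_distrib sum.cartesian_product case_prod_unfold)
      have "sum wt {t. rep G v t} = sum wt (nd ` (?A \<times> ?B)) + sum wt (nd ` (?B \<times> ?A))"
        unfolding split by (intro sum.union_disjoint disj finite_imageI finite_cartesian_product A B)
      then have "sum wt {t. rep G v t} = 1"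
        unfolding prod A(2) B(2) by simp
      moreover have "finite {t. rep G v t}"
        unfolding split using A B by (intro finite_UnI finite_imageI finite_cartesian_product)
      ultimately show ?thesis
        by blast
    qed
    {
      case 1
      then show ?thesis using inner by blast
    next
      case 3
      then show ?thesis using inner by blast
    }
  qed
qed

lemma root_paths: "rep G (Defs.root G) t \<Longrightarrow> x \<in> leaves G \<Longrightarrow> root_path_lengths G x = plen t x"
  using plens_eq_plen [OF leaves_succs, of x "Defs.root G" t] unfolding plens_def root_path_lengths_def by simp

end

section \<open>The network of an unfolding\<close>

context network
begin

lemma backward_in_cycle:
  assumes tc: "tree_cycle G P Q" and R: "dpath G R" "last R = last P"
    and avoid: "\<And>i. 0 < i \<Longrightarrow> i < length R \<Longrightarrow> R ! i \<noteq> hd P"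
  shows "set R \<subseteq> set P \<union> set Q" "path_arcs R \<subseteq> path_arcs P \<union> path_arcs Q"
proof -
  have ne: "R \<noteq> []"
    using R(1) by (simp add: dpath_def)
  have arc: "(R ! i, R ! Suc i) \<in> path_arcs P \<union> path_arcs Q"
    if "Suc i < length R" "R ! Suc i \<in> set P \<union> set Q" for i
  proof -
    have "(R ! i, R ! Suc i) \<in> arcs G"
      using R(1) that(1) by (simp add: dpath_def)
    then show ?thesis
      using tree_cycle_in_arc [OF tc that(2)] avoid that(1) by blast
  qed
  have mem: "R ! (length R - 1 - k) \<in> set P \<union> set Q" if "k < length R" for k
    using that
  proof (induction k)
    case 0
    then show ?case
      using R(2) ne tree_cycle_hd_last(4) [OF tc] by (simp add: last_conv_nth)
  next
    case (Suc k)
    define i where "i = length R - 1 - Suc k"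
    have i: "Suc i = length R - 1 - k" "Suc i < length R"
      using Suc.prems by (auto simp: i_def)
    then have "(R ! i, R ! Suc i) \<in> path_arcs P \<union> path_arcs Q"
      using arc [of i] Suc by simp
    then show ?case
      unfolding i_def [symmetric] using path_arcs_set by blast
  qed
  have mem': "R ! i \<in> set P \<union> set Q" if "i < length R" for i
    using mem [of "length R - 1 - i"] that by simp
  then show "set R \<subseteq> set P \<union> set Q"
    by (metis in_set_conv_nth subsetI)
  show "path_arcs R \<subseteq> path_arcs P \<union> path_arcs Q"
  proof (rule subrelI)
    fix a b assume "(a, b) \<in> path_arcs R"
    then obtain i where "Suc i < length R" "R ! i = a" "R ! Suc i = b"
      by (auto simp: path_arcs_iff)
    then show "(a, b) \<in> path_arcs P \<union> path_arcs Q"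
      using arc [of i] mem' [of "Suc i"] by simp
  qed
qed

lemma nth_not_hd: "dpath G R \<Longrightarrow> 0 < i \<Longrightarrow> i < length R \<Longrightarrow> R ! i \<noteq> hd R"
  using dpath_nth_inj [of R i 0] by (metis hd_conv_nth length_greater_0_conv less_trans list.size(3) not_less_zero neq0_conv)

lemma forward_unique:
  assumes tc: "tree_cycle G P Q" and R: "dpath G R" "last R = last P" "hd R = hd P" "length R \<ge> 2"
    and sub: "path_arcs R \<subseteq> path_arcs P \<union> path_arcs Q" and first: "(hd R, R ! 1) \<in> path_arcs P"
  shows "R = P"
proof -
  have dp: "dpath G P"
    using tree_cycle_dpath [OF tc] by blast
  have ne: "P \<noteq> []" "R \<noteq> []"
    using dp R(1) by (auto simp: dpath_def)
  have prefix: "i < length P \<and> R ! i = P ! i" if "i < length R" for i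
    using that
  proof (induction i)
    case 0
    then show ?case
      using ne R(3) by (simp add: hd_conv_nth)
  next
    case (Suc i)
    then have i: "i < length P" "R ! i = P ! i"
      by auto
    have arc: "(R ! i, R ! Suc i) \<in> path_arcs R"
      using Suc.prems by (auto simp: path_arcs_iff)
    have "R ! i \<noteq> last R"
      using path_arc_source [OF R(1) arc] .
    then have "i \<noteq> length P - 1"
      using i R(2) ne by (auto simp: last_conv_nth)
    then have Suc_i: "Suc i < length P"
      using i by linarith
    then have arcP: "(P ! i, P ! Suc i) \<in> path_arcs P"
      by (auto simp: path_arcs_iff)
    show ?case
    proof (cases "i = 0")
      case True
      then have "(P ! i, R ! Suc i) \<in> path_arcs P"
        using first R(3) ne by (simp add: hd_conv_nth)
      then show ?thesis
        using path_arcs_functional [OF dp] arcP Suc_i by blast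
    next
      case False
      then have "P ! i \<noteq> hd P"
        using nth_not_hd [OF dp] i by blast
      then show ?thesis
        using tree_cycle_out_arc [OF tc, of "P ! i"] arc sub arcP i Suc_i by auto
    qed
  qed
  have "length R = length P"
  proof -
    have "P ! (length R - 1) = last P"
      using prefix [of "length R - 1"] ne R(2) by (simp add: last_conv_nth)
    then have "length R - 1 = length P - 1"
      using dpath_nth_inj [OF dp, of "length R - 1" "length P - 1"] prefix [of "length R - 1"] ne
      by (simp add: last_conv_nth)
    then show ?thesis
      using ne by (cases R; cases P) auto
  qed
  then show ?thesis
    using prefix by (intro nth_equalityI) auto
qed

lemma tree_cycle_top_unique:
  assumes tc: "tree_cycle G P Q" "tree_cycle G P' Q'" and last: "last P = last P'" and ne: "hd P \<noteq> hd P'"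
  shows "(hd P, hd P') \<in> (arcs G)\<^sup>+"
proof -
  note hl = tree_cycle_hd_last [OF tc(1)] and hl' = tree_cycle_hd_last [OF tc(2)]
  have "hd P \<notin> set P' \<or> hd P \<notin> set Q'"
    using tree_cycle_disjoint_interior [OF tc(2), of "hd P"] ne hl last by auto
  then obtain R where R: "R = P' \<or> R = Q'" "hd P \<notin> set R"
    by blast
  then have "dpath G R" "last R = last P" "hd R = hd P'" "hd R \<in> set R"
    using tree_cycle_dpath [OF tc(2)] hl' last by auto
  then have "hd P' \<in> set P \<union> set Q"
    using backward_in_cycle(1) [OF tc(1), of R] R(2) nth_mem by fastforce
  then show ?thesis
    using hd_reaches [of P "hd P'"] hd_reaches [of Q "hd P'"] tree_cycle_dpath [OF tc(1)] ne hl(1) by auto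
qed

lemma tree_cycle_unique:
  assumes tc: "tree_cycle G P Q" "tree_cycle G P' Q'" and last: "last P = last P'"
  shows "{P, Q} = {P', Q'}"
proof -
  note hl = tree_cycle_hd_last [OF tc(1)] and hl' = tree_cycle_hd_last [OF tc(2)]
  have hd: "hd P' = hd P"
    using tree_cycle_top_unique [OF tc last] tree_cycle_top_unique [OF tc(2,1)] last no_cycle
    by (metis trancl_trans)
  have R: "R = P \<or> R = Q" if R: "dpath G R" "length R \<ge> 2" "last R = last P" "hd R = hd P" for R
  proof -
    have "R ! i \<noteq> hd P" if "0 < i" "i < length R" for i
      using nth_not_hd [OF R(1)] that R(4) by simp
    then have sub: "path_arcs R \<subseteq> path_arcs P \<union> path_arcs Q"
      using backward_in_cycle(2) [OF tc(1) R(1,3)] by blast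
    have "hd R = R ! 0"
      using R(1) by (simp add: hd_conv_nth dpath_def)
    then have "(hd R, R ! 1) \<in> path_arcs R"
      using R(2) by (auto simp: path_arcs_iff intro!: exI [of _ 0])
    then have "(hd R, R ! 1) \<in> path_arcs P \<or> (hd R, R ! 1) \<in> path_arcs Q"
      using sub by auto
    then show ?thesis
    proof
      assume "(hd R, R ! 1) \<in> path_arcs P"
      then show ?thesis
        using forward_unique [OF tc(1) R(1,3,4,2) sub] by blast
    next
      assume "(hd R, R ! 1) \<in> path_arcs Q"
      moreover have "last R = last Q" "hd R = hd Q" "path_arcs R \<subseteq> path_arcs Q \<union> path_arcs P"
        using R hl sub by auto
      ultimately show ?thesis
        using forward_unique [OF tree_cycle_sym [OF tc(1)] R(1) _ _ R(2)] by blast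
    qed
  qed
  have ne: "P' \<noteq> Q'"
  proof
    assume "P' = Q'"
    moreover have "(P' ! 0, P' ! 1) \<in> path_arcs P'"
      using tc(2) by (auto simp: path_arcs_iff tree_cycle_def intro!: exI [of _ 0])
    ultimately show False
      using tc(2) by (auto simp: tree_cycle_def)
  qed
  have "P' = P \<or> P' = Q" "Q' = P \<or> Q' = Q"
    using R [of P'] R [of Q'] tc(2) hd last hl' by (auto simp: tree_cycle_def)
  with ne show ?thesis
    by auto
qed

end

instance utree :: countable
  by countable_datatype

fun kids :: "utree \<Rightarrow> utree set" where
  "kids (Lf x) = {}"
| "kids (Rt x) = {Lf x}"
| "kids (Nd l r) = {l, r}"

fun subs :: "utree \<Rightarrow> utree set" where
  "subs (Lf x) = {Lf x}"
| "subs (Rt x) = {Rt x, Lf x}"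
| "subs (Nd l r) = insert (Nd l r) (subs l \<union> subs r)"

fun labels :: "utree \<Rightarrow> nat set" where
  "labels (Lf x) = {x}"
| "labels (Rt x) = {x}"
| "labels (Nd l r) = labels l \<union> labels r"

lemma self_in_subs [simp]: "t \<in> subs t"
  by (cases t) auto

lemma finite_subs: "finite (subs t)"
  by (induction t) auto

lemma labels_nonempty: "labels t \<noteq> {}"
  by (induction t) auto

lemma subs_kids: "s \<in> subs t \<Longrightarrow> kids s \<subseteq> subs t"
  by (induction t) auto

lemma subs_labels: "s \<in> subs t \<Longrightarrow> labels s \<subseteq> labels t"
  by (induction t) auto

fun ht :: "utree \<Rightarrow> nat" where
  "ht (Lf x) = 0"
| "ht (Rt x) = 1"
| "ht (Nd l r) = 1 + ht l + ht r"

lemma subs_ht: "s \<in> subs t \<Longrightarrow> s = t \<or> ht s < ht t"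
  by (induction t) auto

lemma kids_ht: "s \<in> kids t \<Longrightarrow> ht s < ht t"
  by (cases t) auto

lemma subs_subs: "s \<in> subs t \<Longrightarrow> subs s \<subseteq> subs t"
  by (induction t) auto

lemma Nd_notin_subs: "Nd l r \<notin> subs l" "Nd l r \<notin> subs r"
  using subs_ht [of "Nd l r" l] subs_ht [of "Nd l r" r] by auto

definition good :: "utree \<Rightarrow> bool" where
  "good t \<longleftrightarrow> ok (pend t) (labs t) t \<and> distinct (labs t) \<and> set_option (pend t) \<inter> set (labs t) = {}"

lemma ok_labels: "ok q xs t \<Longrightarrow> labels t = set xs \<union> set_option q"
  by (induction rule: ok.induct) auto

lemma good_Lf [simp]: "good (Lf x)" and good_Rt [simp]: "good (Rt x)"
  by (auto simp: good_def intro: ok.intros)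

lemma ok_good: "ok q xs t \<Longrightarrow> distinct xs \<Longrightarrow> set_option q \<inter> set xs = {} \<Longrightarrow> good t"
  using ok_pend ok_labs unfolding good_def by metis

lemma good_Nd:
  assumes "good (Nd l r)"
  shows "good l \<and> good r \<and> (\<not> closes l r \<and> labels l \<inter> labels r = {}
    \<or> (\<exists>x. pend l = Some x \<and> pend r = Some x \<and> labels l \<inter> labels r = {x} \<and> (l, r) \<noteq> (Rt x, Rt x)))"
proof -
  define q xs where "q = pend (Nd l r)" and "xs = labs (Nd l r)"
  have "ok q xs (Nd l r)" and d: "distinct xs" "set_option q \<inter> set xs = {}"
    using assms by (auto simp: good_def q_def xs_def simp del: pend.simps labs.simps)
  then show ?thesis
  proof (cases rule: ok_NdE [consumes 1])
    case (1 ys zs)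
    then have "good l" "good r"
      using d by (auto intro: ok_good)
    moreover have "\<not> closes l r"
      using 1 ok_pend by (auto simp: closes_def)
    ultimately show ?thesis
      using 1 d by (auto simp: ok_labels)
  next
    case (2 x ys zs)
    then have "good l" "good r"
      using d by (auto intro!: ok_good)
    moreover have "pend l = Some x" "pend r = Some x"
      using 2 ok_pend by auto
    moreover have "labels l \<inter> labels r = {x}"
      using 2 d by (auto simp: ok_labels)
    ultimately show ?thesis
      using 2 by blast
  next
    case (3 ys x zs)
    then have "good l" "good r"
      using d by (auto intro!: ok_good)
    moreover have "\<not> closes l r"
      using 3 ok_pend by (auto simp: closes_def)
    ultimately show ?thesis
      using 3 d by (auto simp: ok_labels)
  next
    case (4 x ys zs)
    then have "good l" "good r"
      using d by (auto intro!: ok_good)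
    moreover have "\<not> closes l r"
      using 4 ok_pend by (auto simp: closes_def)
    ultimately show ?thesis
      using 4 d by (auto simp: ok_labels)
  qed
qed

lemma good_subs: "good t \<Longrightarrow> s \<in> subs t \<Longrightarrow> good s"
  by (induction t) (auto dest: good_Nd)

lemma good_pending_single:
  assumes "good t" "pend t = Some x" "labels t = {x}"
  shows "t = Rt x"
proof -
  have ok: "ok (Some x) (labs t) t" "x \<notin> set (labs t)"
    using assms by (auto simp: good_def)
  then have "labs t = []"
    using ok_labels [OF ok(1)] assms(3) by (cases "labs t") auto
  then show ?thesis
    using ok_Some_Nil ok by blast
qed

lemma good_Nd_labels: "good (Nd l r) \<Longrightarrow> \<not> labels (Nd l r) \<subseteq> {x}"
proof
  assume good: "good (Nd l r)" and sub: "labels (Nd l r) \<subseteq> {x}"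
  then have "labels l = {x}" "labels r = {x}"
    using labels_nonempty [of l] labels_nonempty [of r] by auto
  then show False
    using good_Nd [OF good] good_pending_single by auto
qed

lemma good_neq: "good (Nd l r) \<Longrightarrow> l \<noteq> r"
proof
  assume good: "good (Nd l r)" and "l = r"
  then obtain x where "labels l = {x}"
    using good_Nd [OF good] labels_nonempty [of l] by auto
  with \<open>l = r\<close> show False
    using good_Nd_labels [OF good, of x] by simp
qed

lemma common_subs:
  assumes "good (Nd l r)" "s \<in> subs l" "s \<in> subs r"
  obtains x where "pend l = Some x" "pend r = Some x" "s = Rt x \<or> s = Lf x"
proof -
  have "labels s \<subseteq> labels l \<inter> labels r" "labels s \<noteq> {}"
    using assms(2,3) subs_labels labels_nonempty by blast+
  then obtain x where x: "pend l = Some x" "pend r = Some x" "labels s = {x}"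
    using good_Nd [OF assms(1)] by (metis subset_empty subset_singletonD)
  have "good s"
    using good_Nd [OF assms(1)] good_subs assms(2) by blast
  then have "s = Rt x \<or> s = Lf x"
  proof (cases s)
    case (Nd a b)
    then show ?thesis
      using good_Nd_labels [of a b x] \<open>good s\<close> x(3) by (metis subset_refl)
  qed (use x(3) in simp_all)
  with x that show ?thesis
    by blast
qed

lemma pend_in_subs: "good t \<Longrightarrow> pend t = Some x \<Longrightarrow> Rt x \<in> subs t \<and> Lf x \<in> subs t"
  by (induction t) (auto dest!: good_Nd split: option.splits if_splits)

definition par :: "utree \<Rightarrow> utree \<Rightarrow> utree set" where
  "par t s = {p \<in> subs t. s \<in> kids p}"

lemma par_Nd: "par (Nd l r) s = par l s \<union> par r s \<union> (if s = l \<or> s = r then {Nd l r} else {})"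
  by (auto simp: par_def)

lemma finite_par: "finite (par t s)"
  using finite_subs [of t] by (simp add: par_def)

lemma par_empty: "s \<notin> subs t \<Longrightarrow> par t s = {}"
  using subs_kids by (auto simp: par_def)

lemma par_self: "par t t = {}"
  using subs_ht kids_ht by (fastforce simp: par_def)

lemma card_par:
  "good t \<Longrightarrow> s \<in> subs t \<Longrightarrow> s \<noteq> t \<Longrightarrow>
    card (par t s) = (case s of Rt x \<Rightarrow> if pend t = Some x then 1 else 2 | _ \<Rightarrow> 1)"
proof (induction t)
  case (Rt x)
  then have "par (Rt x) s = {Rt x}"
    by (auto simp: par_def)
  with Rt show ?case
    by auto
next
  case (Nd l r)
  note good = Nd.prems(1)
  have gl: "good l" and gr: "good r"
    using good_Nd [OF good] by auto
  consider (left) "s \<in> subs l" "s \<notin> subs r" | (right) "s \<in> subs r" "s \<notin> subs l" | (both) "s \<in> subs l" "s \<in> subs r"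
    using Nd.prems by auto
  then show ?case
  proof cases
    case left
    then have "s \<noteq> r"
      by auto
    have pend_r: "pend r \<noteq> Some y" if "s = Rt y" for y
      using pend_in_subs [OF gr, of y] left that by auto
    have closes: "pend r = None" if "pend l = Some y" "s = Rt y" for y
      using good_Nd [OF good] pend_r that by (auto simp: closes_def)
    show ?thesis
    proof (cases "s = l")
      case True
      then have "par (Nd l r) s = {Nd l r}"
        using par_empty left par_self by (simp add: par_Nd)
      with True closes show ?thesis
        by (auto split: utree.split)
    next
      case False
      then have "par (Nd l r) s = par l s"
        using par_empty left \<open>s \<noteq> r\<close> by (simp add: par_Nd)
      with Nd.IH(1) [OF gl left(1) False] closes pend_r show ?thesis
        by (auto split: utree.splits option.splits if_splits)
    qed
  next
    case right
    then have "s \<noteq> l"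
      by auto
    have pend_l: "pend l \<noteq> Some y" if "s = Rt y" for y
      using pend_in_subs [OF gl, of y] right that by auto
    have closes: "pend l = None" if "pend r = Some y" "s = Rt y" for y
      using good_Nd [OF good] pend_l that by (auto simp: closes_def)
    show ?thesis
    proof (cases "s = r")
      case True
      then have "par (Nd l r) s = {Nd l r}"
        using par_empty right par_self by (simp add: par_Nd)
      with True closes show ?thesis
        by (auto split: utree.split)
    next
      case False
      then have "par (Nd l r) s = par r s"
        using par_empty right \<open>s \<noteq> l\<close> by (simp add: par_Nd)
      with Nd.IH(2) [OF gr right(1) False] closes pend_l show ?thesis
        by (auto split: utree.splits option.splits if_splits)
    qed
  next
    case both
    obtain x where x: "pend l = Some x" "pend r = Some x" "s = Rt x \<or> s = Lf x"
      using common_subs [OF good both] by blast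
    have pl: "Rt x \<in> subs l" "Rt x \<in> subs r"
      using pend_in_subs gl gr x by auto
    from x(3) show ?thesis
    proof
      assume s: "s = Lf x"
      then have "s \<noteq> l" "s \<noteq> r"
        using x by auto
      have "Rt x \<in> par l s" "Rt x \<in> par r s"
        using pl s by (auto simp: par_def)
      moreover have "card (par l s) = 1" "card (par r s) = 1"
        using Nd.IH(1) [OF gl both(1) \<open>s \<noteq> l\<close>] Nd.IH(2) [OF gr both(2) \<open>s \<noteq> r\<close>] s by auto
      ultimately have "par l s = {Rt x}" "par r s = {Rt x}"
        by (auto simp: card_1_singleton_iff)
      then have "par (Nd l r) s = {Rt x}"
        using \<open>s \<noteq> l\<close> \<open>s \<noteq> r\<close> by (simp add: par_Nd)
      with s show ?thesis
        by simp
    next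
      assume s: "s = Rt x"
      have cl: "card (par l s) = 1" if "s \<noteq> l"
        using Nd.IH(1) [OF gl both(1) that] s x by simp
      have cr: "card (par r s) = 1" if "s \<noteq> r"
        using Nd.IH(2) [OF gr both(2) that] s x by simp
      have "\<not> (s = l \<and> s = r)"
        using good_neq [OF good] by auto
      then consider "s = l" "s \<noteq> r" | "s \<noteq> l" "s = r" | "s \<noteq> l" "s \<noteq> r"
        by blast
      then have "card (par (Nd l r) s) = 2"
      proof cases
        case 1
        then have "par (Nd l r) s = insert (Nd l r) (par r s)"
          using par_self [of l] by (simp add: par_Nd)
        moreover have "Nd l r \<notin> par r s"
          using Nd_notin_subs by (auto simp: par_def)
        ultimately show ?thesis
          using cr [OF 1(2)] finite_par [of r s] by simp
      next
        case 2
        then have "par (Nd l r) s = insert (Nd l r) (par l s)"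
          using par_self [of r] by (simp add: par_Nd)
        moreover have "Nd l r \<notin> par l s"
          using Nd_notin_subs by (auto simp: par_def)
        ultimately show ?thesis
          using cl [OF 2(1)] finite_par [of l s] by simp
      next
        case 3
        then have "par (Nd l r) s = par l s \<union> par r s"
          by (simp add: par_Nd)
        moreover have "par l s \<inter> par r s = {}"
        proof (rule equals0I)
          fix p assume "p \<in> par l s \<inter> par r s"
          then have p: "p \<in> subs l" "p \<in> subs r" "Rt x \<in> kids p"
            using s by (auto simp: par_def)
          then obtain z where "p = Rt z \<or> p = Lf z"
            using common_subs [OF good p(1,2)] by blast
          with p(3) show False
            by auto
        qed
        ultimately show ?thesis
          using cl [OF 3(1)] cr [OF 3(2)] finite_par [of l s] finite_par [of r s] by (simp add: card_Un_disjoint)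
      qed
      then show ?thesis
        using s x by simp
    qed
  qed
qed auto

fun spine :: "utree \<Rightarrow> utree list" where
  "spine (Nd l r) = Nd l r # spine (if pend l = None then r else l)"
| "spine t = [t]"

lemma spine_nonempty [simp]: "spine t \<noteq> []"
  by (cases t) auto

lemma hd_spine [simp]: "hd (spine t) = t"
  by (cases t) auto

lemma spine_props:
  "pend t = Some x \<Longrightarrow> last (spine t) = Rt x \<and> set (spine t) \<subseteq> subs t \<and> (\<forall>u\<in>set (spine t). pend u = Some x)
     \<and> (\<forall>u\<in>set (butlast (spine t)). \<exists>l r. u = Nd l r) \<and> successively (\<lambda>a b. b \<in> kids a) (spine t)"
proof (induction t)
  case (Nd l r)
  define s where "s = (if pend l = None then r else l)"
  have s: "pend s = Some x" "s \<in> {l, r}"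
    using Nd.prems by (auto simp: s_def split: option.splits if_splits)
  then have IH: "last (spine s) = Rt x \<and> set (spine s) \<subseteq> subs s \<and> (\<forall>u\<in>set (spine s). pend u = Some x)
     \<and> (\<forall>u\<in>set (butlast (spine s)). \<exists>l r. u = Nd l r) \<and> successively (\<lambda>a b. b \<in> kids a) (spine s)"
    using Nd.IH by blast
  have sp: "spine (Nd l r) = Nd l r # spine s"
    by (simp add: s_def)
  have "subs s \<subseteq> subs (Nd l r)"
    using s by auto
  then show ?case
    using IH s Nd.prems unfolding sp by (auto simp: successively_Cons)
qed auto

lemma closing_subterm:
  "Rt x \<in> subs t \<Longrightarrow> good t \<Longrightarrow> pend t = Some x \<or> (\<exists>l r. Nd l r \<in> subs t \<and> pend l = Some x \<and> pend r = Some x)"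
proof (induction t)
  case (Nd l r)
  have g: "good l" "good r"
    using good_Nd [OF Nd.prems(2)] by auto
  show ?case
  proof (cases "\<exists>l' r'. (Nd l' r' \<in> subs l \<or> Nd l' r' \<in> subs r) \<and> pend l' = Some x \<and> pend r' = Some x")
    case True
    then show ?thesis
      by auto
  next
    case False
    then have x: "pend l = Some x \<or> pend r = Some x"
      using Nd g by auto
    consider "\<not> closes l r" | y where "pend l = Some y" "pend r = Some y"
      using good_Nd [OF Nd.prems(2)] by blast
    then show ?thesis
    proof cases
      case 1
      then show ?thesis
        using x by (auto simp: closes_def)
    next
      case 2
      then have "pend l = Some x" "pend r = Some x"
        using x by auto
      then show ?thesis
        by (intro disjI2 exI [of _ l] exI [of _ r]) simp
    qed
  qed
qed auto

text \<open>
  In a tree with distinct labels only the terms \<open>Rt x\<close> and \<open>Lf x\<close> occur more than once, so the subterms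
  themselves can serve as the vertices of the network.
\<close>
definition enc :: "nat \<Rightarrow> utree \<Rightarrow> nat" where
  "enc n s = (case s of Lf x \<Rightarrow> x | _ \<Rightarrow> n + 1 + to_nat s)"

definition net_of :: "nat \<Rightarrow> utree \<Rightarrow> net" where
  "net_of n t = (enc n ` subs t, {(enc n s, enc n s') | s s'. s \<in> subs t \<and> s' \<in> kids s})"

lemma Lf_in_subs: "x \<in> labels t \<Longrightarrow> Lf x \<in> subs t"
  by (induction t) auto

locale canonical =
  fixes n :: nat and t :: utree
  assumes good: "good t" and closed: "pend t = None" and labels: "labels t = {1..n}" and n: "n \<ge> 2"
begin

abbreviation "e \<equiv> enc n"
abbreviation "N \<equiv> net_of n t"

lemma inj_e: "inj_on e (subs t)"
proof (rule inj_onI)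
  fix s s' assume s: "s \<in> subs t" "s' \<in> subs t" "e s = e s'"
  have le: "x \<le> n" if "Lf x \<in> subs t" for x
    using subs_labels [OF that] labels by auto
  have big: "e u = n + 1 + to_nat u" if "\<nexists>x. u = Lf x" for u
    using that by (cases u) (simp_all add: enc_def)
  have small: "e (Lf x) = x" for x
    by (simp add: enc_def)
  show "s = s'"
  proof (cases "\<exists>x. s = Lf x"; cases "\<exists>x. s' = Lf x")
    assume "\<exists>x. s = Lf x" "\<exists>x. s' = Lf x"
    then show ?thesis
      using s(3) small by auto
  next
    assume "\<exists>x. s = Lf x" "\<nexists>x. s' = Lf x"
    then obtain x where "s = Lf x" "e s' = n + 1 + to_nat s'"
      using big by blast
    then show ?thesis
      using s le [of x] small by simp
  next
    assume "\<nexists>x. s = Lf x" "\<exists>x. s' = Lf x"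
    then obtain x where "s' = Lf x" "e s = n + 1 + to_nat s"
      using big by blast
    then show ?thesis
      using s le [of x] small by simp
  next
    assume "\<nexists>x. s = Lf x" "\<nexists>x. s' = Lf x"
    then have "to_nat s = to_nat s'"
      using s(3) big by simp
    then show ?thesis
      by simp
  qed
qed

lemma e_eq_iff: "s \<in> subs t \<Longrightarrow> s' \<in> subs t \<Longrightarrow> e s = e s' \<longleftrightarrow> s = s'"
  using inj_e by (auto simp: inj_on_def)

lemma verts_N: "verts N = e ` subs t"
  by (simp add: net_of_def verts_def)

lemma arcs_N: "(a, b) \<in> arcs N \<longleftrightarrow> (\<exists>s s'. a = e s \<and> b = e s' \<and> s \<in> subs t \<and> s' \<in> kids s)"
  by (auto simp: net_of_def arcs_def)

lemma arc_iff: "s \<in> subs t \<Longrightarrow> s' \<in> subs t \<Longrightarrow> (e s, e s') \<in> arcs N \<longleftrightarrow> s' \<in> kids s"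
  unfolding arcs_N using subs_kids e_eq_iff by blast

lemma succs_N: "s \<in> subs t \<Longrightarrow> succs N (e s) = e ` kids s"
proof -
  assume s: "s \<in> subs t"
  have "(e s, b) \<in> arcs N \<longleftrightarrow> b \<in> e ` kids s" for b
    unfolding arcs_N using s e_eq_iff by blast
  then show ?thesis
    by auto
qed

lemma preds_N: "s \<in> subs t \<Longrightarrow> preds N (e s) = e ` par t s"
proof -
  assume s: "s \<in> subs t"
  have "(a, e s) \<in> arcs N \<longleftrightarrow> a \<in> e ` par t s" for a
    unfolding arcs_N par_def using s subs_kids e_eq_iff by blast
  then show ?thesis
    by auto
qed

lemma outdeg_N: "s \<in> subs t \<Longrightarrow> outdeg N (e s) = card (kids s)"
  using subs_kids inj_on_subset [OF inj_e] by (simp add: outdeg_succs succs_N card_image)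

lemma indeg_N: "s \<in> subs t \<Longrightarrow> indeg N (e s) = card (par t s)"
  using inj_on_subset [OF inj_e, of "par t s"] by (simp add: indeg_preds preds_N card_image par_def)

lemma t_Nd: obtains l r where "t = Nd l r"
proof (cases t)
  case (Lf x)
  then have "{1..n} = {x}"
    using labels by simp
  then have "card {1..n} = card {x}"
    by (rule arg_cong)
  with n show ?thesis
    by simp
qed (use closed that in auto)

lemma kids_Nd_card: "Nd l r \<in> subs t \<Longrightarrow> card (kids (Nd l r)) = 2"
  using good_neq good_subs [OF good] by fastforce

lemma root_N: "is_root N (e t)"
proof -
  obtain l r where t: "t = Nd l r"
    by (rule t_Nd)
  have "indeg N (e t) = 0" "outdeg N (e t) = 2"
    using indeg_N [of t] outdeg_N [of t] par_self kids_Nd_card [of l r] t by simp_all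
  then show ?thesis
    by (simp add: is_root_def verts_N)
qed

lemma leaf_N: "Lf x \<in> subs t \<Longrightarrow> is_leaf N (e (Lf x))"
proof -
  assume s: "Lf x \<in> subs t"
  have "Lf x \<noteq> t"
    using t_Nd by (metis utree.distinct(3))
  then have "indeg N (e (Lf x)) = 1"
    using card_par [OF good s] indeg_N [OF s] by simp
  then show ?thesis
    using outdeg_N [OF s] s by (simp add: is_leaf_def verts_N)
qed

lemma ret_N: "Rt x \<in> subs t \<Longrightarrow> is_reticulation N (e (Rt x))"
proof -
  assume s: "Rt x \<in> subs t"
  have "Rt x \<noteq> t"
    using closed by auto
  then have "indeg N (e (Rt x)) = 2"
    using card_par [OF good s] indeg_N [OF s] closed by simp
  then show ?thesis
    using outdeg_N [OF s] s by (simp add: is_reticulation_def verts_N)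
qed

lemma tree_N: "Nd l r \<in> subs t \<Longrightarrow> Nd l r \<noteq> t \<Longrightarrow> is_tree_node N (e (Nd l r))"
proof -
  assume s: "Nd l r \<in> subs t" "Nd l r \<noteq> t"
  then have "indeg N (e (Nd l r)) = 1"
    using card_par [OF good s] indeg_N by simp
  then show ?thesis
    using outdeg_N [OF s(1)] kids_Nd_card s by (simp add: is_tree_node_def verts_N)
qed

lemma network_N: "is_network N"
  unfolding is_network_def
proof (intro conjI ballI)
  show "finite (verts N)"
    by (simp add: verts_N finite_subs)
  show "arcs N \<subseteq> verts N \<times> verts N"
    using subs_kids unfolding verts_N by (intro subrelI) (auto simp: arcs_N intro!: imageI)
  have "ht (inv_into (subs t) e b) < ht (inv_into (subs t) e a)" if ab: "(a, b) \<in> arcs N" for a b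
  proof -
    obtain s s' where s: "a = e s" "b = e s'" "s \<in> subs t" "s' \<in> kids s"
      using ab unfolding arcs_N by blast
    then have "s' \<in> subs t"
      using subs_kids by blast
    with s show ?thesis
      using kids_ht inj_e by simp
  qed
  then show "acyclic (arcs N)"
    by (rule acyclicI_order [where f = "\<lambda>a. ht (inv_into (subs t) e a)"])
  have type: "is_root N (e s) \<or> is_leaf N (e s) \<or> is_tree_node N (e s) \<or> is_reticulation N (e s)" if "s \<in> subs t" for s
  proof (cases "s = t")
    case False
    then show ?thesis
      using that leaf_N ret_N tree_N by (cases s) simp_all
  qed (simp add: root_N)
  then show "is_root N v \<or> is_leaf N v \<or> is_tree_node N v \<or> is_reticulation N v" if "v \<in> verts N" for v
  proof -
    obtain s where "v = e s" "s \<in> subs t"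
      using \<open>v \<in> verts N\<close> unfolding verts_N by blast
    then show ?thesis
      using type by simp
  qed
  show "\<exists>!r. r \<in> verts N \<and> indeg N r = 0"
  proof (rule ex1I [of _ "e t"])
    show "e t \<in> verts N \<and> indeg N (e t) = 0"
      using root_N by (simp add: is_root_def)
  next
    fix v assume v: "v \<in> verts N \<and> indeg N v = 0"
    then obtain s where s: "v = e s" "s \<in> subs t"
      by (auto simp: verts_N)
    have "s = t"
    proof (rule ccontr)
      assume "s \<noteq> t"
      then show False
        using card_par [OF good s(2)] indeg_N [OF s(2)] v s(1) by (cases s) (simp_all split: if_splits)
    qed
    with s show "v = e t"
      by simp
  qed
qed

lemma leaves_N: "leaves N = {1..n}"
proof (intro equalityI subsetI)
  fix v assume v: "v \<in> leaves N"
  then obtain s where s: "v = e s" "s \<in> subs t"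
    by (auto simp: leaves_def is_leaf_def verts_N)
  have "card (kids s) = 0"
    using v outdeg_N [OF s(2)] s by (simp add: leaves_def is_leaf_def)
  then obtain x where "s = Lf x"
    by (cases s) (auto simp: card_insert_if split: if_splits)
  with s have "v = x" "x \<in> labels t"
    using subs_labels by (fastforce simp: enc_def)+
  then show "v \<in> {1..n}"
    using labels by simp
next
  fix x assume "x \<in> {1..n}"
  then have "Lf x \<in> subs t"
    using labels Lf_in_subs by simp
  then show "x \<in> leaves N"
    using leaf_N by (auto simp: leaves_def enc_def)
qed

lemma rep_N: "s \<in> subs t \<Longrightarrow> rep N (e s) s"
proof (induction s)
  case (Lf x)
  then show ?case
    using leaf_N [of x] by (simp add: enc_def leaves_def)
next
  case (Rt x)
  then have "Lf x \<in> subs t"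
    using subs_kids [OF Rt] by simp
  then show ?case
    using succs_N [OF Rt] leaf_N [of x] enc_def [of n "Lf x"] by (simp add: leaves_def)
next
  case (Nd l r)
  then have lr: "l \<in> subs t" "r \<in> subs t"
    using subs_kids [OF Nd.prems] by auto
  have "e l \<noteq> e r"
    using good_neq [OF good_subs [OF good Nd.prems]] e_eq_iff [OF lr] by simp
  moreover have "succs N (e (Nd l r)) = {e l, e r}"
    using succs_N [OF Nd.prems] by simp
  moreover have "rep N (e l) l" "rep N (e r) r"
    using Nd.IH lr by blast+
  ultimately show ?case
    unfolding rep.simps by blast
qed

end

context canonical
begin

interpretation network N
  by unfold_locales (rule network_N)

lemma root_N_eq: "Defs.root N = e t"
  using root_eq [OF root_N] by simp

lemma type_of_ret:
  assumes "is_reticulation N v"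
  obtains x where "v = e (Rt x)" "Rt x \<in> subs t"
proof -
  obtain s where s: "v = e s" "s \<in> subs t"
    using assms by (auto simp: is_reticulation_def verts_N)
  show ?thesis
  proof (cases s)
    case (Lf x)
    then show ?thesis
      using leaf_N [of x] s assms node_types_disjoint by metis
  next
    case (Rt x)
    then show ?thesis
      using s that by blast
  next
    case (Nd l r)
    then show ?thesis
      using tree_N [of l r] root_N s assms node_types_disjoint by metis
  qed
qed

lemma dpath_map:
  assumes "ts \<noteq> []" "set ts \<subseteq> subs t" "successively (\<lambda>a b. b \<in> kids a) ts"
  shows "dpath N (map e ts)"
  unfolding dpath_def
proof (intro conjI allI impI)
  fix i assume i: "Suc i < length (map e ts)"
  then have "ts ! Suc i \<in> kids (ts ! i)"
    using assms(3) by (simp add: successively_conv_nth)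
  moreover have "ts ! i \<in> subs t" "ts ! Suc i \<in> subs t"
    using i assms(2) by (auto intro!: subsetD [OF assms(2)] nth_mem)
  ultimately show "(map e ts ! i, map e ts ! Suc i) \<in> arcs N"
    using i arc_iff by simp
qed (use assms in simp)

lemma path_arcs_map:
  assumes "(a, b) \<in> path_arcs (map e ts)"
  obtains i where "Suc i < length ts" "a = e (ts ! i)" "b = e (ts ! Suc i)"
  using assms by (auto simp: path_arcs_iff)

lemma canonical_cycle:
  assumes lr: "Nd l r \<in> subs t" and x: "pend l = Some x" "pend r = Some x"
  shows "tree_cycle N (map e (Nd l r # spine l)) (map e (Nd l r # spine r))"
proof -
  have goodN: "good (Nd l r)"
    using good_subs [OF good lr] .
  have sub: "subs l \<subseteq> subs t" "subs r \<subseteq> subs t"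
    using subs_subs [OF lr] by auto
  have path: "dpath N (map e (Nd l r # spine s))" "set (Nd l r # spine s) \<subseteq> subs t"
    if s: "s = l \<or> s = r" for s
  proof -
    have "pend s = Some x" "subs s \<subseteq> subs t" "s \<in> kids (Nd l r)"
      using s x sub by auto
    then show "set (Nd l r # spine s) \<subseteq> subs t"
      using spine_props [of s x] lr by auto
    then show "dpath N (map e (Nd l r # spine s))"
      using spine_props [of s x] \<open>pend s = Some x\<close> \<open>s \<in> kids (Nd l r)\<close>
      by (intro dpath_map) (auto simp: successively_Cons)
  qed
  have interior: "is_tree_node N v" if s: "s = l \<or> s = r" and v: "v \<in> set (butlast (tl (map e (Nd l r # spine s))))" for s v
  proof -
    have ps: "pend s = Some x"
      using s x by auto
    have "v \<in> set (butlast (map e (spine s)))"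
      using v by simp
    then obtain u where u: "v = e u" "u \<in> set (butlast (spine s))"
      by (auto simp: map_butlast [symmetric])
    then obtain a b where ab: "u = Nd a b"
      using spine_props [OF ps] by blast
    have us: "u \<in> subs s"
      using u(2) spine_props [OF ps] in_set_butlastD by fastforce
    then have "u \<in> subs t"
      using s sub by blast
    moreover have "u \<noteq> t"
    proof
      assume "u = t"
      then have "ht t \<le> ht s"
        using subs_ht [OF us] by auto
      moreover have "ht s < ht (Nd l r)"
        using s by auto
      moreover have "ht (Nd l r) \<le> ht t"
        using subs_ht [OF lr] by auto
      ultimately show False
        by simp
    qed
    ultimately show ?thesis
      using tree_N ab u by blast
  qed
  have disj: "path_arcs (map e (Nd l r # spine l)) \<inter> path_arcs (map e (Nd l r # spine r)) = {}"
  proof (rule equals0I)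
    fix ab assume "ab \<in> path_arcs (map e (Nd l r # spine l)) \<inter> path_arcs (map e (Nd l r # spine r))"
    then obtain a b where "(a, b) \<in> path_arcs (map e (Nd l r # spine l))" "(a, b) \<in> path_arcs (map e (Nd l r # spine r))"
      by (cases ab) auto
    then obtain i j where i: "Suc i < length (Nd l r # spine l)" "a = e ((Nd l r # spine l) ! i)" "b = e ((Nd l r # spine l) ! Suc i)"
      and j: "Suc j < length (Nd l r # spine r)" "a = e ((Nd l r # spine r) ! j)" "b = e ((Nd l r # spine r) ! Suc j)"
      by (elim path_arcs_map)
    let ?u = "(Nd l r # spine l) ! i" and ?v = "(Nd l r # spine l) ! Suc i"
    have in_t: "(Nd l r # spine l) ! k \<in> subs t" if "k < length (Nd l r # spine l)" for k
      using path(2) [of l] nth_mem [OF that] by auto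
    have in_t': "(Nd l r # spine r) ! k \<in> subs t" if "k < length (Nd l r # spine r)" for k
      using path(2) [of r] nth_mem [OF that] by auto
    have eq: "?u = (Nd l r # spine r) ! j" "?v = (Nd l r # spine r) ! Suc j"
      using i j in_t in_t' e_eq_iff by (metis Suc_lessD)+
    have v: "?v \<in> subs l" "pend ?v = Some x" "?v \<in> subs r"
      using spine_props [OF x(1)] spine_props [OF x(2)] i(1) j(1) eq(2) nth_mem [of i "spine l"] nth_mem [of j "spine r"]
      by auto
    obtain y where "pend l = Some y" "?v = Rt y \<or> ?v = Lf y"
      using common_subs [OF goodN v(1,3)] by blast
    then have vx: "?v = Rt x"
      using v(2) x by auto
    have kid: "?v \<in> kids ?u"
    proof -
      have "(map e (Nd l r # spine l) ! i, map e (Nd l r # spine l) ! Suc i) \<in> arcs N"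
        using path(1) [of l] i(1) unfolding dpath_def by (simp only: length_map simp_thms)
      then have "(e ?u, e ?v) \<in> arcs N"
        using i(1) by (simp only: nth_map Suc_lessD)
      then show ?thesis
        using arc_iff in_t i(1) Suc_lessD by blast
    qed
    show False
    proof (cases "i = 0")
      case True
      then have "?u = Nd l r"
        by simp
      then have "j = 0"
        using eq(1) Nd_notin_subs spine_props [OF x(2)] j(1) nth_mem [of "j - 1" "spine r"]
        by (cases j) auto
      then have "l = r"
        using eq(2) True hd_conv_nth [of "spine l"] hd_conv_nth [of "spine r"] by simp
      then show False
        using good_neq [OF goodN] by simp
    next
      case False
      then have ul: "?u \<in> subs l"
        using spine_props [OF x(1)] i(1) nth_mem [of "i - 1" "spine l"] by (cases i) auto
      have "j \<noteq> 0"
      proof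
        assume "j = 0"
        then have "?u = Nd l r"
          using eq(1) by simp
        then show False
          using ul Nd_notin_subs(1) [of l r] by simp
      qed
      then have "?u \<in> subs r"
        using eq(1) spine_props [OF x(2)] j(1) nth_mem [of "j - 1" "spine r"] by (cases j) auto
      then obtain y where "?u = Rt y \<or> ?u = Lf y"
        using common_subs [OF goodN ul] by blast
      then show False
        using kid vx by auto
    qed
  qed
  define P Q where "P = map e (Nd l r # spine l)" and "Q = map e (Nd l r # spine r)"
  have "is_tree_node N (e (Nd l r)) \<or> is_root N (e (Nd l r))"
    using tree_N [OF lr] root_N by metis
  moreover have "is_reticulation N (e (Rt x))"
    using ret_N pend_in_subs [of l x] good_Nd [OF goodN] x sub by blast
  moreover have "2 \<le> length (map e (Nd l r # spine s))" for s
    using spine_nonempty [of s] by (cases "spine s") auto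
  then have "2 \<le> length P" "2 \<le> length Q"
    by (simp_all only: P_def Q_def)
  moreover have "last P = e (Rt x)" "last Q = e (Rt x)" "hd P = e (Nd l r)" "hd Q = e (Nd l r)"
    using spine_props [OF x(1)] spine_props [OF x(2)] by (simp_all add: last_map P_def Q_def)
  moreover have "dpath N P" "dpath N Q" "path_arcs P \<inter> path_arcs Q = {}"
    unfolding P_def Q_def using path(1) disj by blast+
  moreover have "\<forall>v\<in>set (butlast (tl P)). is_tree_node N v" "\<forall>v\<in>set (butlast (tl Q)). is_tree_node N v"
    unfolding P_def Q_def using interior by blast+
  ultimately have "tree_cycle N P Q"
    unfolding tree_cycle_def by (simp add: ball_Un)
  then show ?thesis
    unfolding P_def Q_def .
qed

fun gall_label :: "utree \<Rightarrow> nat option" where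
  "gall_label (Nd l r) = (if closes l r then pend l else pend (Nd l r))"
| "gall_label s = pend s"

lemma canonical_cycle_label:
  assumes x: "pend l = Some x" "pend r = Some x" and u: "u \<in> set (Nd l r # spine l) \<union> set (Nd l r # spine r)"
  shows "gall_label u = Some x"
proof -
  have pend: "gall_label s = Some y" if "pend s = Some y" for s y
    using that by (cases s) (auto simp: closes_def)
  have "gall_label (Nd l r) = Some x"
    using x by (simp add: closes_def)
  then show ?thesis
    using u pend spine_props [OF x(1)] spine_props [OF x(2)] by auto
qed

lemma every_cycle_canonical:
  assumes "tree_cycle N P Q"
  obtains l r x where "Nd l r \<in> subs t" "pend l = Some x" "pend r = Some x" "last P = e (Rt x)"
    "{P, Q} = {map e (Nd l r # spine l), map e (Nd l r # spine r)}"
proof -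
  obtain x where x: "last P = e (Rt x)" "Rt x \<in> subs t"
    using type_of_ret [OF tree_cycle_hd_last(8) [OF assms]] by blast
  then obtain l r where lr: "Nd l r \<in> subs t" "pend l = Some x" "pend r = Some x"
    using closing_subterm [OF x(2) good] closed by auto
  have "last (map e (Nd l r # spine l)) = e (Rt x)"
    using spine_props [OF lr(2)] by (simp add: last_map)
  then have "{P, Q} = {map e (Nd l r # spine l), map e (Nd l r # spine r)}"
    using tree_cycle_unique [OF assms canonical_cycle [OF lr]] x by simp
  with lr x that show ?thesis
    by blast
qed

lemma net_of_SGT: "N \<in> SGT n"
proof -
  have ex: "\<exists>P Q. tree_cycle N P Q \<and> v \<in> set P \<union> set Q" if "is_reticulation N v" for v
  proof -
    obtain x where x: "v = e (Rt x)" "Rt x \<in> subs t"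
      using type_of_ret \<open>is_reticulation N v\<close> by blast
    then obtain l r where lr: "Nd l r \<in> subs t" "pend l = Some x" "pend r = Some x"
      using closing_subterm [OF x(2) good] closed by auto
    have "Rt x \<in> set (spine l)"
      using spine_props [OF lr(2)] last_in_set [of "spine l"] by simp
    then have "v \<in> set (map e (Nd l r # spine l))"
      using x by simp
    then show ?thesis
      using canonical_cycle [OF lr] by blast
  qed
  have disj: "(set P \<union> set Q) \<inter> (set P' \<union> set Q') = {}"
    if tc: "tree_cycle N P Q" "tree_cycle N P' Q'" and ne: "{P, Q} \<noteq> {P', Q'}" for P Q P' Q'
  proof (rule equals0I)
    fix v assume v: "v \<in> (set P \<union> set Q) \<inter> (set P' \<union> set Q')"
    obtain l r x where lr: "Nd l r \<in> subs t" "pend l = Some x" "pend r = Some x" "last P = e (Rt x)"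
      "{P, Q} = {map e (Nd l r # spine l), map e (Nd l r # spine r)}"
      using every_cycle_canonical [OF tc(1)] by blast
    obtain l' r' x' where lr': "Nd l' r' \<in> subs t" "pend l' = Some x'" "pend r' = Some x'" "last P' = e (Rt x')"
      "{P', Q'} = {map e (Nd l' r' # spine l'), map e (Nd l' r' # spine r')}"
      using every_cycle_canonical [OF tc(2)] by blast
    have "set P \<union> set Q = e ` (set (Nd l r # spine l) \<union> set (Nd l r # spine r))"
      using lr(5) by (auto simp: doubleton_eq_iff)
    then obtain u where u: "v = e u" "u \<in> set (Nd l r # spine l) \<union> set (Nd l r # spine r)"
      using v by auto
    have "set P' \<union> set Q' = e ` (set (Nd l' r' # spine l') \<union> set (Nd l' r' # spine r'))"
      using lr'(5) by (auto simp: doubleton_eq_iff)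
    then obtain u' where u': "v = e u'" "u' \<in> set (Nd l' r' # spine l') \<union> set (Nd l' r' # spine r')"
      using v by auto
    have "u \<in> subs t"
      using u(2) lr(1) spine_props [OF lr(2)] spine_props [OF lr(3)] subs_subs [OF lr(1)] by auto
    moreover have "u' \<in> subs t"
      using u'(2) lr'(1) spine_props [OF lr'(2)] spine_props [OF lr'(3)] subs_subs [OF lr'(1)] by auto
    ultimately have "u = u'"
      using u u' e_eq_iff by blast
    then have "x = x'"
      using canonical_cycle_label [OF lr(2,3) u(2)] canonical_cycle_label [OF lr'(2,3) u'(2)] by simp
    then have "last P = last P'"
      using lr lr' by simp
    then show False
      using tree_cycle_unique [OF tc] ne by blast
  qed
  have simp: "is_leaf N w" if "is_reticulation N v" "(v, w) \<in> arcs N" for v w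
  proof -
    obtain x where x: "v = e (Rt x)" "Rt x \<in> subs t"
      using type_of_ret \<open>is_reticulation N v\<close> by blast
    then have "w = e (Lf x)"
      using succs_N [OF x(2)] that(2) x(1) by (metis image_empty image_insert kids.simps(2) mem_succs singletonD)
    moreover have "Lf x \<in> subs t"
      using subs_kids [OF x(2)] by simp
    ultimately show ?thesis
      using leaf_N by blast
  qed
  have "is_galled_tree N"
    unfolding is_galled_tree_def using network_N ex disj by blast
  then show ?thesis
    unfolding SGT_def is_simplex_galled_tree_def using simp leaves_N by blast
qed

end

lemma net_of_exists:
  assumes "ok None xs t" "distinct xs" "set xs = {1..n}" "n \<ge> 2"
  shows "\<exists>G. G \<in> SGT n \<and> rep G (Defs.root G) t"
proof -
  have "good t"
    using assms by (auto intro: ok_good)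
  moreover have "labels t = {1..n}"
    using ok_labels [OF assms(1)] assms(3) by simp
  ultimately interpret canonical n t
    using ok_pend [OF assms(1)] assms(4) by unfold_locales auto
  show ?thesis
    using net_of_SGT rep_N [OF self_in_subs] root_N_eq by metis
qed

section \<open>Isomorphism classes\<close>

definition reps :: "net \<Rightarrow> utree set" where "reps G = {t. rep G (Defs.root G) t}"

lemma SGT_sgt_net: "G \<in> SGT n \<Longrightarrow> sgt_net G"
  by unfold_locales (auto simp: SGT_def is_simplex_galled_tree_def is_galled_tree_def)

lemma SGT_leaves: "G \<in> SGT n \<Longrightarrow> leaves G = {1..n}"
  by (simp add: SGT_def)

lemma SGT_leaves_succs: "G \<in> SGT n \<Longrightarrow> x \<in> leaves G \<Longrightarrow> succs G x = {}"
  using SGT_sgt_net sgt_net_def network.leaves_succs by blast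

lemma SGT_rep_weights: "G \<in> SGT n \<Longrightarrow> v \<in> verts G \<Longrightarrow> finite {t. rep G v t} \<and> (\<Sum>t\<in>{t. rep G v t}. wt t) = 1"
  using SGT_sgt_net sgt_net.rep_weights by blast

lemma SGT_rep_exists: assumes "G \<in> SGT n" "v \<in> verts G" obtains t where "rep G v t"
  using SGT_rep_weights [OF assms] by (metis empty_Collect_eq sum.empty zero_neq_one)

lemma SGT_root: assumes "G \<in> SGT n" shows "Defs.root G \<in> verts G"
proof -
  interpret sgt_net G by (rule SGT_sgt_net [OF assms])
  show ?thesis
    using root_is_root by (simp add: is_root_def)
qed

lemma SGT_rep_meet:
  assumes "G \<in> SGT n" "H \<in> SGT m" "rep G a s" "rep H b s"
  shows "{t. rep G a t} = {t. rep H b t}"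
  using rep_meet [OF assms(3,4) SGT_leaves_succs SGT_leaves_succs, OF assms(1) _ assms(2)]
    rep_meet [OF assms(4,3) SGT_leaves_succs SGT_leaves_succs, OF assms(2) _ assms(1)] by blast

lemma iso_rep:
  assumes f: "bij_betw f (verts G) (verts H)"
    "\<forall>a \<in> verts G. \<forall>b \<in> verts G. (a, b) \<in> arcs G \<longleftrightarrow> (f a, f b) \<in> arcs H"
    "\<forall>x \<in> leaves G. f x = x" and GH: "G \<in> SGT n" "H \<in> SGT n"
  shows "v \<in> verts G \<Longrightarrow> rep G v t \<Longrightarrow> rep H (f v) t"
proof -
  interpret G: sgt_net G by (rule SGT_sgt_net [OF GH(1)])
  interpret H: sgt_net H by (rule SGT_sgt_net [OF GH(2)])
  have leaves: "leaves H = leaves G"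
    using GH SGT_leaves by auto
  have succs: "succs H (f v) = f ` succs G v" if "v \<in> verts G" for v
  proof (intro equalityI subsetI)
    fix w assume w: "w \<in> succs H (f v)"
    then have "w \<in> verts H"
      using H.arcs_verts by auto
    then obtain u where "w = f u" "u \<in> verts G"
      using f(1) by (auto simp: bij_betw_def)
    then show "w \<in> f ` succs G v"
      using w f(2) that by auto
  next
    fix w assume "w \<in> f ` succs G v"
    then obtain u where u: "w = f u" "(v, u) \<in> arcs G"
      by auto
    then have "u \<in> verts G"
      using G.arcs_verts by blast
    then show "w \<in> succs H (f v)"
      using f(2) that u by simp
  qed
  have inj: "inj_on f (verts G)"
    using f(1) by (simp add: bij_betw_def)
  show "v \<in> verts G \<Longrightarrow> rep G v t \<Longrightarrow> rep H (f v) t"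
  proof (induction t arbitrary: v)
    case (Lf x)
    then show ?case
      using f(3) leaves by simp
  next
    case (Rt x)
    then show ?case
      using succs f(3) leaves by simp
  next
    case (Nd l r)
    then obtain a b where ab: "a \<noteq> b" "succs G v = {a, b}" "rep G a l" "rep G b r"
      by auto
    then have "a \<in> verts G" "b \<in> verts G"
      using G.arcs_verts by (metis insert_iff mem_succs)+
    moreover from this have "f a \<noteq> f b"
      using inj ab(1) by (auto simp: inj_on_def)
    moreover have "succs H (f v) = {f a, f b}"
      using succs [OF Nd.prems(1)] ab(2) by simp
    ultimately show ?case
      using Nd.IH ab(3,4) unfolding rep.simps by blast
  qed
qed

lemma iso_reps:
  assumes "net_iso G H" and GH: "G \<in> SGT n" "H \<in> SGT n"
  shows "reps G = reps H"
proof -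
  interpret G: sgt_net G by (rule SGT_sgt_net [OF GH(1)])
  interpret H: sgt_net H by (rule SGT_sgt_net [OF GH(2)])
  obtain f where f: "bij_betw f (verts G) (verts H)"
    "\<forall>a \<in> verts G. \<forall>b \<in> verts G. (a, b) \<in> arcs G \<longleftrightarrow> (f a, f b) \<in> arcs H"
    "\<forall>x \<in> leaves G. f x = x"
    using assms(1) by (auto simp: net_iso_def)
  have root: "Defs.root G \<in> verts G"
    by (rule SGT_root [OF GH(1)])
  have "(w, f (Defs.root G)) \<notin> arcs H" for w
  proof
    assume w: "(w, f (Defs.root G)) \<in> arcs H"
    then obtain u where "w = f u" "u \<in> verts G"
      using f(1) H.arcs_verts by (metis bij_betw_imp_surj_on imageE)
    then have "(u, Defs.root G) \<in> arcs G"
      using w f(2) root by blast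
    then show False
      using G.root_no_preds G.root_is_root by blast
  qed
  then have "preds H (f (Defs.root G)) = {}"
    by auto
  then have "indeg H (f (Defs.root G)) = 0"
    by (simp add: indeg_preds)
  moreover have "f (Defs.root G) \<in> verts H"
    using f(1) root by (auto simp: bij_betw_def)
  ultimately have "f (Defs.root G) = Defs.root H"
    using H.indeg0_is_root H.root_eq by blast
  moreover obtain t where t: "rep G (Defs.root G) t"
    using SGT_rep_exists [OF GH(1) root] by blast
  ultimately have "rep H (Defs.root H) t"
    using iso_rep [OF f GH root t] by simp
  then show ?thesis
    unfolding reps_def using SGT_rep_meet [OF GH t] by blast
qed

lemma rep_child:
  assumes GH: "G \<in> SGT n" "H \<in> SGT n" and s: "rep G a s" "rep H b s" and arc: "(a, a') \<in> arcs G"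
  shows "\<exists>b' s'. (b, b') \<in> arcs H \<and> rep G a' s' \<and> rep H b' s'"
proof (cases s)
  case (Lf x)
  then have "succs G a = {}"
    using s SGT_leaves_succs [OF GH(1)] by auto
  then show ?thesis
    using arc by (metis empty_iff mem_succs)
next
  case (Rt x)
  then have "succs G a = {x}" "succs H b = {x}" "x \<in> leaves G" "x \<in> leaves H"
    using s by auto
  then have "a' = x" "(b, x) \<in> arcs H" "rep G x (Lf x)" "rep H x (Lf x)"
    using arc by (auto dest: equalityD2)
  then show ?thesis
    by blast
next
  case (Nd l r)
  obtain c d where cd: "succs G a = {c, d}" "rep G c l" "rep G d r"
    using s(1) Nd by auto
  obtain c' d' where cd': "succs H b = {c', d'}" "rep H c' l" "rep H d' r"
    using s(2) Nd by auto
  have "(b, c') \<in> arcs H" "(b, d') \<in> arcs H"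
    using cd'(1) by (metis insert_iff mem_succs)+
  moreover have "a' = c \<or> a' = d"
    using cd(1) arc by (metis insert_iff mem_succs singletonD)
  ultimately show ?thesis
    using cd cd' by blast
qed

lemma reps_correspondence:
  assumes GH: "G \<in> SGT n" "H \<in> SGT n" and t: "t \<in> reps G" "t \<in> reps H" and a: "a \<in> verts G"
  shows "\<exists>b\<in>verts H. {s. rep G a s} = {s. rep H b s}"
proof -
  interpret G: sgt_net G by (rule SGT_sgt_net [OF GH(1)])
  interpret H: sgt_net H by (rule SGT_sgt_net [OF GH(2)])
  have "(Defs.root G, a) \<in> (arcs G)\<^sup>*"
    by (rule G.root_reaches [OF a])
  then show ?thesis
  proof (induction rule: rtrancl_induct)
    case base
    have "{s. rep G (Defs.root G) s} = {s. rep H (Defs.root H) s}"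
      using t SGT_rep_meet [OF GH] by (auto simp: reps_def)
    then show ?case
      using SGT_root [OF GH(2)] by blast
  next
    case (step u v)
    then obtain b where b: "b \<in> verts H" "{s. rep G u s} = {s. rep H b s}"
      by blast
    obtain s where "rep G u s"
      using SGT_rep_exists [OF GH(1)] G.arcs_verts step(2) by metis
    then obtain b' s' where "(b, b') \<in> arcs H" "rep G v s'" "rep H b' s'"
      using rep_child [OF GH _ _ step(2)] b(2) by blast
    then show ?case
      using SGT_rep_meet [OF GH] H.arcs_verts by blast
  qed
qed

lemma reps_iso:
  assumes GH: "G \<in> SGT n" "H \<in> SGT n" and t: "t \<in> reps G" "t \<in> reps H"
  shows "net_iso G H"
proof -
  interpret G: sgt_net G by (rule SGT_sgt_net [OF GH(1)])
  interpret H: sgt_net H by (rule SGT_sgt_net [OF GH(2)])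
  define R where "R K v = {s. rep K v s}" for K v
  have ne: "R G a \<noteq> {}" if "a \<in> verts G" for a
    using SGT_rep_exists [OF GH(1) that] unfolding R_def by blast
  have neH: "R H b \<noteq> {}" if "b \<in> verts H" for b
    using SGT_rep_exists [OF GH(2) that] unfolding R_def by blast
  have injG: "a = a'" if "R G a = R G a'" "a \<in> verts G" for a a'
    using ne [OF that(2)] that(1) G.rep_inj unfolding R_def by blast
  have injH: "b = b'" if "R H b = R H b'" "b \<in> verts H" for b b'
    using neH [OF that(2)] that(1) H.rep_inj unfolding R_def by blast
  obtain f where f: "f a \<in> verts H" "R G a = R H (f a)" if "a \<in> verts G" for a
    using reps_correspondence [OF GH t] unfolding R_def by metis
  have surj: "\<exists>a\<in>verts G. f a = b" if b: "b \<in> verts H" for b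
  proof -
    obtain a where "a \<in> verts G" "R H b = R G a"
      using reps_correspondence [OF GH(2,1) t(2,1) b] unfolding R_def by blast
    then show ?thesis
      using f injH b by metis
  qed
  have "bij_betw f (verts G) (verts H)"
  proof (rule bij_betw_imageI)
    show "inj_on f (verts G)"
    proof (rule inj_onI)
      fix a a' assume "a \<in> verts G" "a' \<in> verts G" "f a = f a'"
      then show "a = a'"
        using f(2) [of a] f(2) [of a'] injG [of a a'] by simp
    qed
    show "f ` verts G = verts H"
      using f(1) surj by blast
  qed
  moreover have "(a, b) \<in> arcs G \<longleftrightarrow> (f a, f b) \<in> arcs H" if ab: "a \<in> verts G" "b \<in> verts G" for a b
  proof
    assume arc: "(a, b) \<in> arcs G"
    obtain s where "rep G a s" "rep H (f a) s"
      using ne [OF ab(1)] f(2) [OF ab(1)] unfolding R_def by blast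
    then obtain b' s' where b': "(f a, b') \<in> arcs H" "rep G b s'" "rep H b' s'"
      using rep_child [OF GH _ _ arc] by blast
    then have "R G b = R H b'"
      using SGT_rep_meet [OF GH] unfolding R_def by blast
    then have "b' = f b"
      using f(2) [OF ab(2)] injH H.arcs_verts b'(1) by metis
    with b' show "(f a, f b) \<in> arcs H"
      by simp
  next
    assume arc: "(f a, f b) \<in> arcs H"
    obtain s where "rep H (f a) s" "rep G a s"
      using ne [OF ab(1)] f(2) [OF ab(1)] unfolding R_def by blast
    then obtain b' s' where b': "(a, b') \<in> arcs G" "rep H (f b) s'" "rep G b' s'"
      using rep_child [OF GH(2,1) _ _ arc] by blast
    then have "R G b' = R H (f b)"
      using SGT_rep_meet [OF GH] unfolding R_def by blast
    then have "b' = b"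
      using f(2) [OF ab(2)] injG G.arcs_verts b'(1) by metis
    with b' show "(a, b) \<in> arcs G"
      by simp
  qed
  moreover have "f x = x" if "x \<in> leaves G" for x
  proof -
    have "x \<in> verts G"
      using that by (simp add: leaves_def is_leaf_def)
    moreover have "Lf x \<in> R G x"
      using that by (simp add: R_def)
    ultimately have "Lf x \<in> R H (f x)"
      using f(2) by blast
    then show ?thesis
      by (simp add: R_def)
  qed
  ultimately show ?thesis
    unfolding net_iso_def by blast
qed


definition trees :: "nat \<Rightarrow> utree set" where
  "trees n = (\<Union>xs\<in>permutations_of_set {1..n}. oks None xs)"

lemma sum_trees: "sum f (trees n) = (\<Sum>xs\<in>permutations_of_set {1..n}. sum f (oks None xs))"
  unfolding trees_def
proof (rule sum.UNION_disjoint)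
  show "\<forall>i\<in>permutations_of_set {1..n}. \<forall>j\<in>permutations_of_set {1..n}. i \<noteq> j \<longrightarrow> oks None i \<inter> oks None j = {}"
    using ok_unique by blast
qed (simp_all add: finite_oks)

lemma finite_trees: "finite (trees n)"
  by (simp add: trees_def finite_oks)

lemma sum_wt_trees: "(\<Sum>t\<in>trees n. wt t) = fact n * fps_nth aser n"
  and sum_depths_trees: "(\<Sum>t\<in>trees n. wt t * depths \<theta> t) = fact n * fps_nth (pser \<theta>) n"
proof -
  have len: "length xs = n" if "xs \<in> permutations_of_set {1..n}" for xs
    using distinct_card [of xs] permutations_of_setD [OF that] by simp
  show "(\<Sum>t\<in>trees n. wt t) = fact n * fps_nth aser n"
    unfolding sum_trees sum_wt_eq by (simp add: len)
  show "(\<Sum>t\<in>trees n. wt t * depths \<theta> t) = fact n * fps_nth (pser \<theta>) n"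
    unfolding sum_trees sum_depths_eq by (simp add: len)
qed

lemma wt_pos: "wt t > 0"
  by (induction t) auto

lemma reps_subset_trees:
  assumes "G \<in> SGT n"
  shows "reps G \<subseteq> trees n"
proof
  interpret sgt_net G by (rule SGT_sgt_net [OF assms])
  fix t assume "t \<in> reps G"
  then have "rep G (Defs.root G) t"
    by (simp add: reps_def)
  from root_rep_ok [OF this] show "t \<in> trees n"
    using SGT_leaves [OF assms] unfolding trees_def by blast
qed

lemma trees_reps:
  assumes "t \<in> trees n" "n \<ge> 2"
  shows "\<exists>G\<in>SGT n. t \<in> reps G"
proof -
  obtain xs where "ok None xs t" "set xs = {1..n}" "distinct xs"
    using assms(1) by (auto simp: trees_def dest: permutations_of_setD)
  then show ?thesis
    using net_of_exists [of xs t n] assms(2) by (auto simp: reps_def)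
qed

definition class_rep :: "net set \<Rightarrow> net" where "class_rep C = (SOME G. G \<in> C)"

lemma SGT_classes_eq: "SGT_classes n = (\<lambda>G. {H \<in> SGT n. reps H = reps G}) ` SGT n"
proof -
  have "net_iso G H \<longleftrightarrow> reps H = reps G" if GH: "G \<in> SGT n" "H \<in> SGT n" for G H
  proof
    assume "net_iso G H"
    then show "reps H = reps G"
      using iso_reps GH by blast
  next
    assume eq: "reps H = reps G"
    obtain t where "rep G (Defs.root G) t"
      using SGT_rep_exists [OF GH(1) SGT_root [OF GH(1)]] by blast
    then have "t \<in> reps G" "t \<in> reps H"
      using eq by (simp_all add: reps_def)
    then show "net_iso G H"
      using reps_iso GH by blast
  qed
  then have "{(G, H). G \<in> SGT n \<and> H \<in> SGT n \<and> net_iso G H} `` {G} = {H \<in> SGT n. reps H = reps G}" if "G \<in> SGT n" for G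
    unfolding Image_singleton mem_Collect_eq case_prod_conv using that by blast
  then show ?thesis
    unfolding SGT_classes_def quotient_def by auto
qed

lemma class_rep:
  assumes "C \<in> SGT_classes n"
  shows "class_rep C \<in> SGT n" "C = {H \<in> SGT n. reps H = reps (class_rep C)}"
proof -
  obtain G where G: "G \<in> SGT n" "C = {H \<in> SGT n. reps H = reps G}"
    using assms by (auto simp: SGT_classes_eq)
  then have "class_rep C \<in> C"
    unfolding class_rep_def by (metis (mono_tags, lifting) mem_Collect_eq someI_ex)
  with G show "class_rep C \<in> SGT n" "C = {H \<in> SGT n. reps H = reps (class_rep C)}"
    by auto
qed

lemma class_reps_disjoint:
  assumes C: "C \<in> SGT_classes n" "D \<in> SGT_classes n" and t: "t \<in> reps (class_rep C)" "t \<in> reps (class_rep D)"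
  shows "C = D"
proof -
  have "net_iso (class_rep C) (class_rep D)"
    using reps_iso class_rep(1) C t by blast
  then have "reps (class_rep C) = reps (class_rep D)"
    using iso_reps class_rep(1) C by blast
  then show ?thesis
    using class_rep(2) [OF C(1)] class_rep(2) [OF C(2)] by simp
qed

lemma reps_weights:
  assumes "G \<in> SGT n"
  shows "finite (reps G)" "(\<Sum>t\<in>reps G. wt t) = 1" "reps G \<noteq> {}"
proof -
  show "finite (reps G)" and sum: "(\<Sum>t\<in>reps G. wt t) = 1"
    using SGT_rep_weights [OF assms SGT_root [OF assms]] unfolding reps_def by blast+
  show "reps G \<noteq> {}"
    using sum by auto
qed

lemma finite_SGT_classes: "finite (SGT_classes n)"
proof (rule inj_on_finite)
  show "inj_on (\<lambda>C. reps (class_rep C)) (SGT_classes n)"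
  proof (rule inj_onI)
    fix C D assume C: "C \<in> SGT_classes n" "D \<in> SGT_classes n" and eq: "reps (class_rep C) = reps (class_rep D)"
    obtain t where "t \<in> reps (class_rep C)"
      using reps_weights(3) [OF class_rep(1) [OF C(1)]] by blast
    then show "C = D"
      using class_reps_disjoint [OF C] eq by blast
  qed
  show "(\<lambda>C. reps (class_rep C)) ` SGT_classes n \<subseteq> Pow (trees n)"
    using class_rep(1) reps_subset_trees by blast
  show "finite (Pow (trees n))"
    by (simp add: finite_trees)
qed

lemma trees_eq_Union: "n \<ge> 2 \<Longrightarrow> trees n = (\<Union>C\<in>SGT_classes n. reps (class_rep C))"
proof (intro equalityI subsetI)
  fix t assume "n \<ge> 2" "t \<in> trees n"
  then obtain G where G: "G \<in> SGT n" "t \<in> reps G"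
    using trees_reps by blast
  define C where "C = {H \<in> SGT n. reps H = reps G}"
  have C: "C \<in> SGT_classes n"
    using G by (auto simp: C_def SGT_classes_eq)
  have "G \<in> C"
    using G by (simp add: C_def)
  then have "reps G = reps (class_rep C)"
    using class_rep(2) [OF C] by blast
  then show "t \<in> (\<Union>C\<in>SGT_classes n. reps (class_rep C))"
    using C G by blast
next
  fix t assume "t \<in> (\<Union>C\<in>SGT_classes n. reps (class_rep C))"
  then show "t \<in> trees n"
    using class_rep(1) reps_subset_trees by blast
qed

lemma sum_over_classes:
  assumes n: "n \<ge> 2" and F: "\<And>G t. G \<in> SGT n \<Longrightarrow> t \<in> reps G \<Longrightarrow> S G = F t"
  shows "(\<Sum>C\<in>SGT_classes n. S (class_rep C)) = (\<Sum>t\<in>trees n. wt t * F t)"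
proof -
  have "(\<Sum>t\<in>trees n. wt t * F t) = (\<Sum>C\<in>SGT_classes n. \<Sum>t\<in>reps (class_rep C). wt t * F t)"
    unfolding trees_eq_Union [OF n]
  proof (rule sum.UNION_disjoint)
    show "\<forall>C\<in>SGT_classes n. \<forall>D\<in>SGT_classes n. C \<noteq> D \<longrightarrow> reps (class_rep C) \<inter> reps (class_rep D) = {}"
      using class_reps_disjoint by blast
  qed (use finite_SGT_classes reps_weights(1) class_rep(1) in blast)+
  also have "\<dots> = (\<Sum>C\<in>SGT_classes n. S (class_rep C))"
  proof (rule sum.cong [OF refl])
    fix C assume "C \<in> SGT_classes n"
    then have G: "class_rep C \<in> SGT n"
      by (rule class_rep(1))
    then have "(\<Sum>t\<in>reps (class_rep C). wt t * F t) = (\<Sum>t\<in>reps (class_rep C). wt t * S (class_rep C))"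
      using F by (intro sum.cong) auto
    also have "\<dots> = S (class_rep C)"
      unfolding sum_distrib_right [symmetric] reps_weights(2) [OF G] by simp
    finally show "(\<Sum>t\<in>reps (class_rep C). wt t * F t) = S (class_rep C)" .
  qed
  finally show ?thesis
    by simp
qed

lemma expect_uniform_trees:
  assumes n: "n \<ge> 2" and F: "\<And>G t. G \<in> SGT n \<Longrightarrow> t \<in> reps G \<Longrightarrow> real (S G) = F t"
  shows "expect_uniform n S = (\<Sum>t\<in>trees n. wt t * F t) / (fact n * fps_nth aser n)"
proof -
  have "(\<Sum>C\<in>SGT_classes n. real (S (class_rep C))) = (\<Sum>t\<in>trees n. wt t * F t)"
    by (rule sum_over_classes [OF n F])
  moreover have "(\<Sum>C\<in>SGT_classes n. (1 :: real)) = (\<Sum>t\<in>trees n. wt t * 1)"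
    by (rule sum_over_classes [OF n]) simp
  then have "real (card (SGT_classes n)) = fact n * fps_nth aser n"
    by (simp add: sum_wt_trees)
  ultimately show ?thesis
    by (simp add: expect_uniform_def class_rep_def)
qed

lemma S_trees:
  assumes "G \<in> SGT n" "t \<in> reps G"
  shows "S_plus G = (\<Sum>x=1..n. Max (plen t x))" "S_minus G = (\<Sum>x=1..n. Min (plen t x))"
proof -
  interpret sgt_net G by (rule SGT_sgt_net [OF assms(1)])
  have "root_path_lengths G x = plen t x" if "x \<in> {1..n}" for x
    using root_paths assms that SGT_leaves by (auto simp: reps_def)
  then show "S_plus G = (\<Sum>x=1..n. Max (plen t x))" "S_minus G = (\<Sum>x=1..n. Min (plen t x))"
    unfolding S_plus_def S_minus_def h_plus_def h_minus_def SGT_leaves [OF assms(1)] by simp_all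
qed

lemma trees_bounds:
  assumes "t \<in> trees n"
  shows "depths 0 t \<le> real (\<Sum>x=1..n. Min (plen t x))"
    "real (\<Sum>x=1..n. Min (plen t x)) \<le> real (\<Sum>x=1..n. Max (plen t x))"
    "real (\<Sum>x=1..n. Max (plen t x)) \<le> depths 1 t"
proof -
  obtain xs where xs: "ok None xs t" "set xs = {1..n}" "distinct xs"
    using assms by (auto simp: trees_def dest: permutations_of_setD)
  show "depths 0 t \<le> real (\<Sum>x=1..n. Min (plen t x))" "real (\<Sum>x=1..n. Max (plen t x)) \<le> depths 1 t"
    using depths_bounds [OF xs(1,3)] xs(2) by simp_all
  have "Min (plen t x) \<le> Max (plen t x)" if "x \<in> {1..n}" for x
  proof -
    have "plen t x \<noteq> {}"
      using plen_nonempty_iff [OF xs(1), of x] xs(2) that by simp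
    then show ?thesis
      using finite_plen [of t x] by (metis Max_in Min_le)
  qed
  then show "real (\<Sum>x=1..n. Min (plen t x)) \<le> real (\<Sum>x=1..n. Max (plen t x))"
    unfolding of_nat_le_iff by (rule sum_mono)
qed

lemma expect_bounds:
  assumes n: "n \<ge> 2"
  shows "expect_uniform n S_minus \<in> {fps_nth (pser 0) n / fps_nth aser n..fps_nth (pser 1) n / fps_nth aser n}"
    "expect_uniform n S_plus \<in> {fps_nth (pser 0) n / fps_nth aser n..fps_nth (pser 1) n / fps_nth aser n}"
proof -
  have nonneg: "fact n * fps_nth aser n \<ge> 0"
    unfolding sum_wt_trees [symmetric] by (intro sum_nonneg less_imp_le wt_pos)
  have depths: "fps_nth (pser \<theta>) n / fps_nth aser n = (\<Sum>t\<in>trees n. wt t * depths \<theta> t) / (fact n * fps_nth aser n)" for \<theta>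
    unfolding sum_depths_trees by simp
  have minus: "expect_uniform n S_minus = (\<Sum>t\<in>trees n. wt t * real (\<Sum>x=1..n. Min (plen t x))) / (fact n * fps_nth aser n)"
    by (rule expect_uniform_trees [OF n]) (simp only: S_trees(2))
  have plus: "expect_uniform n S_plus = (\<Sum>t\<in>trees n. wt t * real (\<Sum>x=1..n. Max (plen t x))) / (fact n * fps_nth aser n)"
    by (rule expect_uniform_trees [OF n]) (simp only: S_trees(1))
  have mono: "(\<Sum>t\<in>trees n. wt t * f t) / (fact n * fps_nth aser n) \<le> (\<Sum>t\<in>trees n. wt t * g t) / (fact n * fps_nth aser n)"
    if "\<And>t. t \<in> trees n \<Longrightarrow> f t \<le> g t" for f g
    using that nonneg wt_pos by (intro divide_right_mono sum_mono mult_left_mono) (auto intro: less_imp_le)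
  show "expect_uniform n S_minus \<in> {fps_nth (pser 0) n / fps_nth aser n..fps_nth (pser 1) n / fps_nth aser n}"
    unfolding depths minus atLeastAtMost_iff using trees_bounds by (intro conjI mono) (blast intro: order_trans)+
  show "expect_uniform n S_plus \<in> {fps_nth (pser 0) n / fps_nth aser n..fps_nth (pser 1) n / fps_nth aser n}"
    unfolding depths plus atLeastAtMost_iff using trees_bounds by (intro conjI mono) (blast intro: order_trans)+
qed

theorem theorem1p1:
  shows "((\<lambda>n. expect_uniform n S_plus) \<sim>[at_top]
           (\<lambda>n. sqrt ((2 + sqrt 2) / 2) * sqrt pi * real n powr (3/2)))
       \<and> ((\<lambda>n. expect_uniform n S_minus) \<sim>[at_top]
           (\<lambda>n. sqrt ((2 + sqrt 2) / 2) * sqrt pi * real n powr (3/2)))"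
proof
  have ev: "\<forall>\<^sub>F n in at_top. (2 :: nat) \<le> n"
    by (rule eventually_ge_at_top)
  show "(\<lambda>n. expect_uniform n S_plus) \<sim>[at_top] (\<lambda>n. sqrt ((2 + sqrt 2) / 2) * sqrt pi * real n powr (3/2))"
    by (rule asymp_equiv_sandwich_real [OF pser_aser_ratio pser_aser_ratio])
       (rule eventually_mono [OF ev expect_bounds(2)])
  show "(\<lambda>n. expect_uniform n S_minus) \<sim>[at_top] (\<lambda>n. sqrt ((2 + sqrt 2) / 2) * sqrt pi * real n powr (3/2))"
    by (rule asymp_equiv_sandwich_real [OF pser_aser_ratio pser_aser_ratio])
       (rule eventually_mono [OF ev expect_bounds(1)])
qed

end
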